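(* There is a randomized two-pass streaming algorithm which, given a stream $S\in\Sigma^n$, reports with high probability (probability at least $1-1/n$) the value $\ell_{\max}$ and the midpoints $m$ of all palindromes with $\ell(m)=\ell_{\max}$. The algorithm makes two passes over $S$, uses $O(n)$ total time and $O(\sqrt n)$ space.
   Context: Streaming model: the input is a string $S=S[1]\cdots S[n]$ over an alphabet $\Sigma\subset\mathbb N$, read from left to right (each pass reads the whole stream once); working memory is limited, output space is unlimited. Space is measured in registers of $O(\log n)$ bits. Palindromes are considered in their even form: $S$ contains a palindrome of length $\ell$ with midpoint $m$ if $S[m-i+1]=S[m+i]$ for all $i\in\{1,\dots,\ell\}$ (indices within $\{1,\dots,n\}$). For an index $m$, $\ell(m)$ is the maximal such $\ell$, and $\ell_{\max}=\max_m \ell(m)$ is the length of a longest palindrome in $S$. *)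

theory Defs
  imports "HOL-Probability.Probability_Mass_Function" "HOL-Library.Landau_Symbols"
begin

text \<open>Indices are 1-based as usual for strings: \<open>S[j]\<close> is \<open>S ! (j - 1)\<close>, so \<open>S[m - i + 1]\<close>
  and \<open>S[m + i]\<close> below are \<open>S ! (m - i)\<close> and \<open>S ! (m + i - 1)\<close>.  The guards \<open>i \<le> m\<close> and
  \<open>m + i \<le> length S\<close> say that both indices lie in \<open>{1..length S}\<close>.\<close>

definition palindrome_at :: "'a list \<Rightarrow> nat \<Rightarrow> nat \<Rightarrow> bool" where
  "palindrome_at S m l \<longleftrightarrow>
     (\<forall>i\<in>{1..l}. i \<le> m \<and> m + i \<le> length S \<and> S ! (m - i) = S ! (m + i - 1))"

definition pal_length :: "'a list \<Rightarrow> nat \<Rightarrow> nat" where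
  "pal_length S m = Max {l. palindrome_at S m l}"

definition max_pal_length :: "'a list \<Rightarrow> nat" where
  "max_pal_length S = Max (pal_length S ` {1..length S})"

lemma palindrome_at_0: "palindrome_at S m 0"
  by (simp add: palindrome_at_def)

lemma finite_palindromes_at: "finite {l. palindrome_at S m l}"
proof (rule finite_subset)
  show "{l. palindrome_at S m l} \<subseteq> {..m}"
  proof
    fix l assume "l \<in> {l. palindrome_at S m l}"
    then show "l \<in> {..m}" by (cases "l = 0") (auto simp: palindrome_at_def)
  qed
qed simp

definition correct_report :: "'a list \<Rightarrow> nat list \<Rightarrow> bool" where
  "correct_report S out \<longleftrightarrow>
     (\<exists>ms. out = max_pal_length S # ms \<and>
           set ms = {m \<in> {1..length S}. pal_length S m = max_pal_length S})"


text \<open>Randomized streaming algorithms are while-programs on a unit-cost random access machine.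
  Registers are addressed by natural numbers.  A program is a fixed finite object that does not
  depend on the input; its only indirect accesses are \<open>Load\<close> and \<open>Store\<close>.\<close>

datatype arith_op = Plus | Minus | Times | Divide | Modulo

datatype prog =
    Skip
  | Const nat nat
  | Arith arith_op nat nat nat
  | Load nat nat
  | Store nat nat
  | Read nat
  | Random nat nat
  | Emit nat
  | Seq prog prog
  | Cond nat prog prog
  | While nat prog

text \<open>The field \<open>todo\<close> is the stack of program parts still to be executed, \<open>stream\<close> the part of
  the input that has not been read yet, and \<open>emitted\<close> the contents of a write-only output tape.\<close>

record config =
  todo :: "prog list"
  mem :: "nat \<Rightarrow> nat"
  stream :: "nat list"
  emitted :: "nat list"

fun arith :: "arith_op \<Rightarrow> nat \<Rightarrow> nat \<Rightarrow> nat" where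
  "arith Plus x y = x + y"
| "arith Minus x y = x - y"
| "arith Times x y = x * y"
| "arith Divide x y = x div y"
| "arith Modulo x y = x mod y"

definition set_reg :: "nat \<Rightarrow> nat \<Rightarrow> config \<Rightarrow> config" where
  "set_reg r x c = c\<lparr>mem := (mem c)(r := x)\<rparr>"

text \<open>Execution of the program part on top of the stack, which has already been popped from \<open>c\<close>.
  Reading from the exhausted stream yields 0; \<open>Random r q\<close> draws uniformly from the numbers below
  the contents of register \<open>q\<close> (and yields 0 if there are none).\<close>

fun exec :: "prog \<Rightarrow> config \<Rightarrow> config pmf" where
  "exec Skip c = return_pmf c"
| "exec (Const r x) c = return_pmf (set_reg r x c)"
| "exec (Arith f r p q) c = return_pmf (set_reg r (arith f (mem c p) (mem c q)) c)"
| "exec (Load r q) c = return_pmf (set_reg r (mem c (mem c q)) c)"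
| "exec (Store r q) c = return_pmf (set_reg (mem c r) (mem c q) c)"
| "exec (Read r) c = return_pmf
     (case stream c of [] \<Rightarrow> set_reg r 0 c | x # xs \<Rightarrow> set_reg r x (c\<lparr>stream := xs\<rparr>))"
| "exec (Random r q) c =
     (if mem c q = 0 then return_pmf (set_reg r 0 c)
      else map_pmf (\<lambda>x. set_reg r x c) (pmf_of_set {..<mem c q}))"
| "exec (Emit r) c = return_pmf (c\<lparr>emitted := emitted c @ [mem c r]\<rparr>)"
| "exec (Seq P Q) c = return_pmf (c\<lparr>todo := P # Q # todo c\<rparr>)"
| "exec (Cond r P Q) c =
     return_pmf (c\<lparr>todo := (if mem c r \<noteq> 0 then P else Q) # todo c\<rparr>)"
| "exec (While r P) c =
     return_pmf (if mem c r \<noteq> 0 then c\<lparr>todo := P # While r P # todo c\<rparr> else c)"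

definition step :: "config \<Rightarrow> config pmf" where
  "step c = (case todo c of [] \<Rightarrow> return_pmf c | P # Ps \<Rightarrow> exec P (c\<lparr>todo := Ps\<rparr>))"

primrec steps :: "nat \<Rightarrow> config \<Rightarrow> config pmf" where
  "steps 0 c = return_pmf c"
| "steps (Suc t) c = bind_pmf (step c) (steps t)"

text \<open>A \<open>k\<close>-pass algorithm is offered the whole stream \<open>k\<close> times in succession, and \<open>Read\<close> is the
  only way to access it.  Initially register 0 holds the length of the stream and all other
  registers hold 0.\<close>

definition start :: "nat \<Rightarrow> prog \<Rightarrow> nat list \<Rightarrow> config" where
  "start k P S =
     \<lparr>todo = [P], mem = (\<lambda>_. 0)(0 := length S), stream = concat (replicate k S), emitted = []\<rparr>"

text \<open>Resource bounds are required for every outcome of the random choices: the program halts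
  within \<open>t\<close> unit-cost steps, and at any time it stores its data in the registers below \<open>s\<close>, each of
  which holds a number of at most \<open>b\<close> bits.\<close>

definition halts_within :: "nat \<Rightarrow> config \<Rightarrow> bool" where
  "halts_within t c0 \<longleftrightarrow> (\<forall>c\<in>set_pmf (steps t c0). todo c = [])"

definition uses_space :: "nat \<Rightarrow> nat \<Rightarrow> config \<Rightarrow> bool" where
  "uses_space s b c0 \<longleftrightarrow>
     (\<forall>t. \<forall>c\<in>set_pmf (steps t c0). \<forall>a. mem c a \<noteq> 0 \<longrightarrow> a < s \<and> mem c a < 2 ^ b)"

text \<open>Halting configurations are fixed points of \<open>step\<close>, so for a program halting within \<open>t\<close> steps
  this is the distribution of its final output.\<close>

definition output_after :: "nat \<Rightarrow> config \<Rightarrow> nat list pmf" where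
  "output_after t c0 = map_pmf emitted (steps t c0)"

end

(*
  Let L be the length of the longest palindrome ending at or before the current position i.
  It grows by at most one per step, and it grows exactly if the factor of length 2(L + 1) ending
  at i is a palindrome.  That test compares two prefix hashes at i with two at i - 2L - 2, but only
  O(sqrt n) old hashes can be kept.  The first pass keeps those at every B-th position, where B is
  about sqrt n; testing only palindromes with left end at such a position determines L up to B
  (and exactly if L < 8B, where a window of recent hashes suffices).  In the second pass the left
  ends to be tested are then known to lie in blocks of length B that the first pass has flagged.
  Three long palindromes with close centres force a periodic run, over which the middle one
  extends; hence flagged blocks are sparse and at any time only 32 of them have to be remembered.

  The hashes are numerals in a base M modulo a product of 24 random primes found by trial division.
  A wrong comparison requires every one of these primes to divide a fixed nonzero number of
  O(n log n) bits.
*)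

theory Submission
  imports Defs "HOL-Number_Theory.Number_Theory" "HOL-Probability.Probability" "HOL-Real_Asymp.Real_Asymp"
begin

section \<open>Executing programs\<close>

text \<open>Only the modulus is random. A fixed base \<open>M\<close> above every symbol makes the
  unreduced hashes injective, so a factor that is no palindrome yields a nonzero difference, and
  once the modulus is \<open>faithful\<close> both passes are deterministic.

  All sizes derive from \<open>root4 n\<close>: \<open>B\<close> is its square and \<open>y\<close>
  a constant multiple of it. Drawing \<open>y\<close> numbers below \<open>y ^ 6\<close> and trying
  \<open>y ^ 3\<close> divisors on each costs \<open>y ^ 4\<close>, which is linear. A single prime
  fails with probability at most \<open>y powr (-1/2)\<close>; 24 of them leave at most
  \<open>1 / n ^ 3\<close>, enough for a union bound over \<open>n ^ 2\<close> factors of the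
  stream.

  The output needs two regimes. If L < 8B, there may be linearly many longest palindromes, so they
  must be emitted at once; this is possible since L is then known exactly after the first pass.
  Otherwise L may still grow in the second pass, but there are only O(B) centres, which are buffered
  until the end.

  Resource bounds must hold for bad moduli too and cannot rely on what the hashes mean: values are
  reduced modulo \<open>M\<close>, array writes are range-checked and loop counters are
  capped.\<close>

definition safe :: "nat \<Rightarrow> nat \<Rightarrow> config \<Rightarrow> bool" where
  "safe s b c \<longleftrightarrow> (\<forall>a. mem c a \<noteq> 0 \<longrightarrow> a < s \<and> mem c a < 2 ^ b)"

text \<open>Demanding the same outcome at every \<open>N \<ge> T\<close>, and not only at
  \<open>T\<close>, lets running times be relaxed, so that branches of different length can share
  one bound.\<close>

definition finishes :: "nat \<Rightarrow> nat \<Rightarrow> nat \<Rightarrow> config \<Rightarrow> nat list pmf \<Rightarrow> bool" where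
  "finishes s b T c out \<longleftrightarrow>
     (\<forall>t. \<forall>c'\<in>set_pmf (steps t c). safe s b c') \<and>
     (\<forall>N\<ge>T. (\<forall>c'\<in>set_pmf (steps N c). todo c' = []) \<and> map_pmf emitted (steps N c) = out)"

lemma safe_todo [simp]: "safe s b (c\<lparr>todo := x\<rparr>) = safe s b c"
  by (simp add: safe_def)

lemma steps_halted: "todo c = [] \<Longrightarrow> steps t c = return_pmf c"
  by (induction t) (simp_all add: step_def bind_return_pmf)

lemma finishes_halted:
  assumes "todo c = []" "safe s b c"
  shows "finishes s b T c (return_pmf (emitted c))"
  using assms by (simp add: finishes_def steps_halted)

lemma finishes_mono: "finishes s b T c out \<Longrightarrow> T \<le> T' \<Longrightarrow> finishes s b T' c out"
  unfolding finishes_def by (meson order_trans)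

lemma finishes_step:
  assumes "safe s b c" and "\<And>c'. c' \<in> set_pmf (step c) \<Longrightarrow> finishes s b T c' (out c')"
  shows "finishes s b (Suc T) c (bind_pmf (step c) out)"
  unfolding finishes_def
proof (intro conjI allI ballI impI)
  fix t c' assume "c' \<in> set_pmf (steps t c)"
  then show "safe s b c'"
    using assms by (cases t) (auto simp: finishes_def)
next
  fix N c' assume "Suc T \<le> N" and c': "c' \<in> set_pmf (steps N c)"
  then obtain N' where N: "N = Suc N'" "T \<le> N'"
    by (cases N) auto
  then show "todo c' = []"
    using assms c' by (auto simp: finishes_def)
next
  fix N assume "Suc T \<le> N"
  then obtain N' where N: "N = Suc N'" "T \<le> N'"
    by (cases N) auto
  then show "map_pmf emitted (steps N c) = bind_pmf (step c) out"
    using assms by (auto simp: map_bind_pmf finishes_def intro!: bind_pmf_cong)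
qed

text \<open>Continuation-passing form: whatever code remains on the stack, its behaviour
  from the configurations drawn from \<open>D\<close> determines the behaviour from \<open>c\<close>.\<close>

definition runs :: "nat \<Rightarrow> nat \<Rightarrow> nat \<Rightarrow> prog \<Rightarrow> config \<Rightarrow> config pmf \<Rightarrow> bool" where
  "runs s b k P c D \<longleftrightarrow>
     (\<forall>Ps T out. (\<forall>c'\<in>set_pmf D. finishes s b T (c'\<lparr>todo := Ps\<rparr>) (out c')) \<longrightarrow>
        finishes s b (k + T) (c\<lparr>todo := P # Ps\<rparr>) (bind_pmf D out))"

lemma runsI:
  assumes "\<And>Ps T out. (\<And>c'. c' \<in> set_pmf D \<Longrightarrow> finishes s b T (c'\<lparr>todo := Ps\<rparr>) (out c')) \<Longrightarrow>
        finishes s b (k + T) (c\<lparr>todo := P # Ps\<rparr>) (bind_pmf D out)"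
  shows "runs s b k P c D"
  using assms unfolding runs_def by blast

lemma runsD:
  assumes "runs s b k P c D"
    and "\<And>c'. c' \<in> set_pmf D \<Longrightarrow> finishes s b T (c'\<lparr>todo := Ps\<rparr>) (out c')"
  shows "finishes s b (k + T) (c\<lparr>todo := P # Ps\<rparr>) (bind_pmf D out)"
  using assms unfolding runs_def by blast

lemma runs_mono: "runs s b k P c D \<Longrightarrow> k \<le> k' \<Longrightarrow> runs s b k' P c D"
  unfolding runs_def by (meson add_le_mono1 finishes_mono)

lemma runs_Seq:
  assumes "safe s b c" "runs s b k1 P c D" "\<And>c'. c' \<in> set_pmf D \<Longrightarrow> runs s b k2 Q c' (E c')"
  shows "runs s b (Suc (k1 + k2)) (Seq P Q) c (bind_pmf D E)"
proof (rule runsI)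
  fix Ps T out
  assume *: "\<And>c'. c' \<in> set_pmf (bind_pmf D E) \<Longrightarrow> finishes s b T (c'\<lparr>todo := Ps\<rparr>) (out c')"
  have "finishes s b (k1 + (k2 + T)) (c\<lparr>todo := P # Q # Ps\<rparr>) (bind_pmf D (\<lambda>c'. bind_pmf (E c') out))"
    using * by (intro runsD[OF assms(2)] runsD[OF assms(3)]) auto
  then have "finishes s b (Suc (k1 + (k2 + T))) (c\<lparr>todo := Seq P Q # Ps\<rparr>)
      (bind_pmf (step (c\<lparr>todo := Seq P Q # Ps\<rparr>)) (\<lambda>_. bind_pmf D (\<lambda>c'. bind_pmf (E c') out)))"
    using assms(1) by (intro finishes_step) (auto simp: step_def)
  then show "finishes s b (Suc (k1 + k2) + T) (c\<lparr>todo := Seq P Q # Ps\<rparr>) (bind_pmf (bind_pmf D E) out)"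
    by (simp add: bind_assoc_pmf add_ac)
qed

lemma runs_Seq_return:
  assumes "safe s b c" "runs s b k1 P c (return_pmf c1)" "runs s b k2 Q c1 D"
  shows "runs s b (Suc (k1 + k2)) (Seq P Q) c D"
  using runs_Seq[OF assms(1,2), where E = "\<lambda>_. D"] assms(3) by (simp add: bind_return_pmf)

primrec kernel_power :: "nat \<Rightarrow> ('a \<Rightarrow> 'a pmf) \<Rightarrow> 'a \<Rightarrow> 'a pmf" where
  "kernel_power 0 f x = return_pmf x"
| "kernel_power (Suc n) f x = bind_pmf (f x) (kernel_power n f)"

lemma kernel_power_return: "kernel_power n (\<lambda>x. return_pmf (g x)) x = return_pmf ((g ^^ n) x)"
  by (induction n arbitrary: x) (simp_all add: bind_return_pmf funpow_swap1)

text \<open>The invariant pins the counter \<open>v\<close> to \<open>n - j\<close> on every random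
  outcome. The number of rounds is thus deterministic, and the loop is an \<open>n\<close>-fold
  iteration of the kernel of its body.\<close>

lemma runs_While:
  assumes body: "\<And>j c. j < n \<Longrightarrow> I j c \<Longrightarrow> runs s b k P c (f c)"
    and inv: "\<And>j c c'. j < n \<Longrightarrow> I j c \<Longrightarrow> c' \<in> set_pmf (f c) \<Longrightarrow> I (Suc j) c'"
    and I: "\<And>j c. I j c \<Longrightarrow> mem c v = n - j \<and> safe s b c"
    and "I 0 c"
  shows "runs s b (n * Suc k + 1) (While v P) c (kernel_power n f c)"
proof -
  \<comment> \<open>Induction on the number \<open>m\<close> of rounds left; the invariant is then
    at stage \<open>n - m\<close>.\<close>
  have "runs s b (m * Suc k + 1) (While v P) c (kernel_power m f c)" if "I (n - m) c" "m \<le> n" for m c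
    using that
  proof (induction m arbitrary: c)
    case 0
    then have c: "mem c v = 0" "safe s b c" using I by auto
    show ?case
    proof (rule runsI)
      fix Ps T out
      assume *: "\<And>c'. c' \<in> set_pmf (kernel_power 0 f c) \<Longrightarrow> finishes s b T (c'\<lparr>todo := Ps\<rparr>) (out c')"
      have "finishes s b (Suc T) (c\<lparr>todo := While v P # Ps\<rparr>)
         (bind_pmf (step (c\<lparr>todo := While v P # Ps\<rparr>)) (\<lambda>_. out c))"
        using * c by (intro finishes_step) (auto simp: step_def)
      then show "finishes s b (0 * Suc k + 1 + T) (c\<lparr>todo := While v P # Ps\<rparr>)
           (bind_pmf (kernel_power 0 f c) out)"
        by (simp add: bind_return_pmf)
    qed
  next
    case (Suc m)
    then have c: "mem c v \<noteq> 0" "safe s b c" using I[of "n - Suc m" c] by auto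
    have less: "n - Suc m < n" using Suc by simp
    have next_inv: "I (n - m) c'" if "c' \<in> set_pmf (f c)" for c'
      using inv[OF less Suc.prems(1) that] Suc.prems(2) by (simp add: Suc_diff_Suc)
    show ?case
    proof (rule runsI)
      fix Ps T out
      assume *: "\<And>c'. c' \<in> set_pmf (kernel_power (Suc m) f c) \<Longrightarrow> finishes s b T (c'\<lparr>todo := Ps\<rparr>) (out c')"
      have "finishes s b (k + (m * Suc k + 1 + T)) (c\<lparr>todo := P # While v P # Ps\<rparr>)
          (bind_pmf (f c) (\<lambda>c'. bind_pmf (kernel_power m f c') out))"
        using * Suc.prems(2)
        by (intro runsD[OF body[OF less Suc.prems(1)]] runsD[OF Suc.IH[OF next_inv]]) auto
      then have "finishes s b (Suc (k + (m * Suc k + 1 + T))) (c\<lparr>todo := While v P # Ps\<rparr>)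
         (bind_pmf (step (c\<lparr>todo := While v P # Ps\<rparr>)) (\<lambda>_. bind_pmf (f c) (\<lambda>c'. bind_pmf (kernel_power m f c') out)))"
        using c by (intro finishes_step) (auto simp: step_def)
      then show "finishes s b (Suc m * Suc k + 1 + T) (c\<lparr>todo := While v P # Ps\<rparr>)
           (bind_pmf (kernel_power (Suc m) f c) out)"
        by (simp add: bind_return_pmf bind_assoc_pmf add_ac)
    qed
  qed
  from this[of n c] show ?thesis using \<open>I 0 c\<close> by simp
qed

section \<open>Straight-line programs and the size of the numbers they produce\<close>

fun straight :: "prog \<Rightarrow> bool" where
  "straight (Random r q) = False"
| "straight (While r P) = False"
| "straight (Seq P Q) = (straight P \<and> straight Q)"
| "straight (Cond r P Q) = (straight P \<and> straight Q)"
| "straight _ = True"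

fun sem :: "prog \<Rightarrow> config \<Rightarrow> config" where
  "sem (Const r x) c = set_reg r x c"
| "sem (Arith f r p q) c = set_reg r (arith f (mem c p) (mem c q)) c"
| "sem (Load r q) c = set_reg r (mem c (mem c q)) c"
| "sem (Store r q) c = set_reg (mem c r) (mem c q) c"
| "sem (Read r) c =
     (case stream c of [] \<Rightarrow> set_reg r 0 c | x # xs \<Rightarrow> set_reg r x (c\<lparr>stream := xs\<rparr>))"
| "sem (Emit r) c = c\<lparr>emitted := emitted c @ [mem c r]\<rparr>"
| "sem (Seq P Q) c = sem Q (sem P c)"
| "sem (Cond r P Q) c = (if mem c r \<noteq> 0 then sem P c else sem Q c)"
| "sem _ c = c"

text \<open>An upper bound on the steps: \<open>Cond\<close> pays for both branches, which makes the
  cost independent of the data.\<close>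

fun cost :: "prog \<Rightarrow> nat" where
  "cost (Seq P Q) = Suc (cost P + cost Q)"
| "cost (Cond r P Q) = Suc (cost P + cost Q)"
| "cost _ = 1"

fun max_const :: "prog \<Rightarrow> nat" where
  "max_const (Const r x) = x"
| "max_const (Seq P Q) = max (max_const P) (max_const Q)"
| "max_const (Cond r P Q) = max (max_const P) (max_const Q)"
| "max_const _ = 0"

text \<open>Depends on the configuration since the target of \<open>Store\<close> is known only at
  run time.\<close>

fun writes_below :: "nat \<Rightarrow> prog \<Rightarrow> config \<Rightarrow> bool" where
  "writes_below s (Const r x) c = (r < s)"
| "writes_below s (Arith f r p q) c = (r < s)"
| "writes_below s (Load r q) c = (r < s)"
| "writes_below s (Store r q) c = (mem c r < s)"
| "writes_below s (Read r) c = (r < s)"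
| "writes_below s (Seq P Q) c = (writes_below s P c \<and> writes_below s Q (sem P c))"
| "writes_below s (Cond r P Q) c = (if mem c r \<noteq> 0 then writes_below s P c else writes_below s Q c)"
| "writes_below s _ c = True"

text \<open>The stream is included because \<open>Read\<close> moves its symbols into
  registers.\<close>

definition bounded :: "nat \<Rightarrow> nat \<Rightarrow> config \<Rightarrow> bool" where
  "bounded s X c \<longleftrightarrow> (\<forall>a. mem c a < X) \<and> (\<forall>a\<ge>s. mem c a = 0) \<and> (\<forall>x\<in>set (stream c). x < X)"

lemma bounded_mono: "bounded s X c \<Longrightarrow> X \<le> Y \<Longrightarrow> bounded s Y c"
  unfolding bounded_def by (meson order_less_le_trans)

lemma bounded_todo [simp]: "bounded s X (c\<lparr>todo := x\<rparr>) = bounded s X c"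
  by (simp add: bounded_def)

lemma bounded_safe: "bounded s X c \<Longrightarrow> X \<le> 2 ^ b \<Longrightarrow> safe s b c"
  unfolding bounded_def safe_def by (meson linorder_not_less order_less_le_trans)

lemma arith_less_square:
  assumes "2 \<le> X" "x < X" "y < X"
  shows "arith f x y < X\<^sup>2"
proof -
  have X: "X \<le> X\<^sup>2" "2 * X \<le> X\<^sup>2" using assms(1) by (auto simp: power2_eq_square)
  show ?thesis
  proof (cases f)
    case Times
    then show ?thesis using assms by (auto simp: power2_eq_square intro: mult_strict_mono)
  next
    case Divide
    then show ?thesis using assms X div_le_dividend[of x y] by (simp del: div_le_dividend)
  next
    case Modulo
    then show ?thesis using assms X mod_less_eq_dividend[of x y] by (simp del: mod_less_eq_dividend)
  qed (use assms X in auto)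
qed

lemma bounded_square: "2 \<le> X \<Longrightarrow> bounded s X c \<Longrightarrow> bounded s (X\<^sup>2) c"
  by (rule bounded_mono) (auto simp: power2_eq_square)

lemma bounded_set_reg:
  assumes "2 \<le> X" "bounded s X c" "r < s" "x < X\<^sup>2"
  shows "bounded s (X\<^sup>2) (set_reg r x c)"
  using bounded_square[OF assms(1,2)] assms(3,4) by (auto simp: bounded_def set_reg_def)

text \<open>One instruction at most squares the bound, multiplication being the worst case. A
  program of constant cost therefore multiplies the word length by a constant only.\<close>

lemma bounded_sem:
  assumes "straight P" "max_const P < X" "2 \<le> X" "bounded s X c" "writes_below s P c"
  shows "bounded s (X ^ (2 ^ cost P)) (sem P c)"
  using assms
proof (induction P arbitrary: X c)
  case (Seq P Q)
  have ge: "X \<le> X ^ (2 ^ cost P)" using Seq.prems(3) by (simp add: self_le_power)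
  have "bounded s ((X ^ (2 ^ cost P)) ^ (2 ^ cost Q)) (sem Q (sem P c))"
    using Seq.prems ge by (intro Seq.IH) auto
  moreover have "(X ^ (2 ^ cost P)) ^ (2 ^ cost Q) \<le> X ^ (2 ^ cost (Seq P Q))"
    using Seq.prems(3) by (auto simp: power_add simp flip: power_mult intro!: power_increasing)
  ultimately show ?case by (simp add: bounded_mono)
next
  case (Cond r P Q)
  have "(2::nat) ^ cost P \<le> 2 ^ cost (Cond r P Q)" "(2::nat) ^ cost Q \<le> 2 ^ cost (Cond r P Q)"
    by (auto intro: power_increasing simp del: power_Suc)
  then have "X ^ (2 ^ cost P) \<le> X ^ (2 ^ cost (Cond r P Q))" "X ^ (2 ^ cost Q) \<le> X ^ (2 ^ cost (Cond r P Q))"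
    using Cond.prems(3) by (auto intro: power_increasing simp del: power_Suc cost.simps)
  from bounded_mono[OF Cond.IH(1) this(1)] bounded_mono[OF Cond.IH(2) this(2)] show ?case
    using Cond.prems by auto
next
  case (Const r x)
  then have "x < X" "X \<le> X\<^sup>2" by (auto simp: power2_eq_square)
  then show ?case using Const by (auto intro!: bounded_set_reg)
next
  case (Arith f r p q)
  then have "mem c p < X" "mem c q < X" by (auto simp: bounded_def)
  then show ?case using Arith by (auto intro!: bounded_set_reg arith_less_square)
next
  case (Load r q)
  then have "mem c (mem c q) < X" "X \<le> X\<^sup>2" by (auto simp: bounded_def power2_eq_square)
  then show ?case using Load by (auto intro!: bounded_set_reg)
next
  case (Store r q)
  then have "mem c q < X" "X \<le> X\<^sup>2" by (auto simp: bounded_def power2_eq_square)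
  then show ?case using Store by (auto intro!: bounded_set_reg)
next
  case (Read r)
  have X: "X \<le> X\<^sup>2" "0 < X" using Read by (auto simp: power2_eq_square)
  show ?case
  proof (cases "stream c")
    case Nil
    then show ?thesis using Read X by (auto intro!: bounded_set_reg)
  next
    case (Cons x xs)
    then have "x < X" "bounded s X (c\<lparr>stream := xs\<rparr>)" using Read by (auto simp: bounded_def)
    then show ?thesis using Read X Cons by (auto intro!: bounded_set_reg)
  qed
qed (use bounded_square in \<open>auto simp: bounded_def power2_eq_square intro: less_le_trans\<close>)

lemma finishes_det_step:
  assumes "safe s b c" "step c = return_pmf c'" "finishes s b T c' out"
  shows "finishes s b (Suc T) c out"
  using finishes_step[of s b c T "\<lambda>_. out"] assms by (simp add: bind_return_pmf)

lemma step_basic: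
  assumes "straight P" "\<And>Q R. P \<noteq> Seq Q R" "\<And>r Q R. P \<noteq> Cond r Q R"
  shows "step (c\<lparr>todo := P # Ps\<rparr>) = return_pmf (sem P c\<lparr>todo := Ps\<rparr>)"
  using assms by (cases c; cases P) (auto simp: step_def set_reg_def split: list.splits)

text \<open>Intermediate configurations must be safe too, so the bound is passed on from one piece
  of the program to the next; all of them stay within \<open>X ^ (2 ^ cost P)\<close>.\<close>

lemma finishes_sem:
  assumes "straight P" "max_const P < X" "2 \<le> X" "bounded s X c" "writes_below s P c"
    and "X ^ (2 ^ cost P) \<le> 2 ^ b" and "finishes s b T (sem P c\<lparr>todo := Ps\<rparr>) out"
  shows "finishes s b (cost P + T) (c\<lparr>todo := P # Ps\<rparr>) out"
  using assms
proof (induction P arbitrary: X c T Ps)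
  case (Seq P Q)
  have ge: "X \<le> X ^ (2 ^ cost P)" using Seq.prems(3) by (simp add: self_le_power)
  have le: "(X ^ (2 ^ cost P)) ^ (2 ^ cost Q) \<le> X ^ (2 ^ cost (Seq P Q))"
    using Seq.prems(3) by (auto simp: power_add simp flip: power_mult intro!: power_increasing)
  have "(2::nat) ^ cost P \<le> 2 ^ cost (Seq P Q)"
    by (auto intro: power_increasing simp del: power_Suc)
  then have le': "X ^ (2 ^ cost P) \<le> X ^ (2 ^ cost (Seq P Q))"
    using Seq.prems(3) by (auto intro: power_increasing simp del: power_Suc cost.simps)
  have b: "bounded s (X ^ (2 ^ cost P)) (sem P c)"
    using Seq.prems by (intro bounded_sem) auto
  have le_b: "X ^ (2 ^ cost P) \<le> 2 ^ b"
    using le' Seq.prems(6) by (rule order_trans)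
  have "finishes s b (cost Q + T) (sem P c\<lparr>todo := Q # Ps\<rparr>) out"
    using Seq.prems ge b le by (intro Seq.IH(2)[where X = "X ^ (2 ^ cost P)"]) auto
  then have "finishes s b (cost P + (cost Q + T)) (c\<lparr>todo := P # Q # Ps\<rparr>) out"
    using Seq.prems le_b by (intro Seq.IH(1)[where X = X]) auto
  moreover have "safe s b c"
    using Seq.prems order_trans[OF ge le_b] by (intro bounded_safe[of s X]) auto
  ultimately show ?case
    by (auto intro!: finishes_det_step simp: step_def add_ac)
next
  case (Cond r P Q)
  have "(2::nat) ^ cost P \<le> 2 ^ cost (Cond r P Q)" "(2::nat) ^ cost Q \<le> 2 ^ cost (Cond r P Q)"
    by (auto intro: power_increasing simp del: power_Suc)
  then have le: "X ^ (2 ^ cost P) \<le> X ^ (2 ^ cost (Cond r P Q))" "X ^ (2 ^ cost Q) \<le> X ^ (2 ^ cost (Cond r P Q))"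
      "X \<le> X ^ (2 ^ cost (Cond r P Q))"
    using Cond.prems(3)
    by (auto intro: power_increasing self_le_power simp del: power_Suc cost.simps)
  note le_b = le[THEN order_trans, OF Cond.prems(6)]
  have s: "safe s b c"
    using Cond.prems le_b by (intro bounded_safe[of s X]) auto
  show ?case
  proof (cases "mem c r \<noteq> 0")
    case True
    have "finishes s b (cost P + T) (c\<lparr>todo := P # Ps\<rparr>) out"
      using Cond.prems le_b True by (intro Cond.IH(1)[where X = X]) auto
    then have "finishes s b (cost P + cost Q + T) (c\<lparr>todo := P # Ps\<rparr>) out"
      by (rule finishes_mono) simp
    then show ?thesis using True s
      by (auto intro!: finishes_det_step simp: step_def add_ac)
  next
    case False
    have "finishes s b (cost Q + T) (c\<lparr>todo := Q # Ps\<rparr>) out"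
      using Cond.prems le_b False by (intro Cond.IH(2)[where X = X]) auto
    then have "finishes s b (cost P + cost Q + T) (c\<lparr>todo := Q # Ps\<rparr>) out"
      by (rule finishes_mono) simp
    then show ?thesis using False s
      by (auto intro!: finishes_det_step simp: step_def add_ac)
  qed
qed (auto intro!: finishes_det_step bounded_safe[OF bounded_square] step_basic)

lemma runs_straight:
  assumes "straight P" "max_const P < X" "2 \<le> X" "bounded s X c" "writes_below s P c"
    and "X ^ (2 ^ cost P) \<le> 2 ^ b"
  shows "runs s b (cost P) P c (return_pmf (sem P c))"
  using finishes_sem[OF assms] by (intro runsI) (auto simp: bind_return_pmf)

lemma runs_Random:
  assumes "safe s b c" "mem c q \<noteq> 0"
  shows "runs s b 1 (Random r q) c (map_pmf (\<lambda>x. set_reg r x c) (pmf_of_set {..<mem c q}))"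
proof (rule runsI)
  fix Ps T out
  let ?D = "map_pmf (\<lambda>x. set_reg r x c) (pmf_of_set {..<mem c q})"
  let ?c = "c\<lparr>todo := Random r q # Ps\<rparr>"
  assume *: "\<And>c'. c' \<in> set_pmf ?D \<Longrightarrow> finishes s b T (c'\<lparr>todo := Ps\<rparr>) (out c')"
  have st: "step ?c = map_pmf (\<lambda>x. set_reg r x c\<lparr>todo := Ps\<rparr>) (pmf_of_set {..<mem c q})"
    using assms(2) by (cases c) (simp add: step_def set_reg_def)
  have ne: "finite {..<mem c q}" "{..<mem c q} \<noteq> {}" using assms(2) by (auto simp: lessThan_empty_iff)
  \<comment> \<open>The continuation \<open>out\<close> expects the configuration without the
    remaining stack, while \<open>step\<close> delivers it with \<open>Ps\<close>. The drawn number
    is recovered from register \<open>r\<close> by injectivity, and the configuration is rebuilt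
    from it.\<close>
  have inj: "the_inv_into {..<mem c q} (\<lambda>x. set_reg r x c\<lparr>todo := Ps\<rparr>) (set_reg r x c\<lparr>todo := Ps\<rparr>) = x"
    if "x < mem c q" for x
    using that
    by (intro the_inv_into_f_f) (auto simp: inj_on_def set_reg_def dest!: arg_cong[where f = "\<lambda>c. mem c r"])
  have "finishes s b (Suc T) ?c (bind_pmf (step ?c)
     (\<lambda>c'. out (set_reg r (the_inv_into {..<mem c q} (\<lambda>x. set_reg r x c\<lparr>todo := Ps\<rparr>) c') c)))"
    using * assms ne by (intro finishes_step) (auto simp: st inj)
  also have "bind_pmf (step ?c)
     (\<lambda>c'. out (set_reg r (the_inv_into {..<mem c q} (\<lambda>x. set_reg r x c\<lparr>todo := Ps\<rparr>) c') c)) = bind_pmf ?D out"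
    unfolding st bind_map_pmf using ne by (intro bind_pmf_cong) (auto simp: inj)
  finally show "finishes s b (1 + T) ?c (bind_pmf ?D out)" by simp
qed

section \<open>A compiler for structured commands\<close>

datatype expr = Num nat | Var nat | Op arith_op expr expr | Cell nat expr

text \<open>Sixteen interleaved arrays: their length may depend on the input although the layout
  uses fixed constants only.\<close>

definition addr :: "nat \<Rightarrow> nat \<Rightarrow> nat" where
  "addr f i = 64 + 16 * i + f"

fun eval :: "expr \<Rightarrow> (nat \<Rightarrow> nat) \<Rightarrow> nat" where
  "eval (Num x) m = x"
| "eval (Var v) m = m v"
| "eval (Op f e1 e2) m = arith f (eval e1 m) (eval e2 m)"
| "eval (Cell f e) m = m (addr f (eval e m))"

text \<open>Stack discipline: an expression evaluated at depth \<open>d\<close> uses the temporaries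
  from \<open>d\<close> upwards, and the tests against 64 keep it out of the arrays.\<close>

fun fits :: "nat \<Rightarrow> expr \<Rightarrow> bool" where
  "fits d (Num x) = (d < 64)"
| "fits d (Var v) = (v < 32 \<and> d < 64)"
| "fits d (Op f e1 e2) = (fits d e1 \<and> fits (Suc d) e2)"
| "fits d (Cell f e) = (fits d e \<and> f < 16 \<and> Suc d < 64)"

text \<open>Registers below 32 are program variables, those from 32 to 63 hold temporary values, and
  cell \<open>i\<close> of array \<open>f < 16\<close> is register \<open>addr f i\<close>.\<close>

fun compile_expr :: "nat \<Rightarrow> expr \<Rightarrow> prog" where
  "compile_expr d (Num x) = Const d x"
| "compile_expr d (Var v) = Seq (Const d 0) (Arith Plus d v d)"
| "compile_expr d (Op f e1 e2) =
     Seq (compile_expr d e1) (Seq (compile_expr (Suc d) e2) (Arith f d d (Suc d)))"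
| "compile_expr d (Cell f e) =
     Seq (compile_expr d e) (Seq (Const (Suc d) 16) (Seq (Arith Times d d (Suc d))
       (Seq (Const (Suc d) (64 + f)) (Seq (Arith Plus d d (Suc d)) (Load d d)))))"

lemma straight_compile_expr [simp]: "straight (compile_expr d e)"
  by (induction e arbitrary: d) auto

lemma mem_update_eqI: "(\<And>a. f a = g a) \<Longrightarrow> c\<lparr>mem := f\<rparr> = c\<lparr>mem := g\<rparr>"
  by (simp add: ext)

lemma eval_cong:
  assumes "fits d e" "\<And>a. a < 32 \<or> 64 \<le> a \<Longrightarrow> m a = m' a"
  shows "eval e m = eval e m'"
  using assms(1)
proof (induction e arbitrary: d)
  case (Op f e1 e2)
  then show ?case by (metis eval.simps(3) fits.simps(3))
next
  case (Cell f e)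
  then have "eval e m = eval e m'" by auto
  then show ?case using assms(2) by (simp add: addr_def)
qed (use assms(2) in auto)

lemma fits_less: "fits d e \<Longrightarrow> d < 64"
  by (induction e arbitrary: d) (simp, simp, metis fits.simps(3), simp)

lemma sem_compile_expr:
  assumes "fits d e" "32 \<le> d" "64 \<le> s"
  shows "writes_below s (compile_expr d e) c \<and>
    (\<exists>m'. sem (compile_expr d e) c = c\<lparr>mem := m'\<rparr> \<and> m' d = eval e (mem c) \<and>
          (\<forall>a. a < d \<or> 64 \<le> a \<longrightarrow> m' a = mem c a))"
  using assms(1,2)
proof (induction e arbitrary: d c)
  case (Num x)
  show ?case using Num assms(3) by (intro conjI exI[of _ "(mem c)(d := x)"]) (auto simp: set_reg_def intro!: mem_update_eqI)
next
  case (Var v)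
  show ?case using Var assms(3)
    by (intro conjI exI[of _ "(mem c)(d := mem c v)"]) (auto simp: set_reg_def intro!: mem_update_eqI)
next
  case (Op f e1 e2)
  obtain m1 where m1: "writes_below s (compile_expr d e1) c" "sem (compile_expr d e1) c = c\<lparr>mem := m1\<rparr>"
      "m1 d = eval e1 (mem c)" "\<And>a. a < d \<or> 64 \<le> a \<Longrightarrow> m1 a = mem c a"
    using Op.IH(1)[of d c] Op.prems by auto
  obtain m2 where m2: "writes_below s (compile_expr (Suc d) e2) (c\<lparr>mem := m1\<rparr>)"
      "sem (compile_expr (Suc d) e2) (c\<lparr>mem := m1\<rparr>) = c\<lparr>mem := m2\<rparr>"
      "m2 (Suc d) = eval e2 m1" "\<And>a. a < Suc d \<or> 64 \<le> a \<Longrightarrow> m2 a = m1 a"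
    using Op.IH(2)[of "Suc d" "c\<lparr>mem := m1\<rparr>"] Op.prems by auto
  have d: "d < 64" using Op.prems by (auto dest: fits_less)
  have "eval e2 m1 = eval e2 (mem c)"
    using Op.prems by (intro eval_cong[of "Suc d"]) (auto simp: m1)
  then show ?case using m1 m2 d assms(3)
    by (intro conjI exI[of _ "m2(d := arith f (eval e1 (mem c)) (eval e2 (mem c)))"])
       (auto simp: set_reg_def intro!: mem_update_eqI)
next
  case (Cell f e)
  obtain m1 where m1: "writes_below s (compile_expr d e) c" "sem (compile_expr d e) c = c\<lparr>mem := m1\<rparr>"
      "m1 d = eval e (mem c)" "\<And>a. a < d \<or> 64 \<le> a \<Longrightarrow> m1 a = mem c a"
    using Cell.IH[of d c] Cell.prems by auto
  have "m1 (addr f (eval e (mem c))) = mem c (addr f (eval e (mem c)))"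
    by (rule m1(4)) (simp add: addr_def)
  then show ?case using m1 Cell.prems assms(3)
    by (intro conjI exI[of _ "m1(d := mem c (addr f (eval e (mem c))), Suc d := 64 + f)"])
       (auto simp: set_reg_def addr_def algebra_simps intro!: mem_update_eqI)
qed

text \<open>Zeroing the temporaries after each command makes compiled code end in exactly the
  configuration \<open>den p c\<close>, so that commands can be treated by equations between
  configurations.\<close>

definition clear_temps :: prog where
  "clear_temps = foldr (\<lambda>r. Seq (Const r 0)) [32..<64] Skip"

definition no_temps :: "(nat \<Rightarrow> nat) \<Rightarrow> bool" where
  "no_temps m \<longleftrightarrow> (\<forall>a\<in>{32..<64}. m a = 0)"

lemma sem_clears:
  "sem (foldr (\<lambda>r. Seq (Const r 0)) rs Skip) c = c\<lparr>mem := \<lambda>a. if a \<in> set rs then 0 else mem c a\<rparr>"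
  by (induction rs arbitrary: c) (auto simp: set_reg_def fun_eq_iff)

lemma sem_clear_temps:
  assumes "\<And>a. a < 32 \<or> 64 \<le> a \<Longrightarrow> mem c a = m a" "no_temps m"
  shows "sem clear_temps c = c\<lparr>mem := m\<rparr>"
proof -
  have "(if a \<in> {32..<64} then 0 else mem c a) = m a" for a
    using assms unfolding no_temps_def by (cases "a < 32 \<or> 64 \<le> a") auto
  then show ?thesis unfolding clear_temps_def sem_clears set_upt by simp
qed

lemma clear_temps_simps [simp]:
  "straight clear_temps" "64 \<le> s \<Longrightarrow> writes_below s clear_temps c"
proof -
  have "straight (foldr (\<lambda>r. Seq (Const r 0)) rs Skip)" for rs
    by (induction rs) auto
  then show "straight clear_temps" by (simp add: clear_temps_def)
  have "(\<forall>r\<in>set rs. r < s) \<Longrightarrow> writes_below s (foldr (\<lambda>r. Seq (Const r 0)) rs Skip) c" for rs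
    by (induction rs arbitrary: c) auto
  then show "64 \<le> s \<Longrightarrow> writes_below s clear_temps c" unfolding clear_temps_def by auto
qed

definition move :: "nat \<Rightarrow> expr \<Rightarrow> prog" where
  "move v e = Seq (compile_expr 32 e) (Seq (Const 33 0) (Seq (Arith Plus v 32 33) clear_temps))"

lemma sem_move:
  assumes "fits 32 e" "v < 32" "64 \<le> s" "no_temps (mem c)"
  shows "sem (move v e) c = c\<lparr>mem := (mem c)(v := eval e (mem c))\<rparr> \<and> writes_below s (move v e) c"
proof -
  obtain m where m: "writes_below s (compile_expr 32 e) c" "sem (compile_expr 32 e) c = c\<lparr>mem := m\<rparr>"
      "m 32 = eval e (mem c)" "\<And>a. a < 32 \<or> 64 \<le> a \<Longrightarrow> m a = mem c a"
    using sem_compile_expr[OF assms(1) _ assms(3), of c] by auto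
  let ?c = "c\<lparr>mem := m(33 := 0, v := eval e (mem c))\<rparr>"
  have "sem clear_temps ?c = ?c\<lparr>mem := (mem c)(v := eval e (mem c))\<rparr>"
    using m(4) assms by (intro sem_clear_temps) (auto simp: no_temps_def)
  then show ?thesis unfolding move_def
    using m assms by (auto simp: set_reg_def)
qed

text \<open>Variable 2 holds a bound on all numbers the program works with.  Every assignment is reduced
  modulo this bound, so the space analysis needs no information about the computed values; likewise
  variable 1 limits the array indices that can be written to.\<close>

datatype com =
    Nop
  | Assign nat expr
  | Put nat expr expr
  | Input nat
  | Output expr
  | Then com com (infixr ";;" 60)
  | Branch expr com com

fun den :: "com \<Rightarrow> config \<Rightarrow> config" where
  "den Nop c = c"
| "den (Assign v e) c = c\<lparr>mem := (mem c)(v := eval e (mem c) mod mem c 2)\<rparr>"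
| "den (Put f e1 e2) c = (if eval e1 (mem c) < mem c 1
     then c\<lparr>mem := (mem c)(addr f (eval e1 (mem c)) := eval e2 (mem c) mod mem c 2)\<rparr> else c)"
| "den (Input v) c = sem (Read v) c"
| "den (Output e) c = c\<lparr>emitted := emitted c @ [eval e (mem c)]\<rparr>"
| "den (p ;; q) c = den q (den p c)"
| "den (Branch e p q) c = (if eval e (mem c) \<noteq> 0 then den p c else den q c)"

definition variable :: "nat \<Rightarrow> bool" where
  "variable v \<longleftrightarrow> 2 < v \<and> v < 32"

fun wf_com :: "com \<Rightarrow> bool" where
  "wf_com Nop = True"
| "wf_com (Assign v e) = (variable v \<and> fits 32 e)"
| "wf_com (Put f e1 e2) = (f < 16 \<and> fits 33 e1 \<and> fits 33 e2)"
| "wf_com (Input v) = variable v"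
| "wf_com (Output e) = fits 32 e"
| "wf_com (p ;; q) = (wf_com p \<and> wf_com q)"
| "wf_com (Branch e p q) = (fits 32 e \<and> wf_com p \<and> wf_com q)"

fun compile :: "com \<Rightarrow> prog" where
  "compile Nop = Skip"
| "compile (Assign v e) = move v (Op Modulo e (Var 2))"
| "compile (Put f e1 e2) = Seq (compile_expr 32 (Op Minus (Var 1) e1))
     (Cond 32
       (Seq (compile_expr 32 (Op Plus (Op Times (Num 16) e1) (Num (64 + f))))
         (Seq (compile_expr 33 (Op Modulo e2 (Var 2))) (Seq (Store 32 33) clear_temps)))
       clear_temps)"
| "compile (Input v) = Read v"
| "compile (Output e) = Seq (compile_expr 32 e) (Seq (Emit 32) clear_temps)"
| "compile (p ;; q) = Seq (compile p) (compile q)"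
| "compile (Branch e p q) = Seq (compile_expr 32 e)
     (Cond 32 (Seq clear_temps (compile p)) (Seq clear_temps (compile q)))"

lemma straight_move [simp]: "straight (move v e)"
  by (simp add: move_def)

lemma straight_compile [simp]: "straight (compile p)"
  by (induction p) auto

text \<open>\<open>n\<close>, \<open>l\<close> and \<open>M\<close> are the contents of the variables 0, 1 and 2, which no command changes.\<close>

definition regular :: "nat \<Rightarrow> nat \<Rightarrow> nat \<Rightarrow> nat \<Rightarrow> config \<Rightarrow> bool" where
  "regular s n l M c \<longleftrightarrow> mem c 0 = n \<and> mem c 1 = l \<and> mem c 2 = M \<and> 0 < M \<and> 64 + 16 * l \<le> s \<and>
     no_temps (mem c) \<and> bounded s (Suc M) c"

lemma fits_Suc: "fits (Suc d) e \<Longrightarrow> fits d e"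
  by (induction e arbitrary: d) auto

lemma sem_compile:
  assumes "wf_com p" "no_temps (mem c)" "64 + 16 * mem c 1 \<le> s"
  shows "sem (compile p) c = den p c \<and> no_temps (mem (den p c)) \<and> mem (den p c) 1 = mem c 1 \<and>
    writes_below s (compile p) c"
  using assms
proof (induction p arbitrary: c)
  case (Assign v e)
  then show ?case using sem_move[of "Op Modulo e (Var 2)" v s c]
    by (auto simp: variable_def no_temps_def)
next
  case (Put f e1 e2)
  let ?m = "mem c"
  have s: "64 \<le> s" using Put.prems by simp
  obtain m1 where m1: "writes_below s (compile_expr 32 (Op Minus (Var 1) e1)) c"
      "sem (compile_expr 32 (Op Minus (Var 1) e1)) c = c\<lparr>mem := m1\<rparr>"
      "m1 32 = ?m 1 - eval e1 ?m" "\<And>a. a < 32 \<or> 64 \<le> a \<Longrightarrow> m1 a = ?m a"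
    using sem_compile_expr[of 32 "Op Minus (Var 1) e1" s c] Put.prems s by auto
  let ?e = "Op Plus (Op Times (Num 16) e1) (Num (64 + f))"
  obtain m2 where m2: "writes_below s (compile_expr 32 ?e) (c\<lparr>mem := m1\<rparr>)"
      "sem (compile_expr 32 ?e) (c\<lparr>mem := m1\<rparr>) = c\<lparr>mem := m2\<rparr>"
      "m2 32 = eval ?e m1" "\<And>a. a < 32 \<or> 64 \<le> a \<Longrightarrow> m2 a = m1 a"
    using sem_compile_expr[of 32 ?e s "c\<lparr>mem := m1\<rparr>"] Put.prems s by auto
  let ?f = "Op Modulo e2 (Var 2)"
  obtain m3 where m3: "writes_below s (compile_expr 33 ?f) (c\<lparr>mem := m2\<rparr>)"
      "sem (compile_expr 33 ?f) (c\<lparr>mem := m2\<rparr>) = c\<lparr>mem := m3\<rparr>"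
      "m3 33 = eval ?f m2" "\<And>a. a < 33 \<or> 64 \<le> a \<Longrightarrow> m3 a = m2 a"
    using sem_compile_expr[of 33 ?f s "c\<lparr>mem := m2\<rparr>"] Put.prems s fits_Suc by (auto simp: numeral_eq_Suc)
  have e1: "eval e1 m1 = eval e1 ?m"
    using Put.prems by (intro eval_cong[of 33]) (auto simp: m1)
  have "eval e2 m2 = eval e2 ?m"
    using Put.prems by (intro eval_cong[of 33]) (auto simp: m1 m2)
  then have m3': "m3 32 = addr f (eval e1 ?m)" "m3 33 = eval e2 ?m mod ?m 2"
      "\<And>a. a < 32 \<or> 64 \<le> a \<Longrightarrow> m3 a = ?m a"
    using m1 m2 m3 e1 by (auto simp: addr_def)
  show ?case
  proof (cases "eval e1 ?m < ?m 1")
    case True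
    then have a: "64 \<le> addr f (eval e1 ?m)" "addr f (eval e1 ?m) < s"
      using Put.prems by (auto simp: addr_def)
    let ?m' = "?m(addr f (eval e1 ?m) := eval e2 ?m mod ?m 2)"
    let ?c = "c\<lparr>mem := m3(addr f (eval e1 ?m) := eval e2 ?m mod ?m 2)\<rparr>"
    have "no_temps ?m'" using a Put.prems by (auto simp: no_temps_def)
    moreover from this have "sem clear_temps ?c = ?c\<lparr>mem := ?m'\<rparr>"
      using m3' by (intro sem_clear_temps) auto
    ultimately show ?thesis using True m1 m2 m3 m3' s a Put.prems
      by (auto simp: set_reg_def no_temps_def)
  next
    case False
    moreover have "sem clear_temps (c\<lparr>mem := m1\<rparr>) = c"
      using m1(4) Put.prems by (subst sem_clear_temps[of _ ?m]) auto
    ultimately show ?thesis using m1 s Put.prems by auto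
  qed
next
  case (Input v)
  then show ?case by (auto simp: set_reg_def no_temps_def variable_def split: list.splits)
next
  case (Output e)
  have s: "64 \<le> s" using Output.prems by simp
  obtain m where m: "writes_below s (compile_expr 32 e) c" "sem (compile_expr 32 e) c = c\<lparr>mem := m\<rparr>"
      "m 32 = eval e (mem c)" "\<And>a. a < 32 \<or> 64 \<le> a \<Longrightarrow> m a = mem c a"
    using sem_compile_expr[of 32 e s c] Output.prems by auto
  moreover have "sem clear_temps (c\<lparr>mem := m, emitted := x\<rparr>) = c\<lparr>emitted := x\<rparr>" for x
    using m(4) Output.prems by (subst sem_clear_temps[of _ "mem c"]) auto
  ultimately show ?case using s Output.prems by auto
next
  case (Branch e p q)
  have s: "64 \<le> s" using Branch.prems by simp
  obtain m where m: "writes_below s (compile_expr 32 e) c" "sem (compile_expr 32 e) c = c\<lparr>mem := m\<rparr>"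
      "m 32 = eval e (mem c)" "\<And>a. a < 32 \<or> 64 \<le> a \<Longrightarrow> m a = mem c a"
    using sem_compile_expr[of 32 e s c] Branch.prems by auto
  have "sem clear_temps (c\<lparr>mem := m\<rparr>) = c"
    using m(4) Branch.prems by (subst sem_clear_temps[of _ "mem c"]) auto
  then show ?case using m s Branch.prems Branch.IH[of c] by auto
qed auto

lemma regular_den:
  assumes "wf_com p" "regular s n l M c"
  shows "regular s n l M (den p c)"
  using assms
proof (induction p arbitrary: c)
  case (Assign v e)
  have "eval e (mem c) mod M < Suc M" using Assign by (simp add: regular_def less_SucI)
  then show ?case using Assign
    by (auto simp: regular_def no_temps_def bounded_def variable_def)
next
  case (Put f e1 e2)
  have "eval e2 (mem c) mod M < Suc M" using Put by (simp add: regular_def less_SucI)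
  then show ?case using Put
    by (auto simp: regular_def no_temps_def bounded_def addr_def)
next
  case (Input v)
  then show ?case
    by (auto simp: regular_def no_temps_def bounded_def variable_def set_reg_def split: list.splits)
next
  case (Output e)
  then show ?case by (auto simp: regular_def bounded_def)
qed auto

text \<open>Inside a command numbers may grow to \<open>Suc M ^ (2 ^ cost (compile p))\<close>, but
  by \<open>regular_den\<close> they are below \<open>Suc M\<close> again at its end. Hence the word
  length does not grow with the number of loop rounds.\<close>

lemma runs_compile:
  assumes "wf_com p" "regular s n l M c" "max_const (compile p) \<le> M"
    and "Suc M ^ (2 ^ cost (compile p)) \<le> 2 ^ b"
  shows "runs s b (cost (compile p)) (compile p) c (return_pmf (den p c))"
proof -
  have *: "sem (compile p) c = den p c" "writes_below s (compile p) c"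
    using sem_compile[OF assms(1), of c s] assms(2) by (auto simp: regular_def)
  show ?thesis
    using runs_straight[of "compile p" "Suc M" s c b] assms * by (auto simp: regular_def)
qed

section \<open>Periods and palindromes\<close>

definition periodic :: "(nat \<Rightarrow> 'a) \<Rightarrow> nat \<Rightarrow> nat \<Rightarrow> nat \<Rightarrow> bool" where
  "periodic s p lo hi \<longleftrightarrow> (\<forall>j. lo \<le> j \<and> j + p < hi \<longrightarrow> s j = s (j + p))"

lemma periodicD: "periodic s p lo hi \<Longrightarrow> lo \<le> j \<Longrightarrow> j + p < hi \<Longrightarrow> s j = s (j + p)"
  by (auto simp: periodic_def)

lemma periodic_subset: "periodic s p lo hi \<Longrightarrow> lo \<le> lo' \<Longrightarrow> hi' \<le> hi \<Longrightarrow> periodic s p lo' hi'"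
  by (auto simp: periodic_def)

lemma periodic_mult:
  assumes "periodic s p lo hi" "lo \<le> x" "x + k * p < hi"
  shows "s x = s (x + k * p)"
  using assms(3)
proof (induction k)
  case (Suc k)
  then have "s x = s (x + k * p)" by simp
  also have "\<dots> = s (x + k * p + p)"
    using assms(2) Suc.prems by (intro periodicD[OF assms(1)]) auto
  finally show ?case by (simp add: add_ac)
qed simp

lemma periodic_cong:
  assumes "periodic s p lo hi" "lo \<le> x" "x < hi" "lo \<le> y" "y < hi" "[x = y] (mod p)"
  shows "s x = s y"
proof -
  have *: "s x = s y" if "lo \<le> x" "y < hi" "x \<le> y" "[x = y] (mod p)" for x y
  proof -
    have "p dvd y - x"
      using that(3,4) mod_eq_dvd_iff_nat[of x y p] by (simp add: Cong.cong_def)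
    with that(3) obtain k where y: "y = x + k * p"
      by (metis dvdE le_add_diff_inverse mult.commute)
    show ?thesis
      unfolding y by (rule periodic_mult[OF assms(1) that(1) that(2)[unfolded y]])
  qed
  show ?thesis
  proof (cases "x \<le> y")
    case True
    then show ?thesis using assms by (intro *) auto
  next
    case False
    then have "s y = s x" using assms by (intro *) (auto simp: Cong.cong_def)
    then show ?thesis by (rule sym)
  qed
qed

lemma ex_cong_in_window:
  fixes lo p x :: nat
  assumes "0 < p"
  obtains x' where "lo \<le> x'" "x' < lo + p" "[x' = x] (mod p)"
proof
  \<comment> \<open>\<open>x + p * lo\<close> is congruent to \<open>x\<close> and at least
    \<open>lo\<close> as \<open>0 < p\<close>; this avoids a truncated difference.\<close>
  define x' where "x' = lo + (x + p * lo - lo) mod p"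
  show "lo \<le> x'" "x' < lo + p" using assms by (auto simp: x'_def)
  have "[lo + (x + p * lo - lo) mod p = lo + (x + p * lo - lo)] (mod p)"
    by (intro cong_add) (auto simp: Cong.cong_def)
  also have "lo + (x + p * lo - lo) = x + p * lo"
    using assms by (cases p) auto
  also have "[x + p * lo = x] (mod p)" unfolding Cong.cong_def by (rule mod_mult_self2)
  finally show "[x' = x] (mod p)" by (simp add: x'_def)
qed

text \<open>A weak form of the Fine-Wilf theorem, by Euclid's algorithm with subtraction: in a run
  of length at least \<open>p + q\<close>, two periods \<open>q < p\<close> make
  \<open>p - q\<close> a period.\<close>

lemma periodic_gcd:
  assumes "periodic s p lo hi" "periodic s q lo hi" "0 < p" "0 < q" "lo + p + q \<le> hi"
  shows "periodic s (gcd p q) lo hi"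
  using assms
proof (induction "p + q" arbitrary: p q rule: less_induct)
  case less
  have *: "periodic s (p - q) lo hi"
    if "periodic s p lo hi" "periodic s q lo hi" "q < p" "lo + p + q \<le> hi" for p q
    unfolding periodic_def
  proof (intro allI impI)
    fix j assume j: "lo \<le> j \<and> j + (p - q) < hi"
    show "s j = s (j + (p - q))"
    \<comment> \<open>Step right by \<open>p\<close> and back by \<open>q\<close> if there is room.
      Otherwise \<open>j\<close> is at least \<open>lo + q\<close>, and the step to the left comes
      first.\<close>
    proof (cases "j + p < hi")
      case True
      then have "s j = s (j + p)" using j by (intro periodicD[OF that(1)]) auto
      moreover have "s (j + (p - q)) = s (j + (p - q) + q)"
        using that(3) j True by (intro periodicD[OF that(2)]) auto
      moreover have "j + (p - q) + q = j + p" using that(3) by simp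
      ultimately show ?thesis by metis
    next
      case False
      have "s (j - q) = s (j - q + q)"
        using that(3,4) j False by (intro periodicD[OF that(2)]) auto
      moreover have "s (j - q) = s (j - q + p)"
        using that(3,4) j False by (intro periodicD[OF that(1)]) auto
      moreover have "j - q + q = j" "j - q + p = j + (p - q)"
        using False that by auto
      ultimately show ?thesis by metis
    qed
  qed
  show ?case
  proof (cases p q rule: linorder_cases)
    case less' : less
    have "periodic s (gcd p (q - p)) lo hi"
      using less.prems less' by (intro less.hyps *[of q p]) auto
    then show ?thesis using less' by (metis gcd.commute gcd_diff1_nat less_imp_le_nat)
  next
    case greater
    have "periodic s (gcd (p - q) q) lo hi"
      using less.prems greater by (intro less.hyps *[of p q]) auto
    then show ?thesis using greater by (simp add: gcd_diff1_nat)
  qed (use less.prems in simp)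
qed

text \<open>Each position of the long run is moved by multiples of \<open>p\<close> into the inner
  window, which spans a full period. There \<open>g\<close> applies, and \<open>g dvd p\<close>
  ensures that the residue modulo \<open>g\<close> has not changed.\<close>

lemma periodic_extend:
  assumes "periodic s p lo hi" "g dvd p" "0 < p" "periodic s g lo' hi'" "lo \<le> lo'" "hi' \<le> hi" "lo' + p \<le> hi'"
  shows "periodic s g lo hi"
  unfolding periodic_def
proof (intro allI impI)
  fix j assume j: "lo \<le> j \<and> j + g < hi"
  obtain x where x: "lo' \<le> x" "x < lo' + p" "[x = j] (mod p)"
    by (rule ex_cong_in_window[OF assms(3)])
  obtain y where y: "lo' \<le> y" "y < lo' + p" "[y = j + g] (mod p)"
    by (rule ex_cong_in_window[OF assms(3)])
  have "x mod p mod g = j mod p mod g" "y mod p mod g = (j + g) mod p mod g"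
    using x(3) y(3) by (simp_all only: Cong.cong_def)
  then have "[x = y] (mod g)"
    by (simp add: mod_mod_cancel[OF assms(2)] Cong.cong_def)
  then have "s x = s y" using x y assms(5-7) by (intro periodic_cong[OF assms(4)]) auto
  moreover have "s x = s j" using x assms(5-7) j by (intro periodic_cong[OF assms(1)]) auto
  moreover have "s y = s (j + g)" using y assms(5-7) j by (intro periodic_cong[OF assms(1)]) auto
  ultimately show "s j = s (j + g)" by metis
qed

text \<open>\<open>m\<close> counts the symbols left of the centre, which is the 1-based midpoint.
  The right end is left open; that a palindrome lies in the part read so far is stated separately as
  \<open>m + l \<le> i\<close>.\<close>

definition centered :: "(nat \<Rightarrow> 'a) \<Rightarrow> nat \<Rightarrow> nat \<Rightarrow> bool" where
  "centered s m l \<longleftrightarrow> l \<le> m \<and> (\<forall>i<l. s (m - 1 - i) = s (m + i))"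

lemma centered_mono: "centered s m l \<Longrightarrow> l' \<le> l \<Longrightarrow> centered s m l'"
  by (auto simp: centered_def)

lemma centered_0 [simp]: "centered s m 0"
  by (simp add: centered_def)

lemma centered_reflect:
  assumes "centered s m l" "m - l \<le> x" "x < m + l" "x + y + 1 = 2 * m"
  shows "s x = s y"
proof -
  have *: "s x = s y" if "m \<le> x" "x < m + l" "x + y + 1 = 2 * m" for x y
  proof -
    have "x - m < l" using that(1,2) by simp
    then have "s (m - 1 - (x - m)) = s (m + (x - m))"
      using assms(1)[unfolded centered_def, THEN conjunct2, rule_format, of "x - m"] by blast
    moreover have "m - 1 - (x - m) = y" "m + (x - m) = x" using that by auto
    ultimately show ?thesis by metis
  qed
  show ?thesis
  proof (cases "m \<le> x")
    case True
    then show ?thesis using assms(3,4) by (intro *)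
  next
    case False
    then have "m \<le> y" "y < m + l"
      using assms by (auto simp: centered_def)
    then have "s y = s x" using assms(4) by (intro *) auto
    then show ?thesis by (rule sym)
  qed
qed

text \<open>Reflecting in one centre and then in the other is a translation by twice their
  distance.\<close>

lemma periodic_if_centered:
  assumes "centered s (u + l) l" "centered s (u + l + a) l"
  shows "periodic s (2 * a) u (u + 2 * l + a)"
  unfolding periodic_def
proof (intro allI impI)
  fix j assume j: "u \<le> j \<and> j + 2 * a < u + 2 * l + a"
  obtain r where r: "j + r + 1 = 2 * (u + l)"
    using j that[of "2 * (u + l) - 1 - j"] by auto
  have "s j = s r"
    using j r by (intro centered_reflect[OF assms(1)]) auto
  moreover have "s (j + 2 * a) = s r"
    using j r by (intro centered_reflect[OF assms(2)]) auto
  ultimately show "s j = s (j + 2 * a)" by metis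
qed

text \<open>Two palindromes centred close to each other force a period on their union; with three of
  them, the middle one extends over this whole periodic run.\<close>

lemma centered_middle:
  assumes c1: "centered s m1 l" and c2: "centered s m2 l" and c3: "centered s m3 l"
    and m: "m1 < m2" "m2 < m3" "m3 \<le> m1 + l" and d: "m1 + d \<le> m2" "m2 + d \<le> m3"
  shows "centered s m2 (l + d)"
proof -
  obtain u where u: "m1 = u + l" using c1 by (auto simp: centered_def le_iff_add add_ac)
  obtain a where a: "m2 = u + l + a" "0 < a" using m u by (auto simp: less_iff_Suc_add)
  obtain b where b: "m3 = u + a + l + b" "0 < b" using m a by (auto simp: less_iff_Suc_add)
  define g where "g = gcd (2 * a) (2 * b)"
  have g: "g dvd 2 * a" "g dvd 2 * b" "0 < g" "g \<le> 2 * a"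
    using a b by (auto simp: g_def intro!: dvd_imp_le)
  have ab: "a + b \<le> l" "d \<le> a" "d \<le> b" using m d u a b by auto
  have p1: "periodic s (2 * a) u (u + 2 * l + a)"
    using c1 c2 u a by (intro periodic_if_centered) auto
  have p2: "periodic s (2 * b) (u + a) (u + a + 2 * l + b)"
    using c2 c3 u a b by (intro periodic_if_centered) (auto simp: add_ac)
  \<comment> \<open>Both periods hold on the extent of the middle palindrome. Its size
    \<open>2 * l\<close> is at least \<open>2 * a + 2 * b\<close> because the outer centres are at
    most \<open>l\<close> apart, so \<open>periodic_gcd\<close> applies.\<close>
  have core: "periodic s g (u + a) (u + a + 2 * l)" unfolding g_def
    using ab a b by (intro periodic_gcd periodic_subset[OF p1] periodic_subset[OF p2]) auto
  have g1: "periodic s g u (u + 2 * l + a)"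
    using ab a g by (intro periodic_extend[OF p1 _ _ core]) auto
  have g2: "periodic s g (u + a) (u + a + 2 * l + b)"
    using ab b g by (intro periodic_extend[OF p2 _ _ core]) auto
  have "s z = s (m2 + i)" if i: "i < l + d" "z + i + 1 = m2" for i z
  proof (cases "i < l")
    case True
    then show ?thesis using a i by (intro centered_reflect[OF c2]) auto
  next
    case False
    \<comment> \<open>Beyond the known palindrome: shift the right position into it by multiples of
      \<open>g\<close>, reflect there, and shift back out on the left.\<close>
    obtain x where x: "u + a \<le> x" "x < u + a + g" "[x = m2 + i] (mod g)"
      by (rule ex_cong_in_window[OF g(3)])
    have xhi: "x < u + a + 2 * l" using x g ab by linarith
    obtain y where y: "x + y + 1 = 2 * m2" "u + a \<le> y" "y < u + a + 2 * l"
      using x xhi a that[of "2 * m2 - 1 - x"] by auto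
    have "s x = s y" using x xhi y a by (intro centered_reflect[OF c2]) auto
    moreover have "s x = s (m2 + i)"
      using x xhi i a ab by (intro periodic_cong[OF g2]) auto
    moreover have "s y = s z"
    proof (rule periodic_cong[OF g1])
      have "x + y = (m2 + i) + z" using y i by simp
      then have "[(m2 + i) + y = (m2 + i) + z] (mod g)"
        using x(3) by (metis Cong.cong_def mod_add_left_eq)
      then show "[y = z] (mod g)"
        by (simp only: cong_add_lcancel_nat)
    qed (use y i a ab False in auto)
    ultimately show ?thesis by metis
  qed
  moreover have "l + d \<le> m2" using a ab by simp
  ultimately show ?thesis unfolding centered_def by simp
qed

section \<open>Counting centres and flagged blocks in windows\<close>

lemma card_windows:
  fixes F :: "nat set"
  assumes "\<And>x. card (F \<inter> {x<..x + w}) \<le> k"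
  shows "card (F \<inter> {x<..x + r * w}) \<le> r * k"
proof (induction r)
  case (Suc r)
  have "F \<inter> {x<..x + Suc r * w} \<subseteq> (F \<inter> {x<..x + r * w}) \<union> (F \<inter> {x + r * w<..x + r * w + w})"
    by (auto simp: not_le add_ac)
  then have "card (F \<inter> {x<..x + Suc r * w}) \<le>
      card ((F \<inter> {x<..x + r * w}) \<union> (F \<inter> {x + r * w<..x + r * w + w}))"
    by (intro card_mono) auto
  also have "\<dots> \<le> r * k + k"
    using Suc assms[of "x + r * w"] by (intro order_trans[OF card_Un_le] add_mono)
  finally show ?case by simp
qed simp

text \<open>The elements of rank \<open>0\<close>, \<open>d\<close> and \<open>2 * d\<close> in
  increasing order.\<close>

lemma three_in_set:
  fixes A :: "nat set"
  assumes "finite A" "2 * d < card A"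
  shows "\<exists>x\<in>A. \<exists>y\<in>A. \<exists>z\<in>A. x + d \<le> y \<and> y + d \<le> z"
proof -
  let ?xs = "sorted_list_of_set A"
  have step: "?xs ! i + j \<le> ?xs ! (i + j)" if "i + j < card A" for i j
    using that
  proof (induction j)
    case (Suc j)
    have "?xs ! (i + j) < ?xs ! Suc (i + j)"
      using Suc.prems strict_sorted_list_of_set[of A] by (intro sorted_wrt_nth_less[of "(<)"]) auto
    then show ?case using Suc by simp
  qed simp
  have mem: "?xs ! i \<in> A" if "i < card A" for i
    using that assms(1) by (metis nth_mem length_sorted_list_of_set set_sorted_list_of_set)
  show ?thesis
    using step[of 0 d] step[of d d] mem[of 0] mem[of d] mem[of "d + d"] assms(2) by auto
qed

text \<open>Of three such centres in a window of size \<open>l\<close>, the middle one would carry a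
  palindrome of length \<open>l + 1\<close>.\<close>

lemma card_longest_centers:
  assumes "0 < l" and no: "\<And>m. m + Suc l \<le> i \<Longrightarrow> \<not> centered s m (Suc l)"
  shows "card ({m. centered s m l \<and> m + l \<le> i} \<inter> {x<..x + l}) \<le> 2"
proof (rule ccontr)
  let ?A = "{m. centered s m l \<and> m + l \<le> i} \<inter> {x<..x + l}"
  assume "\<not> card ?A \<le> 2"
  then have "2 * 1 < card ?A" by simp
  from three_in_set[OF _ this] obtain m1 m2 m3 where m: "m1 \<in> ?A" "m2 \<in> ?A" "m3 \<in> ?A" "m1 + 1 \<le> m2" "m2 + 1 \<le> m3"
    by blast
  then have "centered s m2 (l + 1)"
    by (intro centered_middle[of s m1 l m2 m3]) auto
  then show False using no[of m2] m by simp
qed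

text \<open>Among seven such indices there are three with consecutive distances at least 3. Their
  lengths differ by less than \<open>B\<close>, so consecutive centres are at least
  \<open>2 * B + 1\<close> apart, and all three carry palindromes of length
  \<open>l + 1 - B\<close>. The middle one then reaches length \<open>l + B + 2\<close>, which is
  excluded. The 2 subtracted from the window size keeps the outer centres within
  \<open>l + 1 - B\<close> of each other.\<close>

lemma card_sparse_blocks:
  fixes B l u i :: nat
  assumes F: "\<And>k. k \<in> F \<Longrightarrow> \<exists>m e. centered s m e \<and> m = k * B + B - 1 + e \<and> m + e \<le> i \<and> e \<le> l \<and> l < e + B"
    and no: "\<And>m e. centered s m e \<Longrightarrow> m + e \<le> i \<Longrightarrow> e < l + B"
    and l: "8 * B \<le> l"
  shows "card (F \<inter> {x<..x + (l div B - 2)}) \<le> 6"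
proof (rule ccontr)
  let ?A = "F \<inter> {x<..x + (l div B - 2)}"
  assume "\<not> card ?A \<le> 6"
  then have "2 * 3 < card ?A" by simp
  from three_in_set[OF _ this] obtain k1 k2 k3 where k: "k1 \<in> ?A" "k2 \<in> ?A" "k3 \<in> ?A" "k1 + 3 \<le> k2" "k2 + 3 \<le> k3"
    by blast
  obtain m1 e1 where 1: "centered s m1 e1" "m1 = k1 * B + B - 1 + e1" "e1 \<le> l" "l < e1 + B"
    using F[of k1] k by auto
  then have "B \<noteq> 0" by auto
  obtain m2 e2 where 2: "centered s m2 e2" "m2 = k2 * B + B - 1 + e2" "e2 \<le> l" "l < e2 + B"
    using F[of k2] k by auto
  obtain m3 e3 where 3: "centered s m3 e3" "m3 = k3 * B + B - 1 + e3" "m3 + e3 \<le> i" "e3 \<le> l" "l < e3 + B"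
    using F[of k3] k by auto
  have k12: "k1 * B + 3 * B \<le> k2 * B" and k23: "k2 * B + 3 * B \<le> k3 * B"
    using mult_le_mono1[OF k(4), of B] mult_le_mono1[OF k(5), of B] by (auto simp: algebra_simps)
  have "k3 \<le> k1 + (l div B - 2)" using k by auto
  then have "k3 * B \<le> (k1 + (l div B - 2)) * B" by (rule mult_le_mono1)
  also have "\<dots> = k1 * B + (l div B * B - 2 * B)" by (simp add: algebra_simps diff_mult_distrib)
  finally have k13: "k3 * B + 2 * B \<le> k1 * B + l"
    using l div_times_less_eq_dividend[of l B] by linarith
  let ?e = "l + 1 - B"
  have e: "?e \<le> e1" "?e \<le> e2" "?e \<le> e3" using 1 2 3 by auto
  have m12: "m1 + (2 * B + 1) \<le> m2" and m23: "m2 + (2 * B + 1) \<le> m3" and m13: "m3 \<le> m1 + ?e"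
    using 1 2 3 k12 k23 k13 l \<open>B \<noteq> 0\<close> by linarith+
  have "centered s m2 (?e + (2 * B + 1))"
    using m12 m23 m13
    by (intro centered_middle[of s m1 _ m2 m3] centered_mono[OF 1(1) e(1)] centered_mono[OF 2(1) e(2)]
        centered_mono[OF 3(1) e(3)]) auto
  moreover have "m2 + (?e + (2 * B + 1)) \<le> i"
    using m23 e(3) 3(3) by linarith
  ultimately have "?e + (2 * B + 1) < l + B" by (rule no)
  then show False using l by linarith
qed

section \<open>Prime divisors of a random product\<close>

text \<open>The reciprocals form Leibniz's harmonic triangle, where
  \<open>1 / (Suc n * (n choose Suc k))\<close> is the difference of
  \<open>1 / (n * ((n - 1) choose k))\<close> and \<open>1 / (Suc n * (n choose k))\<close>.
  Multiplied by the lcm, integrality passes from one column to the next.\<close>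

lemma Suc_times_binomial_dvd_Lcm: "k \<le> n \<Longrightarrow> Suc n * (n choose k) dvd Lcm {1..Suc n}"
proof (induction k arbitrary: n)
  case 0
  then show ?case by (auto intro!: dvd_Lcm)
next
  case (Suc k)
  then obtain N where n: "n = Suc N" "k \<le> N" by (cases n) auto
  define l where "l = Lcm {1..Suc n}"
  define u where "u = Suc N * (N choose k)"
  have "Lcm {1..Suc N} dvd l"
    unfolding l_def n by (intro Lcm_subset) auto
  with Suc.IH[OF n(2)] have "u dvd l" unfolding u_def by (rule dvd_trans)
  then obtain q where q: "l = u * q" by (rule dvdE)
  have "Suc n * (n choose k) dvd l"
    unfolding l_def using n by (intro Suc.IH) auto
  then obtain r where r: "l = Suc n * (n choose k) * r" by (rule dvdE)
  have u1: "u = (n choose Suc k) * Suc k" unfolding u_def n by (rule Suc_times_binomial_eq)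
  have u2: "u = (n - k) * (n choose k)" unfolding u_def n by (simp add: binomial_absorb_comp)
  have nk: "int (n - k) = int n - int k" using n by simp
  have "int (Suc k) * (int (Suc n * (n choose Suc k)) * (int q - int r)) =
      int (Suc n) * int (u * q) - int (Suc n) * (int u * int r)"
    unfolding u1 by (simp add: algebra_simps)
  also have "int (u * q) = int l" using q by simp
  also have "int (Suc n) * (int u * int r) = (int n - int k) * int l"
    unfolding u2 of_nat_mult nk using r by (simp add: algebra_simps)
  finally have "int (Suc k) * (int (Suc n * (n choose Suc k)) * (int q - int r)) = int (Suc k) * int l"
    by (simp add: algebra_simps)
  then have "int l = int (Suc n * (n choose Suc k)) * (int q - int r)"
    by (metis mult_left_cancel of_nat_eq_0_iff nat.distinct(2))
  then have "int (Suc n * (n choose Suc k)) dvd int l" by (rule dvdI)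
  then show ?case unfolding l_def by (simp only: int_dvd_int_iff)
qed

lemma prime_power_dvd_Lcm:
  assumes "prime (p :: nat)" "0 < e" "p ^ e dvd Lcm {1..N}"
  shows "\<exists>j\<in>{1..N}. p ^ e dvd j"
  using assms(3)
proof (induction N)
  case 0
  then show ?case using assms by (simp add: prime_nat_iff)
next
  case (Suc N)
  have ins: "{1..Suc N} = insert (Suc N) {1..N}" by auto
  have L: "Lcm {1..N} \<noteq> 0" by (simp add: Lcm_0_iff)
  have "p ^ e dvd lcm (Suc N) (Lcm {1..N})"
    using Suc.prems unfolding ins by simp
  then have "e \<le> multiplicity p (lcm (Suc N) (Lcm {1..N}))"
    using assms L by (subst (asm) power_dvd_iff_le_multiplicity) (auto simp: lcm_eq_0_iff prime_nat_iff)
  also have "\<dots> = max (multiplicity p (Suc N)) (multiplicity p (Lcm {1..N}))"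
    using assms L by (intro multiplicity_lcm) auto
  finally have "p ^ e dvd Suc N \<or> p ^ e dvd Lcm {1..N}"
    by (auto simp: le_max_iff_disj intro: multiplicity_dvd')
  then show ?case using Suc.IH unfolding ins by blast
qed

text \<open>The full power of a prime in the lcm divides some \<open>j \<le> N\<close>, hence each
  prime contributes a factor of at most \<open>N\<close>.\<close>

lemma Lcm_le_power_prime_count:
  "Lcm {1..N} \<le> N ^ card {p. prime p \<and> p \<le> N}" for N :: nat
proof -
  define L where "L = Lcm {1..N}"
  have L: "L \<noteq> 0" by (simp add: L_def Lcm_0_iff)
  have fin: "finite {p. prime p \<and> p \<le> N}" by simp
  have le: "p ^ multiplicity p L \<le> N" and pN: "p \<le> N" if "p \<in> prime_factors L" for p
  proof -
    have p: "prime p" "0 < multiplicity p L" using that L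
      by (auto simp: prime_factors_multiplicity)
    obtain j where j: "j \<in> {1..N}" "p ^ multiplicity p L dvd j"
      using prime_power_dvd_Lcm[OF p] multiplicity_dvd[of p L] unfolding L_def by blast
    then have "p ^ multiplicity p L \<le> j" by (intro dvd_imp_le) auto
    then show "p ^ multiplicity p L \<le> N" using j by auto
    moreover have "p \<le> p ^ multiplicity p L"
      using p prime_gt_0_nat by (intro self_le_power) (auto simp: Suc_le_eq)
    ultimately show "p \<le> N" by (rule order_trans[rotated])
  qed
  have "L = (\<Prod>p\<in>prime_factors L. p ^ multiplicity p L)"
    using L by (subst prod_prime_factors) auto
  also have "\<dots> \<le> (\<Prod>p\<in>prime_factors L. N)" using le by (intro prod_mono) auto
  also have "\<dots> = N ^ card (prime_factors L)" by simp
  also have "\<dots> \<le> N ^ card {p. prime p \<and> p \<le> N}"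
  proof (cases "N = 0")
    case True
    then have c: "card {p. prime p \<and> p \<le> N} = 0" by (auto simp: card_eq_0_iff)
    show ?thesis unfolding c using True by (simp add: L_def)
  next
    case False
    have "card (prime_factors L) \<le> card {p. prime p \<and> p \<le> N}"
      using pN by (intro card_mono fin) auto
    then show ?thesis using False by (intro power_increasing) auto
  qed
  finally show ?thesis unfolding L_def .
qed

text \<open>Nair's way to a Chebyshev bound: \<open>4 ^ k\<close> is at most \<open>2 * k\<close>
  times the central binomial coefficient, thus at most the lcm of the numbers up to
  \<open>2 * k + 1\<close>, which in turn is at most \<open>(2 * k + 1) ^ c\<close>.\<close>

lemma prime_count_lower_bound:
  assumes "8 \<le> Q"
  shows "real Q \<le> 2 * log 2 (real Q) * real (card {r. r < Q \<and> prime r})"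
proof -
  \<comment> \<open>The largest \<open>k\<close> with \<open>2 * k + 1 < Q\<close>; from
    \<open>8 \<le> Q\<close> it follows that \<open>Q \<le> 4 * k\<close>.\<close>
  define k where "k = (Q - 2) div 2"
  have k: "2 * k + 2 \<le> Q" "Q \<le> 2 * k + 3" "0 < k" using assms unfolding k_def by linarith+
  define c where "c = card {p. prime p \<and> p \<le> 2 * k + 1}"
  have "4 ^ k / (2 * real k) \<le> real (2 * k choose k)" using k by (intro central_binomial_lower_bound)
  then have "4 ^ k \<le> real (2 * k) * real (2 * k choose k)" using k by (simp add: field_simps)
  also have "\<dots> \<le> real (Suc (2 * k) * (2 * k choose k))" by (simp add: algebra_simps)
  also have "\<dots> \<le> real (Lcm {1..Suc (2 * k)})"
    using Suc_times_binomial_dvd_Lcm[of k "2 * k"]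
    by (intro of_nat_mono dvd_imp_le) (auto simp: Lcm_0_iff simp del: mult_Suc intro!: Nat.gr0I)
  also have "\<dots> \<le> real ((2 * k + 1) ^ c)"
    using Lcm_le_power_prime_count[of "2 * k + 1"] unfolding c_def of_nat_le_iff by simp
  finally have "4 ^ k \<le> real (2 * k + 1) ^ c" by simp
  then have "log 2 (4 ^ k) \<le> log 2 (real (2 * k + 1) ^ c)" by simp
  also have "log 2 (4 ^ k) = real k * log 2 (2 ^ 2)" by (simp add: log_nat_power)
  also have "\<dots> = 2 * real k" by (subst log_nat_power) auto
  also have "log 2 (real (2 * k + 1) ^ c) = real c * log 2 (real (2 * k + 1))"
    by (subst log_nat_power) auto
  also have "\<dots> \<le> real c * log 2 (real Q)" using k by (intro mult_left_mono) auto
  also have "real c \<le> real (card {r. r < Q \<and> prime r})"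
    unfolding c_def using k by (intro of_nat_mono card_mono) auto
  finally have "2 * real k \<le> real (card {r. r < Q \<and> prime r}) * log 2 (real Q)"
    using assms by (simp add: mult_right_mono)
  moreover have "real Q \<le> 2 * (2 * real k)" using k assms by linarith
  ultimately show ?thesis by (simp add: algebra_simps)
qed

lemma card_prime_divisors_le:
  assumes "0 < (D :: nat)"
  shows "real (card {p. prime p \<and> p dvd D}) \<le> log 2 (real D)"
proof -
  have eq: "prime_factors D = {p. prime p \<and> p dvd D}" using assms by (intro prime_factors_dvd) auto
  have "2 ^ card (prime_factors D) = (\<Prod>p\<in>prime_factors D. 2 :: nat)" by simp
  also have "\<dots> \<le> (\<Prod>p\<in>prime_factors D. p ^ multiplicity p D)"
  proof (intro prod_mono conjI)
    fix p assume "p \<in> prime_factors D"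
    then have p: "prime p" "0 < multiplicity p D" using assms by (auto simp: prime_factors_multiplicity)
    then have "2 \<le> p" "p \<le> p ^ multiplicity p D"
      using prime_ge_2_nat prime_gt_0_nat by (auto intro!: self_le_power simp: Suc_le_eq)
    then show "2 \<le> p ^ multiplicity p D" by simp
  qed simp
  also have "\<dots> = D" using assms by (subst prod_prime_factors) auto
  finally have "real (2 ^ card (prime_factors D)) \<le> real D" by (rule of_nat_mono)
  then have "2 ^ card (prime_factors D) \<le> real D" by simp
  then show ?thesis unfolding eq by (rule le_log_of_power) simp
qed

section \<open>The chance that a product of random primes divides a given number\<close>

lemma measure_bind_pmf_of_set:
  assumes "finite A" "A \<noteq> {}"
  shows "measure_pmf.prob (bind_pmf (pmf_of_set A) f) X = (\<Sum>a\<in>A. measure_pmf.prob (f a) X) / card A"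
proof -
  have "ennreal (measure_pmf.prob (bind_pmf (pmf_of_set A) f) X) = emeasure (bind_pmf (pmf_of_set A) f) X"
    by (simp add: measure_pmf.emeasure_eq_measure)
  also have "\<dots> = (\<Sum>a\<in>A. emeasure (f a) X) / card A"
    using assms by (simp add: nn_integral_pmf_of_set)
  also have "\<dots> = ennreal ((\<Sum>a\<in>A. measure_pmf.prob (f a) X) / card A)"
    using assms by (simp add: measure_pmf.emeasure_eq_measure sum_nonneg divide_ennreal card_gt_0_iff ennreal_of_nat_eq_real_of_nat)
  finally show ?thesis by (subst (asm) ennreal_inj) (auto intro!: divide_nonneg_nonneg sum_nonneg)
qed

lemma measure_bind_pmf_le:
  assumes "\<And>x. x \<in> set_pmf A \<Longrightarrow> measure_pmf.prob (f x) X \<le> (if x \<in> Y then d else 0)" "0 \<le> d"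
  shows "measure_pmf.prob (bind_pmf A f) X \<le> d * measure_pmf.prob A Y"
proof -
  have "ennreal (measure_pmf.prob (bind_pmf A f) X) = (\<integral>\<^sup>+x. emeasure (f x) X \<partial>A)"
    by (simp flip: measure_pmf.emeasure_eq_measure)
  also have "\<dots> \<le> (\<integral>\<^sup>+x. ennreal d * indicator Y x \<partial>A)"
    using assms(1)
    by (intro nn_integral_mono_AE)
       (force simp: AE_measure_pmf_iff measure_pmf.emeasure_eq_measure indicator_def split: if_splits
         intro!: ennreal_leI dest: order_antisym[OF _ measure_nonneg])
  also have "\<dots> = ennreal (d * measure_pmf.prob A Y)"
    using assms(2) by (subst nn_integral_cmult_indicator)
      (auto simp: measure_pmf.emeasure_eq_measure ennreal_mult)
  finally show ?thesis using assms(2) by (subst (asm) ennreal_le_iff) auto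
qed

text \<open>All \<open>t\<close> draws are made whatever their outcome, since the loop computing
  this has a fixed number of rounds; \<open>p\<close> survives if no prime is drawn.\<close>

primrec last_prime :: "nat \<Rightarrow> nat \<Rightarrow> nat \<Rightarrow> nat pmf" where
  "last_prime Q 0 p = return_pmf p"
| "last_prime Q (Suc t) p = bind_pmf (pmf_of_set {..<Q}) (\<lambda>r. last_prime Q t (if prime r then r else p))"

text \<open>The search for each factor starts from 1. If no prime turns up, the factor 1 divides
  everything and so counts as a failure.\<close>

primrec prime_product :: "nat \<Rightarrow> nat \<Rightarrow> nat \<Rightarrow> nat \<Rightarrow> nat pmf" where
  "prime_product Q t 0 m = return_pmf m"
| "prime_product Q t (Suc k) m = bind_pmf (last_prime Q t 1) (\<lambda>p. prime_product Q t k (m * p))"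

text \<open>Either no draw is prime and \<open>p\<close> itself divides \<open>D\<close>, or some
  draw is a prime divisor of \<open>D\<close>; the latter is estimated by summing over the
  \<open>t\<close> draws.\<close>

lemma prob_last_prime_dvd:
  fixes D :: nat
  assumes "0 < Q"
  defines "\<rho> \<equiv> 1 - real (card {r. r < Q \<and> prime r}) / real Q"
    and "\<omega> \<equiv> real (card {p. p < Q \<and> prime p \<and> p dvd D}) / real Q"
  shows "measure_pmf.prob (last_prime Q t p) {x. x dvd D} \<le> (if p dvd D then \<rho> ^ t else 0) + real t * \<omega>"
proof (induction t arbitrary: p)
  case 0
  then show ?case by (simp add: indicator_def)
next
  case (Suc t)
  let ?P = "\<lambda>q. measure_pmf.prob (last_prime Q t q) {x. x dvd D}"
  have rho: "0 \<le> \<rho>"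
    using card_mono[of "{..<Q}" "{r. r < Q \<and> prime r}"] assms(1) by (auto simp: \<rho>_def)
  have omega: "0 \<le> \<omega>" by (simp add: \<omega>_def)
  have "(\<Sum>r<Q. ?P (if prime r then r else p)) \<le>
      (\<Sum>r<Q. (if prime r \<and> r dvd D then 1 else 0) +
        (if prime r then 0 else (if p dvd D then \<rho> ^ t else 0)) + real t * \<omega>)"
  proof (rule sum_mono)
    fix r assume "r \<in> {..<Q}"
    show "?P (if prime r then r else p) \<le> (if prime r \<and> r dvd D then 1 else 0) +
        (if prime r then 0 else (if p dvd D then \<rho> ^ t else 0)) + real t * \<omega>"
      using Suc[of r] Suc[of p] measure_pmf.prob_le_1[of "last_prime Q t r" "{x. x dvd D}"] omega
      by (auto intro: order_trans)
  qed
  also have "\<dots> = real (card {r. r < Q \<and> prime r \<and> r dvd D}) +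
      (real Q - real (card {r. r < Q \<and> prime r})) * (if p dvd D then \<rho> ^ t else 0) + real Q * (real t * \<omega>)"
  proof -
    have "(\<Sum>r<Q. if prime r \<and> r dvd D then 1 else 0 :: real) = real (card {r. r < Q \<and> prime r \<and> r dvd D})"
      by (subst sum.If_cases) (auto intro!: arg_cong[where f = card])
    moreover have "(\<Sum>r<Q. if prime r then 0 else (if p dvd D then \<rho> ^ t else 0)) =
        (\<Sum>r<Q. (if p dvd D then \<rho> ^ t else 0) - (if prime r then (if p dvd D then \<rho> ^ t else 0) else 0))"
      by (intro sum.cong) auto
    moreover have "(\<Sum>r<Q. (if prime r then (if p dvd D then \<rho> ^ t else 0) else 0)) =
        real (card {r. r < Q \<and> prime r}) * (if p dvd D then \<rho> ^ t else 0)"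
      by (subst sum.If_cases) (auto intro!: arg_cong[where f = card])
    ultimately show ?thesis by (simp add: sum.distrib sum_subtractf algebra_simps)
  qed
  also have "\<dots> = real Q * ((if p dvd D then \<rho> ^ Suc t else 0) + real (Suc t) * \<omega>)"
    using assms(1) by (simp add: \<rho>_def \<omega>_def field_simps)
  finally have "(\<Sum>r<Q. ?P (if prime r then r else p)) / real Q \<le>
      (if p dvd D then \<rho> ^ Suc t else 0) + real (Suc t) * \<omega>"
    using assms(1) by (simp add: field_simps)
  then show ?case
    using assms(1) by (simp add: measure_bind_pmf_of_set lessThan_empty_iff)
qed

lemma dvd_prime_product: "x \<in> set_pmf (prime_product Q t k m) \<Longrightarrow> m dvd x"
  by (induction k arbitrary: m) (auto intro: dvd_mult_left)

text \<open>The product divides \<open>D\<close> only if every factor does, and the factors are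
  drawn independently. Repeated primes do no harm, as each draw is counted by itself.\<close>

lemma prob_prime_product_dvd:
  assumes "measure_pmf.prob (last_prime Q t 1) {x. x dvd D} \<le> d"
  shows "measure_pmf.prob (prime_product Q t k m) {x. x dvd D} \<le> d ^ k"
proof (induction k arbitrary: m)
  case 0
  then show ?case by simp
next
  case (Suc k)
  have d: "0 \<le> d" using assms measure_nonneg order_trans by blast
  have "measure_pmf.prob (prime_product Q t (Suc k) m) {x. x dvd D} \<le>
      d ^ k * measure_pmf.prob (last_prime Q t 1) {x. x dvd D}"
    unfolding prime_product.simps
  proof (rule measure_bind_pmf_le)
    fix p
    show "measure_pmf.prob (prime_product Q t k (m * p)) {x. x dvd D} \<le> (if p \<in> {x. x dvd D} then d ^ k else 0)"
    proof (cases "p dvd D")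
      case False
      then have "set_pmf (prime_product Q t k (m * p)) \<inter> {x. x dvd D} = {}"
        using dvd_prime_product by (metis (mono_tags, lifting) disjoint_iff dvd_mult_right dvd_trans mem_Collect_eq)
      then show ?thesis using False by (simp add: measure_pmf_zero_iff[THEN iffD2])
    qed (use Suc in simp)
  qed (use d in simp)
  also have "\<dots> \<le> d ^ k * d" using assms d by (intro mult_left_mono) auto
  finally show ?case by (simp add: mult.commute)
qed

lemma last_prime_bounds:
  assumes "x \<in> set_pmf (last_prime Q t p)" "0 < p" "p \<le> Q" "0 < Q"
  shows "0 < x \<and> x \<le> Q"
  using assms
proof (induction t arbitrary: p)
  case (Suc t)
  then obtain r where "r < Q" "x \<in> set_pmf (last_prime Q t (if prime r then r else p))"
    by (auto simp: set_pmf_of_set lessThan_empty_iff)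
  then show ?case using Suc.IH[of "if prime r then r else p"] Suc.prems prime_gt_0_nat by (auto split: if_splits)
qed simp

lemma prime_product_bounds:
  assumes "x \<in> set_pmf (prime_product Q t k m)" "0 < m" "0 < Q"
  shows "0 < x \<and> x \<le> m * Q ^ k"
  using assms
proof (induction k arbitrary: m)
  case (Suc k)
  then obtain p where p: "p \<in> set_pmf (last_prime Q t 1)" "x \<in> set_pmf (prime_product Q t k (m * p))"
    by auto
  have "0 < p" "p \<le> Q" using last_prime_bounds[OF p(1)] Suc.prems by auto
  moreover from this have "0 < x \<and> x \<le> m * p * Q ^ k" using Suc.IH[OF p(2)] Suc.prems by auto
  moreover have "m * p * Q ^ k \<le> m * Q * Q ^ k" using \<open>p \<le> Q\<close> by (intro mult_le_mono) auto
  ultimately have "0 < x" "x \<le> m * Q * Q ^ k" by linarith+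
  then show ?case by (simp add: mult_ac)
qed simp

text \<open>With \<open>y\<close> draws below \<open>y ^ 6\<close>, the first summand bounds the probability of never drawing
  a prime, the second one that of drawing a prime divisor of a number with
  \<open>O(y\<^sup>4 log y)\<close> bits.\<close>

lemma eventually_failure_small:
  fixes e :: real
  shows "eventually (\<lambda>y. (1 - 1 / (12 * log 2 y)) powr y + y * (2 * y ^ 4 + 1) * (e * log 2 y) / y ^ 6
     \<le> y powr (-1/2)) at_top"
proof -
  have "((\<lambda>y::real. y powr (1/2) * (y * (2 * y ^ 4 + 1) * log 2 y / y ^ 6)) \<longlongrightarrow> 0) at_top"
    by real_asymp
  then have "((\<lambda>y::real. e * (y powr (1/2) * (y * (2 * y ^ 4 + 1) * log 2 y / y ^ 6))) \<longlongrightarrow> e * 0) at_top"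
    by (rule tendsto_mult_left)
  then have "eventually (\<lambda>y::real. e * (y powr (1/2) * (y * (2 * y ^ 4 + 1) * log 2 y / y ^ 6)) < 1 / 2) at_top"
    by (rule order_tendstoD) simp
  moreover have "eventually (\<lambda>y::real. (1 - 1 / (12 * log 2 y)) powr y \<le> y powr (-1/2) / 2) at_top"
    by real_asymp
  ultimately show ?thesis using eventually_gt_at_top[of 0]
  proof eventually_elim
    case (elim y)
    have "y powr (1/2) * (y powr (-1/2)) = 1" using elim by (simp flip: powr_add)
    then have "y * (2 * y ^ 4 + 1) * (e * log 2 y) / y ^ 6 =
        y powr (-1/2) * (e * (y powr (1/2) * (y * (2 * y ^ 4 + 1) * log 2 y / y ^ 6)))"
      by (simp add: algebra_simps)
    also have "\<dots> \<le> y powr (-1/2) * (1 / 2)" using elim by (intro mult_left_mono) auto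
    finally show ?case using elim(2) by linarith
  qed
qed

section \<open>Palindromes and prefix hashes\<close>

text \<open>The prefix as a numeral in base \<open>M\<close> with its first symbol most significant;
  in \<open>bwd_hash\<close> the same digits stand in reverse order.\<close>

primrec fwd_hash :: "nat \<Rightarrow> (nat \<Rightarrow> nat) \<Rightarrow> nat \<Rightarrow> nat" where
  "fwd_hash M s 0 = 0"
| "fwd_hash M s (Suc i) = fwd_hash M s i * M + s i"

primrec bwd_hash :: "nat \<Rightarrow> (nat \<Rightarrow> nat) \<Rightarrow> nat \<Rightarrow> nat" where
  "bwd_hash M s 0 = 0"
| "bwd_hash M s (Suc i) = bwd_hash M s i + s i * M ^ i"

lemma fwd_hash_add:
  "fwd_hash M s (a + k) = fwd_hash M s a * M ^ k + (\<Sum>t<k. s (a + k - 1 - t) * M ^ t)"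
proof (induction k)
  case (Suc k)
  have "(\<Sum>t<Suc k. s (a + Suc k - 1 - t) * M ^ t) = s (a + k) + (\<Sum>t<k. s (a + k - 1 - t) * M ^ t) * M"
    by (subst sum.lessThan_Suc_shift) (simp add: sum_distrib_left sum_distrib_right mult_ac)
  then show ?case using Suc by (simp add: algebra_simps)
qed simp

lemma bwd_hash_add:
  "bwd_hash M s (a + k) = bwd_hash M s a + M ^ a * (\<Sum>t<k. s (a + t) * M ^ t)"
  by (induction k) (simp_all add: algebra_simps power_add)

lemma digits_unique:
  fixes x y :: "nat \<Rightarrow> nat"
  assumes "\<And>t. t < k \<Longrightarrow> x t < M" "\<And>t. t < k \<Longrightarrow> y t < M"
    and "(\<Sum>t<k. x t * M ^ t) = (\<Sum>t<k. y t * M ^ t)" and "t < k"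
  shows "x t = y t"
  using assms
proof (induction k arbitrary: x y t)
  case (Suc k)
  have sum: "(\<Sum>t<Suc k. z t * M ^ t) = z 0 + M * (\<Sum>t<k. z (Suc t) * M ^ t)" for z :: "nat \<Rightarrow> nat"
    by (subst sum.lessThan_Suc_shift) (simp add: sum_distrib_left mult_ac)
  have eq: "x 0 + M * (\<Sum>t<k. x (Suc t) * M ^ t) = y 0 + M * (\<Sum>t<k. y (Suc t) * M ^ t)"
    using Suc.prems(3) unfolding sum .
  have lt: "x 0 < M" "y 0 < M" using Suc.prems(1)[of 0] Suc.prems(2)[of 0] by auto
  have "x 0 = y 0" using arg_cong[OF eq, of "\<lambda>z. z mod M"] lt by simp
  moreover have "(\<Sum>t<k. x (Suc t) * M ^ t) = (\<Sum>t<k. y (Suc t) * M ^ t)"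
    using arg_cong[OF eq, of "\<lambda>z. z div M"] lt by simp
  then have "x (Suc u) = y (Suc u)" if "u < k" for u
    using Suc.prems(1,2) that by (intro Suc.IH[of "\<lambda>t. x (Suc t)" "\<lambda>t. y (Suc t)"]) auto
  ultimately show ?case using Suc.prems(4) by (cases t) auto
qed simp

text \<open>Removing the part before \<open>a\<close> from the two prefix hashes at
  \<open>a + 2 * l\<close> leaves the numeral of the factor and \<open>M ^ a\<close> times that of
  its reversal. Scaling the former by \<open>M ^ a\<close> and moving the removed terms across gives
  an equation without subtraction or division, which makes sense modulo any number.\<close>

lemma hash_eq_iff_centered:
  assumes "\<And>t. t < a + 2 * l \<Longrightarrow> s t < M" "0 < M"
  shows "fwd_hash M s (a + 2 * l) * M ^ a + bwd_hash M s a =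
      bwd_hash M s (a + 2 * l) + fwd_hash M s a * M ^ (a + 2 * l) \<longleftrightarrow> centered s (a + l) l"
    (is "?L \<longleftrightarrow> ?R")
proof -
  let ?x = "\<lambda>t. s (a + 2 * l - 1 - t)" and ?y = "\<lambda>t. s (a + t)"
  have "?L \<longleftrightarrow> M ^ a * (\<Sum>t<2*l. ?x t * M ^ t) = M ^ a * (\<Sum>t<2*l. ?y t * M ^ t)"
    unfolding fwd_hash_add bwd_hash_add by (simp add: algebra_simps power_add)
  also have "\<dots> \<longleftrightarrow> (\<Sum>t<2*l. ?x t * M ^ t) = (\<Sum>t<2*l. ?y t * M ^ t)"
    using assms(2) by simp
  also have "\<dots> \<longleftrightarrow> (\<forall>t<2*l. ?x t = ?y t)"
  proof
    assume "(\<Sum>t<2*l. ?x t * M ^ t) = (\<Sum>t<2*l. ?y t * M ^ t)"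
    then show "\<forall>t<2*l. ?x t = ?y t"
      using assms(1) by (intro allI impI digits_unique[of "2*l" ?x M ?y]) auto
  qed (auto intro!: sum.cong)
  also have "\<dots> \<longleftrightarrow> ?R"
  proof
    assume *: "\<forall>t<2*l. ?x t = ?y t"
    have "s (a + l - 1 - i) = s (a + l + i)" if "i < l" for i
    proof -
      have "?x (l + i) = ?y (l + i)" using that by (intro *[rule_format]) simp
      moreover have "a + 2 * l - 1 - (l + i) = a + l - 1 - i" "a + (l + i) = a + l + i" using that by auto
      ultimately show ?thesis by metis
    qed
    then show ?R by (simp add: centered_def)
  next
    assume R: ?R
    show "\<forall>t<2*l. ?x t = ?y t"
    proof (intro allI impI)
      fix t assume "t < 2 * l"
      then show "?x t = ?y t" by (intro centered_reflect[OF R]) auto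
    qed
  qed
  finally show ?thesis .
qed

section \<open>The probability that a random modulus misjudges a factor\<close>

lemma fwd_hash_less:
  assumes "\<And>t. t < i \<Longrightarrow> s t < M"
  shows "fwd_hash M s i < M ^ i"
  using assms
proof (induction i)
  case (Suc i)
  then have "fwd_hash M s i + 1 \<le> M ^ i" "s i < M" by (auto simp: Suc_le_eq)
  then have "(fwd_hash M s i + 1) * M \<le> M ^ i * M" by (intro mult_le_mono1)
  then show ?case using \<open>s i < M\<close> by (simp add: algebra_simps)
qed simp

lemma bwd_hash_less:
  assumes "\<And>t. t < i \<Longrightarrow> s t < M"
  shows "bwd_hash M s i < M ^ i"
  using assms
proof (induction i)
  case (Suc i)
  then have "bwd_hash M s i < M ^ i" "s i + 1 \<le> M" by (auto simp: Suc_le_eq)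
  moreover from this have "(s i + 1) * M ^ i \<le> M * M ^ i" by (intro mult_le_mono1)
  ultimately show ?case by (simp add: algebra_simps)
qed simp

lemma hash_side_less:
  assumes "f < (M :: nat) ^ i" "b < M ^ a"
  shows "f * M ^ a + b < M ^ (i + a)"
proof -
  have "f * M ^ a + b < (f + 1) * M ^ a" using assms(2) by simp
  also have "\<dots> \<le> M ^ i * M ^ a" using assms(1) by (intro mult_le_mono1) simp
  finally show ?thesis by (simp add: power_add)
qed

text \<open>Only false positives are excluded; for true palindromes the equation already holds
  before reduction, by \<open>hash_eq_iff_centered\<close>.\<close>

definition faithful :: "nat \<Rightarrow> (nat \<Rightarrow> nat) \<Rightarrow> nat \<Rightarrow> nat \<Rightarrow> bool" where
  "faithful M s n m \<longleftrightarrow> (\<forall>a l. a + 2 * l \<le> n \<longrightarrow>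
     (fwd_hash M s (a + 2 * l) * M ^ a + bwd_hash M s a) mod m =
     (bwd_hash M s (a + 2 * l) + fwd_hash M s a * M ^ (a + 2 * l)) mod m \<longrightarrow> centered s (a + l) l)"

text \<open>A union bound over at most \<open>n ^ 2\<close> factors that are no palindromes. For
  each the two sides of the test differ by a nonzero number below \<open>M ^ (2 * n)\<close>, which
  has at most \<open>2 * n * log 2 M\<close> prime divisors.\<close>

lemma prob_faithful_aux:
  assumes s: "\<And>t. t < n \<Longrightarrow> s t < M" and M: "2 \<le> M" and n: "0 < n" and Q: "0 < Q"
    and d: "(1 - real (card {r. r < Q \<and> prime r}) / real Q) ^ t + real t * (2 * real n * log 2 (real M)) / real Q \<le> d"
  shows "measure_pmf.prob (prime_product Q t k 1) {m. \<not> faithful M s n m} \<le> real n ^ 2 * d ^ k"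
proof -
  \<comment> \<open>\<open>Suc l\<close>, because a palindrome of length 0 is always
    present.\<close>
  define A where "A = {(a, l). a < n \<and> l < n \<and> a + 2 * Suc l \<le> n \<and> \<not> centered s (a + Suc l) (Suc l)}"
  define lhs where "lhs = (\<lambda>(a, l). fwd_hash M s (a + 2 * Suc l) * M ^ a + bwd_hash M s a)"
  define rhs where "rhs = (\<lambda>(a, l). bwd_hash M s (a + 2 * Suc l) + fwd_hash M s a * M ^ (a + 2 * Suc l))"
  define D where "D = (\<lambda>x. nat \<bar>int (lhs x) - int (rhs x)\<bar>)"
  have A: "A \<subseteq> {..<n} \<times> {..<n}" by (auto simp: A_def)
  then have finA: "finite A" by (rule finite_subset) simp
  have cardA: "card A \<le> n ^ 2"
    using card_mono[OF _ A] by (simp add: card_cartesian_product power2_eq_square)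
  have sub: "{m. \<not> faithful M s n m} \<subseteq> (\<Union>x\<in>A. {m. m dvd D x})"
  proof
    fix m assume "m \<in> {m. \<not> faithful M s n m}"
    then obtain a l where al: "a + 2 * l \<le> n" "\<not> centered s (a + l) l"
      "(fwd_hash M s (a + 2 * l) * M ^ a + bwd_hash M s a) mod m =
       (bwd_hash M s (a + 2 * l) + fwd_hash M s a * M ^ (a + 2 * l)) mod m"
      by (auto simp: faithful_def)
    then obtain k where k: "l = Suc k" by (cases l) auto
    have "lhs (a, k) mod m = rhs (a, k) mod m" using al k by (simp add: lhs_def rhs_def)
    then have "int (lhs (a, k)) mod int m = int (rhs (a, k)) mod int m" by (metis of_nat_mod)
    then have "int m dvd int (lhs (a, k)) - int (rhs (a, k))" by (simp add: mod_eq_dvd_iff)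
    then have "m dvd D (a, k)" unfolding D_def by (simp add: nat_abs_dvd_iff dvd_nat_abs_iff)
    moreover have "(a, k) \<in> A" using al k by (auto simp: A_def)
    ultimately show "m \<in> (\<Union>x\<in>A. {m. m dvd D x})" by blast
  qed
  have each: "measure_pmf.prob (prime_product Q t k 1) {m. m dvd D x} \<le> d ^ k" if "x \<in> A" for x
  proof (rule prob_prime_product_dvd)
    obtain a l where x: "x = (a, l)" by (cases x)
    have al: "a + 2 * Suc l \<le> n" "\<not> centered s (a + Suc l) (Suc l)" using that by (auto simp: A_def x)
    have "lhs x \<noteq> rhs x"
      using hash_eq_iff_centered[of a "Suc l" s M] al s M by (auto simp: lhs_def rhs_def x)
    then have pos: "0 < D x" by (auto simp: D_def)
    have "lhs x < M ^ (a + 2 * Suc l + a)"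
      using s al unfolding lhs_def x split by (intro hash_side_less fwd_hash_less bwd_hash_less) auto
    moreover have "rhs x < M ^ (a + (a + 2 * Suc l))"
      using s al unfolding rhs_def x split
      by (subst add.commute) (intro hash_side_less fwd_hash_less bwd_hash_less, auto)
    ultimately have "D x < M ^ (a + 2 * Suc l + a)" unfolding D_def by (simp add: add_ac)
    also have "\<dots> \<le> M ^ (2 * n)" using al M by (intro power_increasing) auto
    finally have "real (D x) \<le> real M ^ (2 * n)" by (simp flip: of_nat_power)
    then have logD: "log 2 (real (D x)) \<le> 2 * real n * log 2 (real M)"
      using pos M by (subst (asm) log_le_cancel_iff[symmetric, of 2]) (auto simp: log_nat_power)
    have "real (card {p. p < Q \<and> prime p \<and> p dvd D x}) \<le> real (card {p. prime p \<and> p dvd D x})"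
      using pos by (intro of_nat_mono card_mono) auto
    also have "\<dots> \<le> 2 * real n * log 2 (real M)"
      using card_prime_divisors_le[OF pos] logD by simp
    finally have c: "real t * (real (card {p. p < Q \<and> prime p \<and> p dvd D x}) / real Q)
        \<le> real t * (2 * real n * log 2 (real M)) / real Q"
      by (simp add: divide_right_mono mult_left_mono)
    show "measure_pmf.prob (last_prime Q t 1) {m. m dvd D x} \<le> d"
      using prob_last_prime_dvd[OF Q, of t 1 "D x"] c d by simp
  qed
  have "measure_pmf.prob (prime_product Q t k 1) {m. \<not> faithful M s n m} \<le>
      measure_pmf.prob (prime_product Q t k 1) (\<Union>x\<in>A. {m. m dvd D x})"
    using sub by (intro measure_pmf.finite_measure_mono) auto
  also have "\<dots> \<le> (\<Sum>x\<in>A. measure_pmf.prob (prime_product Q t k 1) {m. m dvd D x})"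
    using finA by (intro measure_pmf.finite_measure_subadditive_finite) auto
  also have "\<dots> \<le> (\<Sum>x\<in>A. d ^ k)" using each by (intro sum_mono)
  also have "\<dots> = real (card A) * d ^ k" by simp
  also have "\<dots> \<le> real n ^ 2 * d ^ k"
  proof -
    have "0 \<le> (1 - real (card {r. r < Q \<and> prime r}) / real Q) ^ t"
      using card_mono[of "{..<Q}" "{r. r < Q \<and> prime r}"] Q by (intro zero_le_power) auto
    moreover have "0 \<le> real t * (2 * real n * log 2 (real M)) / real Q" using M by simp
    ultimately have "0 \<le> d" using d by linarith
    moreover have "real (card A) \<le> real n ^ 2" using cardA by (simp flip: of_nat_power)
    ultimately show ?thesis by (intro mult_right_mono) auto
  qed
  finally show ?thesis .
qed

text \<open>With \<open>n \<le> y ^ 4\<close>, 24 factors failing with probability at most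
  \<open>y powr (-1/2)\<close> each leave \<open>n ^ 2 / y ^ 12\<close>, which is at most
  \<open>1 / n\<close>.\<close>

lemma prob_faithful:
  fixes E :: nat
  assumes s: "\<And>t. t < n \<Longrightarrow> s t < M" and M: "2 \<le> M" "M \<le> y ^ (4 * E)" and n: "0 < n" "n \<le> y ^ 4"
    and y: "2 \<le> y"
    and small: "(1 - 1 / (12 * log 2 (real y))) powr real y +
      real y * (2 * real y ^ 4 + 1) * (real (4 * E) * log 2 (real y)) / real y ^ 6 \<le> real y powr (-1/2)"
  shows "measure_pmf.prob (prime_product (y ^ 6) y 24 1) {m. faithful M s n m} \<ge> 1 - 1 / real n"
proof -
  define Q where "Q = y ^ 6"
  have Q: "64 \<le> Q" using power_mono[OF y, of 6] by (simp add: Q_def)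
  define d where "d = real y powr (-1/2)"
  define \<rho> where "\<rho> = 1 - real (card {r. r < Q \<and> prime r}) / real Q"
  have logQ: "log 2 (real Q) = 6 * log 2 (real y)" using y by (simp add: Q_def log_nat_power)
  have log1: "1 \<le> log 2 (real y)" using y by simp
  have rho0: "0 \<le> \<rho>"
    using card_mono[of "{..<Q}" "{r. r < Q \<and> prime r}"] Q by (auto simp: \<rho>_def)
  have "\<rho> \<le> 1 - 1 / (12 * log 2 (real y))"
  proof -
    have "real Q \<le> 12 * log 2 (real y) * real (card {r. r < Q \<and> prime r})"
      using prime_count_lower_bound[of Q] Q logQ by simp
    then have "1 / (12 * log 2 (real y)) \<le> real (card {r. r < Q \<and> prime r}) / real Q"
      using Q log1 by (simp add: field_simps)
    then show ?thesis by (simp add: \<rho>_def)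
  qed
  then have "\<rho> ^ y \<le> (1 - 1 / (12 * log 2 (real y))) ^ y" using rho0 by (intro power_mono)
  also have "\<dots> = (1 - 1 / (12 * log 2 (real y))) powr real y"
  proof -
    have "0 < 1 - 1 / (12 * log 2 (real y))" using log1 by (simp add: field_simps)
    then show ?thesis by (rule powr_realpow[symmetric])
  qed
  finally have 1: "\<rho> ^ y \<le> (1 - 1 / (12 * log 2 (real y))) powr real y" .
  have "log 2 (real M) \<le> log 2 (real y ^ (4 * E))"
    using M y by (subst log_le_cancel_iff) (auto simp flip: of_nat_power)
  then have logM: "log 2 (real M) \<le> real (4 * E) * log 2 (real y)" using y by (simp add: log_nat_power)
  have "real n \<le> real y ^ 4" using n by (simp flip: of_nat_power)
  then have "2 * real n \<le> 2 * real y ^ 4 + 1" by linarith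
  then have "2 * real n * log 2 (real M) \<le> (2 * real y ^ 4 + 1) * (real (4 * E) * log 2 (real y))"
    using logM M by (intro mult_mono) auto
  then have 2: "real y * (2 * real n * log 2 (real M)) / real Q \<le>
      real y * (2 * real y ^ 4 + 1) * (real (4 * E) * log 2 (real y)) / real y ^ 6"
    unfolding Q_def of_nat_power mult.assoc by (intro divide_right_mono mult_left_mono) auto
  have "measure_pmf.prob (prime_product Q y 24 1) {m. \<not> faithful M s n m} \<le> real n ^ 2 * d ^ 24"
    using 1 2 small s M(1) n(1) Q unfolding d_def \<rho>_def by (intro prob_faithful_aux) auto
  also have "d ^ 24 = 1 / real y ^ 12"
  proof -
    have "d ^ 24 = real y powr (-1/2 * 24)" unfolding d_def using y by (subst powr_power) auto
    also have "\<dots> = 1 / real y ^ 12" using y by (simp add: powr_minus_divide)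
    finally show ?thesis .
  qed
  also have "real n ^ 2 * (1 / real y ^ 12) \<le> 1 / real n"
  proof -
    have "real n ^ 3 \<le> (real y ^ 4) ^ 3" using \<open>real n \<le> real y ^ 4\<close> by (intro power_mono) auto
    then show ?thesis using n y by (simp add: field_simps power2_eq_square power3_eq_cube flip: power_mult power_add)
  qed
  finally have "measure_pmf.prob (prime_product Q y 24 1) {m. \<not> faithful M s n m} \<le> 1 / real n" .
  then show ?thesis
    using measure_pmf.prob_compl[of "{m. faithful M s n m}" "prime_product Q y 24 1"]
    by (simp add: Q_def Compl_eq_Diff_UNIV[symmetric] Collect_neg_eq)
qed

section \<open>Notation for commands, counted loops and the word size they need\<close>

abbreviation plus_expr (infixl "[+]" 65) where "a [+] b \<equiv> Op Plus a b"
abbreviation minus_expr (infixl "[-]" 65) where "a [-] b \<equiv> Op Minus a b"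
abbreviation times_expr (infixl "[*]" 70) where "a [*] b \<equiv> Op Times a b"
abbreviation div_expr (infixl "[div]" 70) where "a [div] b \<equiv> Op Divide a b"
abbreviation mod_expr (infixl "[mod]" 70) where "a [mod] b \<equiv> Op Modulo a b"
text \<open>Truth values are numbers, nonzero meaning true; truncated subtraction turns comparisons
  into arithmetic.\<close>

abbreviation less_expr (infix "[<]" 50) where "a [<] b \<equiv> b [-] a"
abbreviation leq_expr (infix "[<=]" 50) where "a [<=] b \<equiv> b [+] Num 1 [-] a"
abbreviation eq_expr (infix "[=]" 50) where "a [=] b \<equiv> Num 1 [-] ((a [-] b) [+] (b [-] a))"

fun power_expr :: "expr \<Rightarrow> nat \<Rightarrow> expr" where
  "power_expr e 0 = Num 1"
| "power_expr e (Suc k) = power_expr e k [*] e"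

lemma eval_power_expr [simp]: "eval (power_expr e k) m = eval e m ^ k"
  by (induction k) (simp_all add: mult.commute)

lemma fits_power_expr: "fits (Suc d) e \<Longrightarrow> fits d (power_expr e k)"
  by (induction k) (auto dest: fits_less)

fun assigned :: "com \<Rightarrow> nat set" where
  "assigned (Assign v e) = {v}"
| "assigned (Input v) = {v}"
| "assigned (p ;; q) = assigned p \<union> assigned q"
| "assigned (Branch e p q) = assigned p \<union> assigned q"
| "assigned _ = {}"

lemma den_unassigned: "v \<notin> assigned p \<Longrightarrow> v < 32 \<Longrightarrow> mem (den p c) v = mem c v"
  by (induction p arbitrary: c) (auto simp: addr_def set_reg_def split: list.splits)

definition modest :: "nat \<Rightarrow> nat \<Rightarrow> com \<Rightarrow> bool" where
  "modest k X p \<longleftrightarrow> wf_com p \<and> max_const (compile p) \<le> X \<and> cost (compile p) \<le> k"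

definition countdown :: "nat \<Rightarrow> com \<Rightarrow> com" where
  "countdown v p = (p ;; Assign v (Var v [-] Num 1))"

definition For :: "nat \<Rightarrow> com \<Rightarrow> prog" where
  "For v p = While v (compile (countdown v p))"

text \<open>\<open>b\<close> bits suffice for all intermediate numbers of any command of cost at
  most \<open>k\<close>.\<close>

locale resources =
  fixes s b k n M :: nat
  assumes word: "Suc M ^ (2 ^ k) \<le> 2 ^ b"
begin

lemma Suc_M_le: "Suc M \<le> 2 ^ b"
  using word by (rule order_trans[rotated]) (simp add: self_le_power)

lemma regular_safe: "regular s n l M c \<Longrightarrow> safe s b c"
  unfolding regular_def using bounded_safe[OF _ Suc_M_le] by blast

lemma runs_com:
  assumes "modest k M p" "regular s n l M c"
  shows "runs s b k (compile p) c (return_pmf (den p c))"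
proof -
  have "Suc M ^ (2 ^ cost (compile p)) \<le> Suc M ^ (2 ^ k)"
    using assms(1) by (intro power_increasing) (auto simp: modest_def)
  then have "Suc M ^ (2 ^ cost (compile p)) \<le> 2 ^ b" using word by (rule order_trans)
  then show ?thesis
    using assms unfolding modest_def by (intro runs_mono[OF runs_compile[of p s n l M c b]]) auto
qed

lemma runs_move:
  assumes "fits 32 e" "v < 32" "64 \<le> s" "no_temps (mem c)" "bounded s (Suc M) c" "0 < M"
    and "cost (move v e) \<le> k" "max_const (move v e) \<le> M"
  shows "runs s b k (move v e) c (return_pmf (sem (move v e) c))"
proof -
  have "Suc M ^ (2 ^ cost (move v e)) \<le> Suc M ^ (2 ^ k)"
    using assms(7) by (intro power_increasing) auto
  then have "Suc M ^ (2 ^ cost (move v e)) \<le> 2 ^ b" using word by (rule order_trans)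
  then show ?thesis
    using runs_straight[of "move v e" "Suc M" s c b] sem_move[OF assms(1-4)] assms(5-8)
    by (intro runs_mono[OF _ assms(7)]) auto
qed

lemma regular_modest: "modest k M p \<Longrightarrow> regular s n l M c \<Longrightarrow> regular s n l M (den p c)"
  unfolding modest_def by (auto intro: regular_den)

lemma den_countdown:
  assumes "regular s n l M c" "v \<notin> assigned p" "variable v" "modest k M p"
  shows "mem (den (countdown v p) c) v = mem c v - 1"
proof -
  have "mem (den p c) v = mem c v"
    using assms by (intro den_unassigned) (auto simp: variable_def)
  moreover have "mem c v \<le> M" "0 < M" "mem (den p c) 2 = M"
    using assms regular_den[of p s n l M c] by (auto simp: regular_def bounded_def less_Suc_eq_le modest_def)
  ultimately show ?thesis by (simp add: countdown_def mod_if)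
qed

lemma regular_funpow:
  assumes "modest k M p" "regular s n l M c"
  shows "regular s n l M ((den p ^^ N) c)"
  by (induction N) (use assms regular_modest in auto)

lemma runs_For:
  assumes p: "modest k M (countdown v p)" "v \<notin> assigned p" and c: "regular s n l M c" and v: "mem c v = N"
  shows "runs s b (N * Suc k + 1) (For v p) c (return_pmf ((den (countdown v p) ^^ N) c))"
proof -
  have p': "modest k M p" "variable v" using p(1) by (auto simp: modest_def countdown_def)
  have "runs s b (N * Suc k + 1) (For v p) c
      (kernel_power N (\<lambda>c. return_pmf (den (countdown v p) c)) c)"
    unfolding For_def
  proof (rule runs_While[where I = "\<lambda>j c. regular s n l M c \<and> mem c v = N - j"])
    fix j c assume "regular s n l M c \<and> mem c v = N - j"
    then show "mem c v = N - j \<and> safe s b c" using regular_safe by blast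
  next
    fix j c c' assume "regular s n l M c \<and> mem c v = N - j" "c' \<in> set_pmf (return_pmf (den (countdown v p) c))"
    then show "regular s n l M c' \<and> mem c' v = N - Suc j"
      using den_countdown[of l c v p] p p' regular_modest[OF p(1)] by auto
  qed (use p c v runs_com in auto)
  then show ?thesis by (simp add: kernel_power_return)
qed

end

section \<open>Choosing the modulus\<close>

text \<open>Started from 0 and repeated \<open>n\<close> times, this ends at \<open>root4 n\<close>,
  which is at most \<open>n\<close>.\<close>

definition grow :: com where
  "grow = Branch (power_expr (Var 3) 4 [<] Var 0) (Assign 3 (Var 3 [+] Num 1)) Nop"

text \<open>Register 19 holds \<open>y\<close>, 20 the range \<open>y ^ 6\<close> of the draws, 5
  the product, 21 the number of factors and 22 the number of draws still to come, 23 the trial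
  divisor, 24 the number drawn, 25 the last prime found, and 26 whether the drawn number still
  passes for a prime.\<close>

definition init_draws :: "nat \<Rightarrow> com" where
  "init_draws C = (Assign 19 (Num C [*] Var 3) ;; Assign 20 (power_expr (Var 19) 6) ;;
     Assign 5 (Num 1) ;; Assign 21 (Num 24))"

definition init_search :: com where
  "init_search = (Assign 25 (Num 1) ;; Assign 22 (Var 19))"

definition init_trial :: com where
  "init_trial = (Branch (Num 2 [<=] Var 24) (Assign 26 (Num 1)) (Assign 26 (Num 0)) ;;
     Assign 23 (power_expr (Var 19) 3))"

definition trial :: com where
  "trial = Branch (Num 2 [<=] Var 23) (Branch (Var 23 [<] Var 24)
     (Branch (Var 24 [mod] Var 23) Nop (Assign 26 (Num 0))) Nop) Nop"

definition end_trial :: com where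
  "end_trial = (Branch (Var 26) (Assign 25 (Var 24)) Nop ;; Assign 24 (Num 0) ;; Assign 26 (Num 0) ;;
     Assign 22 (Var 22 [-] Num 1))"

definition end_search :: com where
  "end_search = (Assign 5 (Var 5 [*] Var 25) ;; Assign 25 (Num 0) ;; Assign 21 (Var 21 [-] Num 1))"

definition draw_prog :: prog where
  "draw_prog = Seq (Random 24 20) (Seq (compile init_trial) (Seq (For 23 trial) (compile end_trial)))"

definition search_prog :: prog where
  "search_prog = Seq (compile init_search) (Seq (While 22 draw_prog) (compile end_search))"

definition root4 :: "nat \<Rightarrow> nat" where
  "root4 n = (LEAST r. n \<le> r ^ 4)"

lemma root4: "n \<le> root4 n ^ 4"
  unfolding root4_def by (rule LeastI[of _ n]) (simp add: self_le_power power_eq_if)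

lemma root4_le: "n \<le> r ^ 4 \<Longrightarrow> root4 n \<le> r"
  unfolding root4_def by (rule Least_le)

lemma root4_le_self: "root4 n \<le> n"
  by (rule root4_le) (cases n; simp add: power_eq_if)

text \<open>Variable 1 limits the array writes and no command can assign it, so it is set by a bare
  \<open>move\<close>. Until then the limit is 0.\<close>

definition scale_prog :: prog where
  "scale_prog = Seq (compile (Assign 3 (Num 0) ;; Assign 17 (Var 0)))
     (Seq (For 17 grow) (Seq (compile (Assign 4 (Var 3 [*] Var 3))) (move 1 (Num 64 [*] Var 4))))"

lemma mem_update_idI: "(\<And>a. f a = mem c a) \<Longrightarrow> c = c\<lparr>mem := f\<rparr>"
  by (cases c) (simp add: ext)

lemma ex_at_least_split:
  "(a :: nat) \<le> m \<Longrightarrow> (\<exists>d. a \<le> d \<and> d \<le> m \<and> Q d) \<longleftrightarrow> Q a \<or> (\<exists>d. a < d \<and> d \<le> m \<and> Q d)"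
  by (metis le_eq_less_or_eq)

lemma funpow_invariant:
  assumes "I 0 x" "\<And>j x. j < N \<Longrightarrow> I j x \<Longrightarrow> I (Suc j) (f x)"
  shows "I N ((f ^^ N) x)"
proof -
  have "j \<le> N \<Longrightarrow> I j ((f ^^ j) x)" for j
    by (induction j) (use assms in auto)
  then show ?thesis by simp
qed

context resources
begin

lemma grow_loop:
  assumes c: "mem c 0 = n" "mem c 2 = M" "mem c 3 = 0" "mem c 17 = n" and n: "n < M"
  shows "(den (countdown 17 grow) ^^ n) c = c\<lparr>mem := (mem c)(3 := root4 n, 17 := 0)\<rparr>"
proof -
  have "(den (countdown 17 grow) ^^ n) c = c\<lparr>mem := (mem c)(3 := min n (root4 n), 17 := n - n)\<rparr>"
  proof (rule funpow_invariant[where I = "\<lambda>j d. d = c\<lparr>mem := (mem c)(3 := min j (root4 n), 17 := n - j)\<rparr>"])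
    show "c = c\<lparr>mem := (mem c)(3 := min 0 (root4 n), 17 := n - 0)\<rparr>"
      by (rule mem_update_idI) (use c in simp)
  next
    fix j d assume j: "j < n" and d: "d = c\<lparr>mem := (mem c)(3 := min j (root4 n), 17 := n - j)\<rparr>"
    have test: "min j (root4 n) ^ 4 < n \<longleftrightarrow> j < root4 n"
    proof (cases "j < root4 n")
      case True
      then have "\<not> n \<le> j ^ 4" using root4_le[of n j] by linarith
      then show ?thesis using True by (simp add: min_def)
    next
      case False
      then show ?thesis using root4[of n] by (simp add: min_def)
    qed
    have "Suc (min j (root4 n)) < M" using j n by (simp add: min_def)
    moreover have "min (Suc j) (root4 n) = (if j < root4 n then Suc (min j (root4 n)) else min j (root4 n))"
      by simp
    ultimately show "den (countdown 17 grow) d = c\<lparr>mem := (mem c)(3 := min (Suc j) (root4 n), 17 := n - Suc j)\<rparr>"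
      using j n c test unfolding d by (simp add: countdown_def grow_def) (auto intro!: mem_update_eqI)
  qed
  then show ?thesis using root4_le_self[of n] by (simp add: min_def)
qed

lemma runs_scale:
  assumes small: "modest k M (Assign 3 (Num 0) ;; Assign 17 (Var 0))" "modest k M (countdown 17 grow)"
      "modest k M (Assign 4 (Var 3 [*] Var 3))" "cost (move 1 (Num 64 [*] Var 4)) \<le> k"
    and c: "regular s n 0 M c" and M: "n < M" "64 * root4 n ^ 2 < M" "1 \<le> n"
    and s: "64 + 16 * (64 * root4 n ^ 2) \<le> s"
  defines "c' \<equiv> c\<lparr>mem := (mem c)(3 := root4 n, 17 := 0, 4 := root4 n ^ 2, 1 := 64 * root4 n ^ 2)\<rparr>"
  shows "runs s b (3 * k + n * Suc k + 4) scale_prog c (return_pmf c')" "regular s n (64 * root4 n ^ 2) M c'"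
proof -
  define c1 where "c1 = den (Assign 3 (Num 0) ;; Assign 17 (Var 0)) c"
  define c2 where "c2 = (den (countdown 17 grow) ^^ n) c1"
  define c3 where "c3 = den (Assign 4 (Var 3 [*] Var 3)) c2"
  have r1: "regular s n 0 M c1" unfolding c1_def using small(1) c by (rule regular_modest)
  have r2: "regular s n 0 M c2" unfolding c2_def using small(2) r1 by (rule regular_funpow)
  have r3: "regular s n 0 M c3" unfolding c3_def using small(3) r2 by (rule regular_modest)
  have e1: "c1 = c\<lparr>mem := (mem c)(3 := 0, 17 := n)\<rparr>"
    using c M by (simp add: c1_def regular_def)
  have e2: "c2 = c\<lparr>mem := (mem c)(3 := root4 n, 17 := 0)\<rparr>"
    unfolding c2_def using r1 e1 M by (subst grow_loop) (auto simp: regular_def intro!: mem_update_eqI)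
  have e3: "c3 = c\<lparr>mem := (mem c)(3 := root4 n, 17 := 0, 4 := root4 n ^ 2)\<rparr>"
    using r2 M by (simp add: c3_def e2 regular_def power2_eq_square)
  have mv: "sem (move 1 (Num 64 [*] Var 4)) c3 = c'"
    using sem_move[of "Num 64 [*] Var 4" 1 s c3] s r3 by (auto simp: c'_def e3 regular_def)
  show r': "regular s n (64 * root4 n ^ 2) M c'"
    using r3 M s unfolding e3 c'_def by (auto simp: regular_def no_temps_def bounded_def)
  have "0 < root4 n" using root4[of n] M by (cases "root4 n") auto
  then have "1 \<le> root4 n ^ 2" by simp
  then have M64: "64 < M" using M(2) by linarith
  have mc: "max_const (move 1 (Num 64 [*] Var 4)) \<le> 64"
  proof -
    have "max_const (foldr (\<lambda>r. Seq (Const r 0)) rs Skip) = 0" for rs by (induction rs) auto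
    then show ?thesis by (simp add: move_def clear_temps_def)
  qed
  have 4: "runs s b k (move 1 (Num 64 [*] Var 4)) c3 (return_pmf c')"
    using runs_move[of "Num 64 [*] Var 4" 1 c3] mv r3 M64 mc small(4) s by (auto simp: regular_def)
  have 3: "runs s b k (compile (Assign 4 (Var 3 [*] Var 3))) c2 (return_pmf c3)"
    unfolding c3_def using small(3) r2 by (rule runs_com)
  have 2: "runs s b (n * Suc k + 1) (For 17 grow) c1 (return_pmf c2)"
    unfolding c2_def using small(2) r1 by (intro runs_For) (auto simp: grow_def e1)
  have 1: "runs s b k (compile (Assign 3 (Num 0) ;; Assign 17 (Var 0))) c (return_pmf c1)"
    unfolding c1_def using small(1) c by (rule runs_com)
  note r = regular_safe[OF c] regular_safe[OF r1] regular_safe[OF r2]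
  have "runs s b (Suc (k + Suc ((n * Suc k + 1) + Suc (k + k)))) scale_prog c (return_pmf c')"
    unfolding scale_prog_def
    by (intro runs_Seq_return[OF r(1) 1] runs_Seq_return[OF r(2) 2] runs_Seq_return[OF r(3) 3] 4)
  then show "runs s b (3 * k + n * Suc k + 4) scale_prog c (return_pmf c')"
    by (rule runs_mono) simp
qed

text \<open>Trial division up to \<open>y\<^sup>3\<close> decides primality of the numbers below \<open>y ^ 6\<close>.\<close>

lemma prime_iff_trial:
  fixes r y :: nat
  assumes "r < y ^ 6"
  shows "prime r \<longleftrightarrow> 2 \<le> r \<and> (\<forall>d. 0 < d \<and> d \<le> y ^ 3 \<longrightarrow> \<not> (2 \<le> d \<and> d < r \<and> r mod d = 0))" (is "_ \<longleftrightarrow> ?R")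
proof
  assume "prime r"
  then show ?R by (auto simp: prime_ge_2_nat prime_nat_iff mod_eq_0_iff_dvd)
next
  assume R: ?R
  show "prime r"
  proof (rule ccontr)
    assume "\<not> prime r"
    then obtain d where d: "d dvd r" "d \<noteq> 1" "d \<noteq> r" using R by (auto simp: prime_nat_iff)
    then obtain e where e: "r = d * e" by (rule_tac dvdE)
    have "d \<noteq> 0" "e \<noteq> 0" "e \<noteq> 1" using R d e by (metis mult_is_0 not_numeral_le_zero mult.right_neutral)+
    then have de: "2 \<le> d" "2 \<le> e" using d(2) by linarith+
    \<comment> \<open>The square of the smaller cofactor is at most \<open>r\<close>, which is below
      \<open>(y ^ 3) ^ 2\<close>.\<close>
    have "min d e ^ 2 \<le> d * e" unfolding power2_eq_square by (intro mult_le_mono) auto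
    also have "\<dots> < (y ^ 3) ^ 2" using e assms by (simp flip: power_mult)
    finally have "min d e \<le> y ^ 3" by (metis less_imp_le_nat power_less_imp_less_base zero_le)
    moreover have "min d e < r" using e de by (auto simp: min_def)
    moreover have "r mod min d e = 0" using e by (auto simp: min_def)
    ultimately show False using R[THEN conjunct2, rule_format, of "min d e"] de by auto
  qed
qed

lemma den_trial:
  "den trial c = (if 2 \<le> mem c 23 \<and> mem c 23 < mem c 24 \<and> mem c 24 mod mem c 23 = 0
     then c\<lparr>mem := (mem c)(26 := 0)\<rparr> else c)"
proof -
  have "mem c 23 + 1 - 2 \<noteq> 0 \<longleftrightarrow> 2 \<le> mem c 23" "mem c 24 - mem c 23 \<noteq> 0 \<longleftrightarrow> mem c 23 < mem c 24" by auto
  then show ?thesis unfolding trial_def den.simps eval.simps arith.simps by simp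
qed

text \<open>The loop counter doubles as the trial divisor: divisors are tried from \<open>N\<close>
  downwards, and after \<open>j\<close> rounds those above \<open>N - j\<close> are done.\<close>

lemma trial_loop:
  assumes c: "mem c 2 = M" "mem c 23 = N" "mem c 26 = f" "N < M" "f \<le> 1" "1 < M"
  shows "(den (countdown 23 trial) ^^ N) c = c\<lparr>mem := (mem c)(23 := 0,
     26 := if \<exists>d. 0 < d \<and> d \<le> N \<and> 2 \<le> d \<and> d < mem c 24 \<and> mem c 24 mod d = 0 then 0 else f)\<rparr>"
proof -
  let ?Q = "\<lambda>d. 2 \<le> d \<and> d < mem c 24 \<and> mem c 24 mod d = 0"
  define q where "q = (\<lambda>j. \<exists>d. N - j < d \<and> d \<le> N \<and> ?Q d)"
  let ?c = "\<lambda>j. c\<lparr>mem := (mem c)(23 := N - j, 26 := if q j then 0 else f)\<rparr>"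
  have "(den (countdown 23 trial) ^^ N) c = ?c N"
  proof (rule funpow_invariant[where I = "\<lambda>j x. x = ?c j"])
    have "\<not> q 0" by (simp add: q_def)
    then show "c = ?c 0"
      by (intro mem_update_idI) (use c in simp)
  next
    fix j x assume j: "j < N" and x: "x = ?c j"
    have *: "N - Suc j < d \<longleftrightarrow> N - j \<le> d" for d using j by auto
    have q: "q (Suc j) \<longleftrightarrow> ?Q (N - j) \<or> q j"
      unfolding q_def * by (rule ex_at_least_split) simp
    have "mem x 23 = N - j" "mem x 24 = mem c 24" "mem x 2 = M" using c by (simp_all add: x)
    moreover have "N - j - 1 < M" using c by simp
    ultimately have "den (countdown 23 trial) x =
        c\<lparr>mem := (mem c)(23 := N - Suc j, 26 := if ?Q (N - j) then 0 else if q j then 0 else f)\<rparr>"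
      unfolding countdown_def den.simps den_trial
      by (simp add: x c) (intro conjI impI mem_update_eqI; simp)
    then show "den (countdown 23 trial) x = ?c (Suc j)" using q by simp
  qed
  then show ?thesis by (simp add: q_def)
qed

end

definition modulus_prog :: "nat \<Rightarrow> prog" where
  "modulus_prog C = Seq (compile (init_draws C)) (While 21 search_prog)"

lemma den_init_trial:
  assumes "1 < mem c 2" "mem c 19 ^ 3 < mem c 2"
  shows "den init_trial c = c\<lparr>mem := (mem c)(26 := if 2 \<le> mem c 24 then 1 else 0, 23 := mem c 19 ^ 3)\<rparr>"
  using assms by (cases "2 \<le> mem c 24") (simp_all add: init_trial_def)

lemma den_end_trial:
  assumes "mem c 24 < mem c 2" "mem c 22 - 1 < mem c 2"
  shows "den end_trial c = c\<lparr>mem := (mem c)(25 := if mem c 26 \<noteq> 0 then mem c 24 else mem c 25,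
     24 := 0, 26 := 0, 22 := mem c 22 - 1)\<rparr>"
proof (cases "mem c 26 = 0")
  case True
  then have "den end_trial c = c\<lparr>mem := (mem c)(24 := 0, 26 := 0, 22 := mem c 22 - 1)\<rparr>"
    using assms by (simp add: end_trial_def)
  also have "\<dots> = c\<lparr>mem := (mem c)(25 := if mem c 26 \<noteq> 0 then mem c 24 else mem c 25,
     24 := 0, 26 := 0, 22 := mem c 22 - 1)\<rparr>"
    using True by (intro mem_update_eqI) simp
  finally show ?thesis .
next
  case False
  then show ?thesis using assms by (simp add: end_trial_def)
qed

context resources
begin

text \<open>Registers 23, 24 and 26 return to 0 between draws, so that a draw changes nothing but 25
  and 22 and its effect can be given exactly by the kernel \<open>draw\<close>.\<close>

definition ready :: "nat \<Rightarrow> nat \<Rightarrow> config \<Rightarrow> bool" where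
  "ready l y c \<longleftrightarrow> regular s n l M c \<and> mem c 19 = y \<and> mem c 20 = y ^ 6 \<and>
     mem c 23 = 0 \<and> mem c 24 = 0 \<and> mem c 26 = 0"

definition draw :: "config \<Rightarrow> config pmf" where
  "draw c = map_pmf (\<lambda>r. c\<lparr>mem := (mem c)(25 := if prime r then r else mem c 25, 22 := mem c 22 - 1)\<rparr>)
     (pmf_of_set {..<mem c 20})"

definition search :: "nat \<Rightarrow> config \<Rightarrow> config pmf" where
  "search y c = map_pmf (\<lambda>p. c\<lparr>mem := (mem c)(5 := mem c 5 * p, 21 := mem c 21 - 1)\<rparr>) (last_prime (y ^ 6) y 1)"

lemma regular_update:
  assumes "regular s n l M c" "variable v" "x \<le> M"
  shows "regular s n l M (c\<lparr>mem := (mem c)(v := x)\<rparr>)"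
  using assms by (auto simp: regular_def no_temps_def bounded_def variable_def)

lemma regular_le: "regular s n l M c \<Longrightarrow> mem c a \<le> M"
  by (auto simp: regular_def bounded_def less_Suc_eq_le)

lemma runs_draw:
  assumes small: "modest k M init_trial" "modest k M (countdown 23 trial)" "modest k M end_trial"
    and c: "ready l y c" and y: "1 \<le> y" "y ^ 6 < M"
  shows "runs s b (y ^ 3 * Suc k + 2 * k + 5) draw_prog c (draw c)"
proof -
  let ?D = "map_pmf (\<lambda>x. set_reg 24 x c) (pmf_of_set {..<mem c 20})"
  let ?res = "\<lambda>r. c\<lparr>mem := (mem c)(25 := if prime r then r else mem c 25, 22 := mem c 22 - 1)\<rparr>"
  have reg: "regular s n l M c" and c20: "mem c 20 = y ^ 6" and c19: "mem c 19 = y"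
    and c0: "mem c 23 = 0" "mem c 24 = 0" "mem c 26 = 0" and M: "mem c 2 = M"
    using c by (auto simp: ready_def regular_def)
  have ne: "{..<mem c 20} \<noteq> {}" using y c20 by (auto simp: lessThan_empty_iff)
  have "y ^ 3 \<le> y ^ 6" using y by (intro power_increasing) auto
  then have y3: "y ^ 3 < M" using y by simp
  have "1 \<le> y ^ 6" using y by simp
  then have M1: "1 < M" using y by linarith
  have rest: "runs s b (Suc (k + Suc ((y ^ 3 * Suc k + 1) + k)))
      (Seq (compile init_trial) (Seq (For 23 trial) (compile end_trial))) c' (return_pmf (?res (mem c' 24)))"
    if "c' \<in> set_pmf ?D" for c'
  proof -
    have "c' \<in> (\<lambda>x. set_reg 24 x c) ` {..<y ^ 6}"
      using that ne by (simp add: c20 set_pmf_of_set)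
    then obtain r where r: "r < y ^ 6" and c': "c' = c\<lparr>mem := (mem c)(24 := r)\<rparr>"
      unfolding set_reg_def by blast
    define c1 where "c1 = den init_trial c'"
    define c2 where "c2 = (den (countdown 23 trial) ^^ (y ^ 3)) c1"
    define c3 where "c3 = den end_trial c2"
    have reg': "regular s n l M c'"
      unfolding c' using r y by (intro regular_update[OF reg]) (auto simp: variable_def)
    have reg1: "regular s n l M c1" unfolding c1_def using small(1) reg' by (rule regular_modest)
    have reg2: "regular s n l M c2" unfolding c2_def using small(2) reg1 by (rule regular_funpow)
    let ?f = "if 2 \<le> r then 1 else 0 :: nat"
    have c1: "c1 = c\<lparr>mem := (mem c)(24 := r, 26 := ?f, 23 := y ^ 3)\<rparr>"
      unfolding c1_def c' by (subst den_init_trial) (use M c19 y3 M1 in simp_all)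
    define X where "X \<longleftrightarrow> (\<exists>d. 0 < d \<and> d \<le> y ^ 3 \<and> 2 \<le> d \<and> d < r \<and> r mod d = 0)"
    have "(\<forall>d. 0 < d \<and> d \<le> y ^ 3 \<longrightarrow> \<not> (2 \<le> d \<and> d < r \<and> r mod d = 0)) \<longleftrightarrow> \<not> X"
      by (simp only: X_def not_ex de_Morgan_conj imp_conv_disj disj_assoc)
    then have P: "prime r \<longleftrightarrow> 2 \<le> r \<and> \<not> X"
      by (simp only: prime_iff_trial[OF r])
    have c1r: "mem c1 24 = r" "mem c1 2 = M" "mem c1 23 = y ^ 3" "mem c1 26 = ?f" using c1 M by simp_all
    have "c2 = c1\<lparr>mem := (mem c1)(23 := 0, 26 := if X then 0 else ?f)\<rparr>"
      using trial_loop[OF c1r(2-4) y3 _ M1] unfolding c2_def X_def c1r(1) by simp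
    moreover have "(if X then 0 else ?f) = (if prime r then 1 else 0)"
      by (simp only: P) simp
    ultimately have c2: "c2 = c1\<lparr>mem := (mem c1)(23 := 0, 26 := if prime r then 1 else 0)\<rparr>"
      by (simp only:)
    have le: "mem c 22 - 1 < M" using regular_le[OF reg, of 22] M1 by linarith
    have rM: "r < M" using r y by linarith
    have c3: "c3 = ?res r"
      unfolding c3_def c2 c1 using M le rM c0
      by (subst den_end_trial) (simp_all, auto intro!: mem_update_eqI)
    have "runs s b (Suc (k + Suc ((y ^ 3 * Suc k + 1) + k)))
      (Seq (compile init_trial) (Seq (For 23 trial) (compile end_trial))) c' (return_pmf c3)"
    proof (rule runs_Seq_return[OF regular_safe[OF reg'] _ runs_Seq_return[OF regular_safe[OF reg1]]])
      show "runs s b k (compile init_trial) c' (return_pmf c1)"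
        unfolding c1_def using small(1) reg' by (rule runs_com)
      show "runs s b (y ^ 3 * Suc k + 1) (For 23 trial) c1 (return_pmf c2)"
        unfolding c2_def using small(2) reg1 by (intro runs_For) (auto simp: trial_def c1)
      show "runs s b k (compile end_trial) c2 (return_pmf c3)"
        unfolding c3_def using small(3) reg2 by (rule runs_com)
    qed
    moreover have "mem c' 24 = r" by (simp add: c')
    ultimately show ?thesis by (simp only: c3)
  qed
  have "runs s b (Suc (1 + Suc (k + Suc ((y ^ 3 * Suc k + 1) + k)))) draw_prog c
      (bind_pmf ?D (\<lambda>c'. return_pmf (?res (mem c' 24))))"
    unfolding draw_prog_def using ne
    by (intro runs_Seq rest regular_safe[OF reg] runs_Random) auto
  also have "bind_pmf ?D (\<lambda>c'. return_pmf (?res (mem c' 24))) = draw c"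
  proof -
    have "mem (set_reg 24 x c) 24 = x" for x by (simp add: set_reg_def)
    then show ?thesis
      by (simp add: draw_def map_pmf_def bind_assoc_pmf bind_return_pmf cong: if_cong)
  qed
  finally show ?thesis by (rule runs_mono) simp
qed

lemma ready_draw:
  assumes c: "ready l y c" and c': "c' \<in> set_pmf (draw c)" and y: "1 \<le> y" "y ^ 6 < M"
  shows "ready l y c' \<and> mem c' 22 = mem c 22 - 1"
proof -
  have ne: "{..<mem c 20} \<noteq> {}" using y c by (auto simp: lessThan_empty_iff ready_def)
  obtain r where r: "r < y ^ 6"
      "c' = c\<lparr>mem := (mem c)(25 := if prime r then r else mem c 25, 22 := mem c 22 - 1)\<rparr>"
    using c' ne c by (auto simp: draw_def ready_def)
  have reg: "regular s n l M c" using c by (simp add: ready_def)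
  have "regular s n l M (c\<lparr>mem := (mem c)(25 := if prime r then r else mem c 25)\<rparr>)"
    using r y regular_le[OF reg, of 25] by (intro regular_update[OF reg]) (auto simp: variable_def)
  from regular_update[OF this, of 22 "mem c 22 - 1"] show ?thesis
    using c regular_le[OF reg, of 22] unfolding r(2) by (auto simp: ready_def variable_def)
qed

lemma kernel_power_draw:
  "mem c 22 = t \<Longrightarrow> kernel_power t draw c =
     map_pmf (\<lambda>p. c\<lparr>mem := (mem c)(25 := p, 22 := 0)\<rparr>) (last_prime (mem c 20) t (mem c 25))"
proof (induction t arbitrary: c)
  case 0
  then have "c\<lparr>mem := (mem c)(25 := mem c 25, 22 := 0)\<rparr> = c"
    by (intro mem_update_idI[symmetric]) simp
  then show ?case unfolding kernel_power.simps last_prime.simps map_return_pmf by (rule arg_cong[OF sym])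
next
  case (Suc t)
  let ?c = "\<lambda>r. c\<lparr>mem := (mem c)(25 := if prime r then r else mem c 25, 22 := t)\<rparr>"
  have dc: "draw c = map_pmf ?c (pmf_of_set {..<mem c 20})" by (simp add: draw_def Suc.prems)
  have kp: "kernel_power t draw (?c r) = map_pmf (\<lambda>p. c\<lparr>mem := (mem c)(25 := p, 22 := 0)\<rparr>)
      (last_prime (mem c 20) t (if prime r then r else mem c 25))" for r
    by (subst Suc.IH) (auto intro!: map_pmf_cong mem_update_eqI)
  show ?case unfolding kernel_power.simps dc bind_map_pmf kp last_prime.simps map_bind_pmf ..
qed

lemma runs_search:
  assumes small: "modest k M init_trial" "modest k M (countdown 23 trial)" "modest k M end_trial"
      "modest k M init_search" "modest k M end_search"
    and c: "ready l y c" "mem c 22 = 0" "mem c 25 = 0" and y: "1 \<le> y" "y ^ 6 < M" "mem c 5 * y ^ 6 < M"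
  shows "runs s b (y * (y ^ 3 * Suc k + 2 * k + 6) + 2 * k + 3) search_prog c (search y c)"
proof -
  define c1 where "c1 = den init_search c"
  have reg: "regular s n l M c" using c by (simp add: ready_def)
  have reg1: "regular s n l M c1" unfolding c1_def using small(4) reg by (rule regular_modest)
  have "y ^ 1 \<le> y ^ 6" using y by (intro power_increasing) auto
  then have yM: "y < M" "1 < M" using y by auto
  have c1: "c1 = c\<lparr>mem := (mem c)(25 := 1, 22 := y)\<rparr>"
    using c yM by (simp add: c1_def init_search_def ready_def regular_def)
  have ready1: "ready l y c1" using c(1) reg1 unfolding c1 by (simp add: ready_def)
  have 1: "runs s b k (compile init_search) c (return_pmf c1)"
    unfolding c1_def using small(4) reg by (rule runs_com)
  have 2: "runs s b (y * Suc (y ^ 3 * Suc k + 2 * k + 5) + 1) (While 22 draw_prog) c1 (kernel_power y draw c1)"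
  proof (rule runs_While[where I = "\<lambda>j c. ready l y c \<and> mem c 22 = y - j"])
    show "runs s b (y ^ 3 * Suc k + 2 * k + 5) draw_prog d (draw d)"
      if "ready l y d \<and> mem d 22 = y - j" for j d
      using that small y by (intro runs_draw) auto
    show "ready l y d' \<and> mem d' 22 = y - Suc j"
      if "ready l y d \<and> mem d 22 = y - j" "d' \<in> set_pmf (draw d)" for j d d'
      using ready_draw[of l y d d'] that y by auto
    show "mem d 22 = y - j \<and> safe s b d" if "ready l y d \<and> mem d 22 = y - j" for j d
      using that regular_safe by (auto simp: ready_def)
    show "ready l y c1 \<and> mem c1 22 = y - 0" using ready1 by (simp add: c1)
  qed
  have kp: "kernel_power y draw c1 = map_pmf (\<lambda>p. c1\<lparr>mem := (mem c1)(25 := p, 22 := 0)\<rparr>) (last_prime (y ^ 6) y 1)"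
    using c by (subst kernel_power_draw) (auto simp: c1 ready_def)
  have 3: "runs s b k (compile end_search) d (return_pmf (den end_search d))"
    if d: "d \<in> set_pmf (kernel_power y draw c1)" for d
  proof -
    obtain p where p: "p \<in> set_pmf (last_prime (y ^ 6) y 1)" "d = c1\<lparr>mem := (mem c1)(25 := p, 22 := 0)\<rparr>"
      using d unfolding kp set_map_pmf by blast
    have "p \<le> M" using last_prime_bounds[OF p(1)] y by simp
    then have "regular s n l M d"
      unfolding p(2) using regular_update[OF regular_update[OF reg1, of 25 p], of 22 0] by (simp add: variable_def)
    with small(5) show ?thesis by (rule runs_com)
  qed
  have "runs s b (Suc (k + Suc ((y * Suc (y ^ 3 * Suc k + 2 * k + 5) + 1) + k))) search_prog c
      (bind_pmf (kernel_power y draw c1) (\<lambda>d. return_pmf (den end_search d)))"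
    unfolding search_prog_def
    by (intro runs_Seq_return[OF regular_safe[OF reg] 1] runs_Seq[OF regular_safe[OF reg1] 2 3])
  also have "bind_pmf (kernel_power y draw c1) (\<lambda>d. return_pmf (den end_search d)) = search y c"
  proof -
    have "den end_search (c1\<lparr>mem := (mem c1)(25 := p, 22 := 0)\<rparr>) =
        c\<lparr>mem := (mem c)(5 := mem c 5 * p, 21 := mem c 21 - 1)\<rparr>"
      if "p \<in> set_pmf (last_prime (y ^ 6) y 1)" for p
    proof -
      have "p \<le> y ^ 6" using last_prime_bounds[OF that] y by simp
      then have "mem c 5 * p \<le> mem c 5 * y ^ 6" by (rule mult_le_mono2)
      then have 5: "mem c 5 * p < M" using y by linarith
      have 21: "mem c 21 - 1 < M" using regular_le[OF reg, of 21] yM by linarith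
      show ?thesis using c 5 21 reg unfolding c1 end_search_def
        by (simp add: regular_def) (intro mem_update_eqI; simp)
    qed
    then show ?thesis unfolding kp search_def map_pmf_def bind_assoc_pmf bind_return_pmf
      by (intro bind_pmf_cong refl) simp
  qed
  finally show ?thesis by (rule runs_mono) simp
qed

lemma kernel_power_search:
  "mem c 21 = t \<Longrightarrow> kernel_power t (search y) c =
     map_pmf (\<lambda>m. c\<lparr>mem := (mem c)(5 := m, 21 := 0)\<rparr>) (prime_product (y ^ 6) y t (mem c 5))"
proof (induction t arbitrary: c)
  case 0
  then have "c\<lparr>mem := (mem c)(5 := mem c 5, 21 := 0)\<rparr> = c"
    by (intro mem_update_idI[symmetric]) simp
  then show ?case unfolding kernel_power.simps prime_product.simps map_return_pmf by (rule arg_cong[OF sym])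
next
  case (Suc t)
  let ?c = "\<lambda>p. c\<lparr>mem := (mem c)(5 := mem c 5 * p, 21 := t)\<rparr>"
  have sc: "search y c = map_pmf ?c (last_prime (y ^ 6) y 1)" by (simp add: search_def Suc.prems)
  have kp: "kernel_power t (search y) (?c p) = map_pmf (\<lambda>m. c\<lparr>mem := (mem c)(5 := m, 21 := 0)\<rparr>)
      (prime_product (y ^ 6) y t (mem c 5 * p))" for p
    by (subst Suc.IH) (auto intro!: map_pmf_cong mem_update_eqI)
  show ?case unfolding kernel_power.simps sc bind_map_pmf kp prime_product.simps map_bind_pmf ..
qed

lemma runs_modulus:
  assumes small: "modest k M init_trial" "modest k M (countdown 23 trial)" "modest k M end_trial"
      "modest k M init_search" "modest k M end_search" "modest k M (init_draws C)"
    and c: "regular s n l M c" "\<And>v. 20 \<le> v \<Longrightarrow> v < 32 \<Longrightarrow> mem c v = 0"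
    and y: "y = C * mem c 3" "1 \<le> y" "(y ^ 6) ^ 24 < M" "24 < M"
  shows "runs s b (24 * (y * (y ^ 3 * Suc k + 2 * k + 6) + 2 * k + 4) + k + 2) (modulus_prog C) c
    (map_pmf (\<lambda>m. c\<lparr>mem := (mem c)(19 := y, 20 := y ^ 6, 5 := m)\<rparr>) (prime_product (y ^ 6) y 24 1))"
proof -
  define c1 where "c1 = den (init_draws C) c"
  have reg1: "regular s n l M c1" unfolding c1_def using small(6) c(1) by (rule regular_modest)
  have "(y ^ 6) ^ 1 \<le> (y ^ 6) ^ 24" using y(2) by (intro power_increasing) auto
  then have y6: "y ^ 6 < M" using y(3) by simp
  have "y ^ 1 \<le> y ^ 6" using y by (intro power_increasing) auto
  then have yM: "y < M" using y6 by simp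
  have c1: "c1 = c\<lparr>mem := (mem c)(19 := y, 20 := y ^ 6, 5 := 1, 21 := 24)\<rparr>"
    using c(1) y y6 yM by (simp add: c1_def init_draws_def regular_def)
  have 1: "runs s b k (compile (init_draws C)) c (return_pmf c1)"
    unfolding c1_def using small(6) c(1) by (rule runs_com)
  \<comment> \<open>After \<open>j\<close> factors the product is at most
    \<open>(y ^ 6) ^ j\<close>, which is below \<open>M\<close> up to \<open>j = 24\<close>, so the
    reduction built into \<open>Assign\<close> does not alter it.\<close>
  let ?I = "\<lambda>j d. ready l y d \<and> mem d 22 = 0 \<and> mem d 25 = 0 \<and> mem d 21 = 24 - j \<and> mem d 5 \<le> (y ^ 6) ^ j"
  have step: "mem d 5 * y ^ 6 \<le> (y ^ 6) ^ Suc j" "(y ^ 6) ^ Suc j < M" if "?I j d" "j < 24" for j d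
  proof -
    show "mem d 5 * y ^ 6 \<le> (y ^ 6) ^ Suc j" using that by simp
    have "(y ^ 6) ^ Suc j \<le> (y ^ 6) ^ 24" using that y by (intro power_increasing) auto
    then show "(y ^ 6) ^ Suc j < M" using y by simp
  qed
  have 2: "runs s b (24 * Suc (y * (y ^ 3 * Suc k + 2 * k + 6) + 2 * k + 3) + 1) (While 21 search_prog) c1
      (kernel_power 24 (search y) c1)"
  proof (rule runs_While[where I = ?I])
    fix j d assume j: "j < 24" and d: "?I j d"
    show "runs s b (y * (y ^ 3 * Suc k + 2 * k + 6) + 2 * k + 3) search_prog d (search y d)"
      using le_less_trans[OF step[OF d j]] d small y(2) y6 by (intro runs_search) auto
  next
    fix j d d' assume j: "j < 24" and d: "?I j d" and d': "d' \<in> set_pmf (search y d)"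
    obtain p where p: "p \<in> set_pmf (last_prime (y ^ 6) y 1)"
        "d' = d\<lparr>mem := (mem d)(5 := mem d 5 * p, 21 := mem d 21 - 1)\<rparr>"
      using d' by (auto simp: search_def)
    have "p \<le> y ^ 6" using last_prime_bounds[OF p(1)] y by simp
    then have "mem d 5 * p \<le> mem d 5 * y ^ 6" by (rule mult_le_mono2)
    then have 5: "mem d 5 * p \<le> (y ^ 6) ^ Suc j" "mem d 5 * p < M" using step[OF d j] by linarith+
    have reg: "regular s n l M d" using d by (simp add: ready_def)
    have "regular s n l M (d\<lparr>mem := (mem d)(5 := mem d 5 * p)\<rparr>)"
      using 5 by (intro regular_update[OF reg]) (auto simp: variable_def)
    from regular_update[OF this, of 21 "mem d 21 - 1"] have "regular s n l M d'"
      using regular_le[OF reg, of 21] by (simp add: p(2) variable_def)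
    then show "?I (Suc j) d'" using d 5(1) unfolding p(2) by (simp add: ready_def del: power_Suc)
  next
    fix j d assume "?I j d"
    then show "mem d 21 = 24 - j \<and> safe s b d" using regular_safe by (auto simp: ready_def)
  next
    show "?I 0 c1" using reg1 c(2) unfolding c1 by (simp add: ready_def)
  qed
  have "runs s b (Suc (k + (24 * Suc (y * (y ^ 3 * Suc k + 2 * k + 6) + 2 * k + 3) + 1))) (modulus_prog C) c
      (kernel_power 24 (search y) c1)"
    unfolding modulus_prog_def by (rule runs_Seq_return[OF regular_safe[OF c(1)] 1 2])
  also have "kernel_power 24 (search y) c1 =
      map_pmf (\<lambda>m. c\<lparr>mem := (mem c)(19 := y, 20 := y ^ 6, 5 := m)\<rparr>) (prime_product (y ^ 6) y 24 1)"
    using c(2)[of 21] by (subst kernel_power_search) (auto simp: c1 intro!: map_pmf_cong mem_update_eqI)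
  finally show ?thesis by (rule runs_mono) simp
qed

end

section \<open>The two passes\<close>

text \<open>Registers: 4 is \<open>B\<close>, 5 the modulus, 6 the position, 7 to 9 the two prefix
  hashes and the power of \<open>M\<close> there, 10 the length L, 11 and 12 the length found by the
  first pass and whether it is below \<open>8 * B\<close>, 13 the number of stored centres, 14 and
  16 the number of flags so far and the flag of the current block, 18 the edge to be tested. Arrays:
  0 to 2 hold the checkpoint hashes, 3 the best length per edge, 4 the slot number per block, 5 to 7
  the ring of recent hashes, 8 the centres.\<close>

definition save :: "nat \<Rightarrow> expr \<Rightarrow> com" where
  "save f e = (Put f e (Var 7) ;; Put (f + 1) e (Var 8) ;; Put (f + 2) e (Var 9))"

definition match :: "nat \<Rightarrow> expr \<Rightarrow> expr" where
  "match f e = ((Var 7 [*] Cell (f + 2) e [+] Cell (f + 1) e) [mod] Var 5 [=]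
     (Var 8 [+] Cell f e [*] Var 9) [mod] Var 5)"

definition read_symbol :: com where
  "read_symbol = (Input 15 ;;
     Assign 7 ((Var 7 [*] Var 2 [+] Var 15) [mod] Var 5) ;;
     Assign 8 ((Var 8 [+] Var 15 [*] Var 9) [mod] Var 5) ;;
     Assign 9 ((Var 9 [*] Var 2) [mod] Var 5) ;;
     Assign 6 (Var 6 [+] Num 1))"

text \<open>At the first position of a block its flag \<open>e\<close> is evaluated. The running
  number of flags is the slot number of a flagged block, while 0 in array 4 marks an unflagged
  one.\<close>

definition store :: "expr \<Rightarrow> com" where
  "store e =
     (Branch (Var 6 [mod] Var 4) Nop
        (Assign 16 e ;; Assign 14 (Var 14 [+] Var 16) ;; Put 4 (Var 6 [div] Var 4) (Var 14 [*] Var 16)) ;;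
      Branch (Var 16) (save 5 (Var 14 [mod] Num 32 [*] Var 4 [+] Var 6 [mod] Var 4)) Nop)"

text \<open>Checkpoints lie at the last position of a block, because shortening a palindrome moves
  its left end forward.\<close>

definition checkpoint :: com where
  "checkpoint = Branch ((Var 6 [+] Num 1) [mod] Var 4) Nop (save 0 (Var 6 [div] Var 4))"

definition test_at :: "expr \<Rightarrow> com \<Rightarrow> com" where
  "test_at e p = Branch (Cell 4 (e [div] Var 4))
     (Branch (match 5 (Cell 4 (e [div] Var 4) [mod] Num 32 [*] Var 4 [+] e [mod] Var 4)) p Nop) Nop"

definition extend :: com where
  "extend = Branch (Num 2 [*] Var 10 [+] Num 2 [<=] Var 6)
     (test_at (Var 6 [-] (Num 2 [*] Var 10 [+] Num 2))
        (Assign 10 (Var 10 [+] Num 1) ;; Assign 13 (Num 0))) Nop"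

text \<open>The recurring difference is the distance from \<open>edge k\<close> to the current
  position, with \<open>k\<close> in register 18. Only an even distance can be spanned, by a
  palindrome of half that length.\<close>

definition aligned :: com where
  "aligned = (Branch (Var 18 [*] Var 4 [+] Var 4 [<=] Var 6 [+] Num 1)
      (Branch ((Var 6 [+] Num 1 [-] (Var 18 [*] Var 4 [+] Var 4)) [mod] Num 2) Nop
        (Branch (match 0 (Var 18))
           (Put 3 (Var 18) ((Var 6 [+] Num 1 [-] (Var 18 [*] Var 4 [+] Var 4)) [div] Num 2) ;;
            Branch (Var 10 [<] (Var 6 [+] Num 1 [-] (Var 18 [*] Var 4 [+] Var 4)) [div] Num 2)
              (Assign 10 ((Var 6 [+] Num 1 [-] (Var 18 [*] Var 4 [+] Var 4)) [div] Num 2)) Nop)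
           Nop)) Nop ;;
     Assign 18 (Var 18 [-] Num 1))"

definition init_pass :: com where
  "init_pass = (Assign 6 (Num 0) ;; Assign 7 (Num 0) ;; Assign 8 (Num 0) ;; Assign 9 (Num 1 [mod] Var 5) ;;
     Assign 14 (Num 0) ;; Assign 16 (Num 0) ;; Assign 17 (Var 0))"

text \<open>The exact extension by one is tried only while the left end surely lies in the ring of
  recent hashes. Why five edges are enough is shown in \<open>approx_complete\<close>.\<close>

definition pass1 :: com where
  "pass1 = (read_symbol ;; store (Num 1) ;; checkpoint ;;
     Branch (Var 10 [<] Num 8 [*] Var 4) extend Nop ;;
     Assign 18 ((Var 6 [+] Num 2 [*] Var 4 [-] Num 2 [*] Var 10) [div] Var 4) ;;
     aligned ;; aligned ;; aligned ;; aligned ;; aligned)"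

text \<open>\<open>1 - (1 - x)\<close> turns every positive value into 1, as the flags are summed
  up. Here \<open>x\<close> is positive if register 12 is set or the best length at the edge exceeds
  \<open>L1 - B\<close>.\<close>

definition flag_expr :: expr where
  "flag_expr = Num 1 [-] (Num 1 [-] (Var 12 [+] (Cell 3 (Var 6 [div] Var 4) [+] Var 4 [-] Var 11)))"

definition hit :: com where
  "hit = Branch (Num 2 [*] Var 10 [<=] Var 6)
     (test_at (Var 6 [-] Num 2 [*] Var 10)
        (Branch (Var 12) (Output (Var 6 [-] Var 10))
           (Put 8 (Var 13) (Var 6 [-] Var 10) ;; Assign 13 (Var 13 [+] Num 1)))) Nop"

definition pass2 :: com where
  "pass2 = (read_symbol ;; store flag_expr ;; extend ;; hit)"

definition start1 :: com where
  "start1 = (Assign 10 (Num 0) ;; init_pass ;; store (Num 1) ;; checkpoint)"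

definition start2 :: com where
  "start2 = (Assign 12 (Num 1 [-] (Num 1 [-] (Num 8 [*] Var 4 [-] Var 10))) ;; Assign 11 (Var 10) ;;
     Assign 13 (Num 0) ;; Branch (Var 12) (Output (Var 10)) Nop ;; init_pass ;; store flag_expr)"

text \<open>Capping the number of listed centres by variable 1 bounds the running time even if the
  hashes have gone wrong.\<close>

definition start3 :: com where
  "start3 = Branch (Var 12) (Assign 17 (Num 0))
     (Output (Var 10) ;; Branch (Var 13 [<] Var 1) (Assign 17 (Var 13)) (Assign 17 (Var 1)))"

definition list_center :: com where
  "list_center = Output (Cell 8 (Var 13 [-] Var 17))"

definition search_palindromes :: prog where
  "search_palindromes = Seq (compile start1) (Seq (For 17 pass1) (Seq (compile start2)
     (Seq (For 17 pass2) (Seq (compile start3) (For 17 list_center)))))"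

definition after_pass1 :: "nat \<Rightarrow> config \<Rightarrow> config" where
  "after_pass1 n c = (den (countdown 17 pass1) ^^ n) (den start1 c)"

definition after_pass2 :: "nat \<Rightarrow> config \<Rightarrow> config" where
  "after_pass2 n c = (den (countdown 17 pass2) ^^ n) (den start2 (after_pass1 n c))"

definition final :: "nat \<Rightarrow> config \<Rightarrow> config" where
  "final n c = (let d = den start3 (after_pass2 n c) in (den (countdown 17 list_center) ^^ mem d 17) d)"

fun arrays :: "com \<Rightarrow> nat set" where
  "arrays (Put f e1 e2) = {f}"
| "arrays (p ;; q) = arrays p \<union> arrays q"
| "arrays (Branch e p q) = arrays p \<union> arrays q"
| "arrays _ = {}"

fun silent :: "com \<Rightarrow> bool" where
  "silent (Input v) = False"
| "silent (Output e) = False"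
| "silent (p ;; q) = (silent p \<and> silent q)"
| "silent (Branch e p q) = (silent p \<and> silent q)"
| "silent _ = True"

lemma addr_eq_iff:
  assumes fg: "f < 16" "g < 16"
  shows "addr f i = addr g j \<longleftrightarrow> f = g \<and> i = j"
proof
  assume "addr f i = addr g j"
  then have eq: "f + 16 * i = g + 16 * j" by (simp add: addr_def)
  have "(f + 16 * i) mod 16 = f" "(g + 16 * j) mod 16 = g"
    using fg by simp_all
  with eq have "f = g" by metis
  then show "f = g \<and> i = j" using eq by simp
qed simp

lemma addr_neq: "v < 64 \<Longrightarrow> addr f i \<noteq> v" "v < 64 \<Longrightarrow> v \<noteq> addr f i"
  by (auto simp: addr_def)

lemma mem_addr_den:
  assumes "wf_com p" "f < 16" "f \<notin> arrays p"
  shows "mem (den p c) (addr f i) = mem c (addr f i)"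
  using assms
proof (induction p arbitrary: c)
  case (Assign v e)
  then show ?case by (auto simp: variable_def addr_neq)
next
  case (Input v)
  then show ?case by (auto simp: variable_def addr_neq set_reg_def split: list.splits)
qed (auto simp: addr_eq_iff)

lemma silent_den: "silent p \<Longrightarrow> stream (den p c) = stream c \<and> emitted (den p c) = emitted c"
  by (induction p arbitrary: c) auto

context resources
begin

text \<open>Nothing is assumed about the modulus: the counters are bounded by \<open>n\<close> and
  \<open>l\<close> whatever the comparisons of hashes say.\<close>

lemma runs_search_palindromes:
  assumes small: "modest k M start1" "modest k M (countdown 17 pass1)" "modest k M start2"
      "modest k M (countdown 17 pass2)" "modest k M start3" "modest k M (countdown 17 list_center)"
    and c: "regular s n l M c" and M: "n < M" "l < M"
  shows "runs s b (3 * k + (2 * n + l) * Suc k + 8) search_palindromes c (return_pmf (final n c))"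
    "safe s b (final n c)"
proof -
  have un: "17 \<notin> assigned pass1" "17 \<notin> assigned pass2" "17 \<notin> assigned list_center"
    by (auto simp: pass1_def pass2_def list_center_def read_symbol_def store_def save_def checkpoint_def
        extend_def test_at_def aligned_def hit_def)
  define c1 where "c1 = den start1 c"
  define c2 where "c2 = after_pass1 n c"
  define c3 where "c3 = den start2 c2"
  define c4 where "c4 = after_pass2 n c"
  define c5 where "c5 = den start3 c4"
  have c2: "c2 = (den (countdown 17 pass1) ^^ n) c1" by (simp add: c2_def after_pass1_def c1_def)
  have c4: "c4 = (den (countdown 17 pass2) ^^ n) c3" by (simp add: c4_def after_pass2_def c3_def c2_def)
  have fin: "final n c = (den (countdown 17 list_center) ^^ mem c5 17) c5" by (simp add: final_def c5_def c4_def Let_def)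
  have r1: "regular s n l M c1" unfolding c1_def using small(1) c by (rule regular_modest)
  have r2: "regular s n l M c2" unfolding c2 using small(2) r1 by (rule regular_funpow)
  have r3: "regular s n l M c3" unfolding c3_def using small(3) r2 by (rule regular_modest)
  have r4: "regular s n l M c4" unfolding c4 using small(4) r3 by (rule regular_funpow)
  have r5: "regular s n l M c5" unfolding c5_def using small(5) r4 by (rule regular_modest)
  have rf: "regular s n l M (final n c)" unfolding fin using small(6) r5 by (rule regular_funpow)
  show "safe s b (final n c)" using rf by (rule regular_safe)
  have init17: "mem (den init_pass d) 17 = n" if "regular s n l M d" for d
    using that M by (simp add: init_pass_def regular_def)
  have store17: "mem (den (store e) d) 17 = mem d 17" "mem (den checkpoint d) 17 = mem d 17" for e d
    by (rule den_unassigned; simp add: store_def save_def checkpoint_def)+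
  have reg_den: "wf_com p \<Longrightarrow> regular s n l M d \<Longrightarrow> regular s n l M (den p d)" for p d
    by (rule regular_den)
  have c1_17: "mem c1 17 = n"
    unfolding c1_def start1_def den.simps(6) store17
    by (intro init17 reg_den c) (simp_all add: variable_def)
  have c3_17: "mem c3 17 = n"
    unfolding c3_def start2_def den.simps(6) store17
    by (intro init17 reg_den r2) (simp_all add: variable_def)
  have c5_17: "mem c5 17 \<le> l"
  proof -
    have "mem c4 2 = M" "mem c4 1 = l" using r4 by (simp_all add: regular_def)
    then show ?thesis using M unfolding c5_def start3_def by simp
  qed
  have 1: "runs s b k (compile start1) c (return_pmf c1)"
    unfolding c1_def using small(1) c by (rule runs_com)
  have 2: "runs s b (n * Suc k + 1) (For 17 pass1) c1 (return_pmf c2)"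
    unfolding c2 using small(2) un(1) r1 c1_17 by (rule runs_For)
  have 3: "runs s b k (compile start2) c2 (return_pmf c3)"
    unfolding c3_def using small(3) r2 by (rule runs_com)
  have 4: "runs s b (n * Suc k + 1) (For 17 pass2) c3 (return_pmf c4)"
    unfolding c4 using small(4) un(2) r3 c3_17 by (rule runs_For)
  have 5: "runs s b k (compile start3) c4 (return_pmf c5)"
    unfolding c5_def using small(5) r4 by (rule runs_com)
  have "runs s b (mem c5 17 * Suc k + 1) (For 17 list_center) c5 (return_pmf (final n c))"
    unfolding fin using small(6) un(3) r5 refl by (rule runs_For)
  then have 6: "runs s b (l * Suc k + 1) (For 17 list_center) c5 (return_pmf (final n c))"
    by (rule runs_mono) (use c5_17 in \<open>simp add: add_mono mult_le_mono1 del: mult_Suc_right\<close>)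
  note rs = regular_safe[OF c] regular_safe[OF r1] regular_safe[OF r2] regular_safe[OF r3] regular_safe[OF r4]
  have "runs s b (Suc (k + Suc (n * Suc k + 1 + Suc (k + Suc (n * Suc k + 1 + Suc (k + (l * Suc k + 1)))))))
      search_palindromes c (return_pmf (final n c))"
    unfolding search_palindromes_def
    by (intro runs_Seq_return[OF rs(1) 1] runs_Seq_return[OF rs(2) 2] runs_Seq_return[OF rs(3) 3]
        runs_Seq_return[OF rs(4) 4] runs_Seq_return[OF rs(5) 5] 6)
  then show "runs s b (3 * k + (2 * n + l) * Suc k + 8) search_palindromes c (return_pmf (final n c))"
    by (rule runs_mono) (simp add: algebra_simps)
qed

end

lemma wf_coms:
  "wf_com init_trial" "wf_com (countdown 23 trial)" "wf_com end_trial" "wf_com init_search" "wf_com end_search"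
  "wf_com (init_draws C)" "wf_com (countdown 17 grow)" "wf_com start1" "wf_com (countdown 17 pass1)"
  "wf_com start2" "wf_com (countdown 17 pass2)" "wf_com start3" "wf_com (countdown 17 list_center)"
  by (simp_all add: init_trial_def countdown_def trial_def end_trial_def init_search_def end_search_def
      init_draws_def grow_def start1_def pass1_def start2_def pass2_def start3_def list_center_def
      init_pass_def store_def save_def checkpoint_def extend_def test_at_def aligned_def hit_def match_def
      read_symbol_def flag_expr_def variable_def fits_power_expr)

section \<open>Hash tables\<close>

definition nflags :: "(nat \<Rightarrow> bool) \<Rightarrow> nat \<Rightarrow> nat" where
  "nflags fl k = card {j. j < k \<and> fl j}"

lemma nflags_Suc: "nflags fl (Suc k) = nflags fl k + (if fl k then 1 else 0)"
proof -
  have "{j. j < Suc k \<and> fl j} = (if fl k then insert k {j. j < k \<and> fl j} else {j. j < k \<and> fl j})"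
    by (auto simp: less_Suc_eq)
  then show ?thesis by (simp add: nflags_def)
qed

lemma nflags_mono: "k \<le> k' \<Longrightarrow> nflags fl k \<le> nflags fl k'"
  unfolding nflags_def by (intro card_mono) auto

lemma nflags_le: "nflags fl k \<le> k"
  using card_mono[of "{..<k}" "{j. j < k \<and> fl j}"] by (auto simp: nflags_def)

lemma nflags_0 [simp]: "nflags fl 0 = 0"
  by (simp add: nflags_def)

lemma block_end_div: "1 \<le> (B :: nat) \<Longrightarrow> (k * B + B - 1) div B = k"
proof -
  assume "1 \<le> B"
  then have "k * B + B - 1 = (B - 1) + k * B" "B - 1 < B" by simp_all
  then show ?thesis using \<open>1 \<le> B\<close> by (simp only: div_mult_self1) simp
qed

text \<open>The modulus is now a fixed faithful number and the remaining argument deterministic.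
  \<open>n \<le> B * B\<close> keeps block numbers inside the arrays, and
  \<open>n + 64 * B < M\<close> protects positions and indices from the reduction modulo
  \<open>M\<close>.\<close>

locale two_pass =
  fixes S :: "nat list" and n M B md :: nat
  assumes length_S: "length S = n" and symbols: "\<And>i. i < n \<Longrightarrow> S ! i < M"
    and B: "1 \<le> B" "n \<le> B * B" and md: "0 < md" "md < M" and M: "n + 64 * B < M"
    and faithful: "faithful M (\<lambda>i. S ! i) n md"
begin

abbreviation "sy \<equiv> (\<lambda>i. S ! i)"

abbreviation "F i \<equiv> fwd_hash M sy i mod md"
abbreviation "R i \<equiv> bwd_hash M sy i mod md"
abbreviation "P i \<equiv> M ^ i mod md"

definition env :: "config \<Rightarrow> bool" where
  "env c \<longleftrightarrow> mem c 0 = n \<and> mem c 1 = 64 * B \<and> mem c 2 = M \<and> mem c 4 = B \<and> mem c 5 = md"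

definition cursor :: "nat \<Rightarrow> config \<Rightarrow> bool" where
  "cursor i c \<longleftrightarrow> mem c 6 = i \<and> mem c 7 = F i \<and> mem c 8 = R i \<and> mem c 9 = P i"

definition hashed :: "nat \<Rightarrow> nat \<Rightarrow> nat \<Rightarrow> config \<Rightarrow> bool" where
  "hashed f j a c \<longleftrightarrow> mem c (addr f j) = F a \<and> mem c (addr (f + 1) j) = R a \<and> mem c (addr (f + 2) j) = P a"

lemma less_M: "F i < M" "R i < M" "P i < M" "x mod md < M"
  using md by (auto intro: less_trans[OF mod_less_divisor])

lemma env_den: "{0, 1, 2, 4, 5} \<inter> assigned p = {} \<Longrightarrow> env (den p c) = env c"
  by (simp add: env_def den_unassigned)

lemma cursor_den: "{6, 7, 8, 9} \<inter> assigned p = {} \<Longrightarrow> cursor i (den p c) = cursor i c"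
  by (simp add: cursor_def den_unassigned)

lemma hashed_den:
  assumes "wf_com p" "f < 14" "{f, f + 1, f + 2} \<inter> arrays p = {}"
  shows "hashed f j a (den p c) = hashed f j a c"
  using assms by (simp add: hashed_def mem_addr_den)

text \<open>Passing the test implies a palindrome because \<open>md\<close> is faithful; the
  converse is the exact hash identity reduced modulo \<open>md\<close>.\<close>

lemma eval_match:
  assumes c: "env c" "cursor i c" "hashed f (eval e (mem c)) a c" and i: "a + 2 * l = i" "i \<le> n"
  shows "eval (match f e) (mem c) \<noteq> 0 \<longleftrightarrow> centered sy (a + l) l"
proof -
  let ?x = "(F i * P a + R a) mod md" and ?y = "(R i + F a * P i) mod md"
  have x: "?x = (fwd_hash M sy i * M ^ a + bwd_hash M sy a) mod md"
    by (intro mod_add_cong mod_mult_cong) simp_all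
  have y: "?y = (bwd_hash M sy i + fwd_hash M sy a * M ^ i) mod md"
    by (intro mod_add_cong mod_mult_cong) simp_all
  have "eval (match f e) (mem c) = 1 - ((?x - ?y) + (?y - ?x))"
    unfolding match_def eval.simps arith.simps using c by (simp only: env_def cursor_def hashed_def)
  then have "eval (match f e) (mem c) \<noteq> 0 \<longleftrightarrow> ?x = ?y" by auto
  also have "\<dots> \<longleftrightarrow> centered sy (a + l) l"
  proof
    assume "?x = ?y"
    then show "centered sy (a + l) l"
      using faithful i unfolding faithful_def x y by blast
  next
    assume "centered sy (a + l) l"
    moreover have "0 < M" using M by simp
    ultimately have "fwd_hash M sy i * M ^ a + bwd_hash M sy a = bwd_hash M sy i + fwd_hash M sy a * M ^ i"
      using hash_eq_iff_centered[of a l sy M] symbols i by auto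
    then show "?x = ?y" unfolding x y by (rule arg_cong)
  qed
  finally show ?thesis .
qed

lemma read_symbol:
  assumes c: "env c" "cursor i c" "stream c = sy i # xs" and i: "i < n"
  shows "cursor (Suc i) (den read_symbol c)" "stream (den read_symbol c) = xs"
    "emitted (den read_symbol c) = emitted c"
proof -
  have 7: "(F i * M + sy i) mod md = F (Suc i)"
    unfolding fwd_hash.simps by (intro mod_add_cong mod_mult_cong) simp_all
  have 8: "(R i + sy i * P i) mod md = R (Suc i)"
    unfolding bwd_hash.simps by (intro mod_add_cong mod_mult_cong) simp_all
  have 9: "P i * M mod md = P (Suc i)"
    unfolding power_Suc2 by (intro mod_mult_cong) simp_all
  have regs: "mem c 2 = M" "mem c 5 = md" "mem c 6 = i" "mem c 7 = F i" "mem c 8 = R i" "mem c 9 = P i"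
    using c by (simp_all add: env_def cursor_def)
  have iM: "Suc i < M" using i M by simp
  have "den read_symbol c = c\<lparr>stream := xs, mem := (mem c)(15 := sy i, 7 := F (Suc i), 8 := R (Suc i),
      9 := P (Suc i), 6 := Suc i)\<rparr>"
    unfolding 7[symmetric] 8[symmetric] 9[symmetric]
    using c(3) iM regs less_M(4) by (simp add: read_symbol_def set_reg_def)
  then show "cursor (Suc i) (den read_symbol c)" "stream (den read_symbol c) = xs"
    "emitted (den read_symbol c) = emitted c"
    by (simp_all add: cursor_def del: fwd_hash.simps bwd_hash.simps power_Suc)
qed

text \<open>The index has to depend on variables only, for the later \<open>Put\<close> commands
  evaluate it again after array cells have changed.\<close>

lemma den_save:
  assumes c: "env c" "cursor i c" and e: "\<And>m. (\<And>v. v < 32 \<Longrightarrow> m v = mem c v) \<Longrightarrow> eval e m = j"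
    and j: "j < 64 * B" and f: "f < 14"
  shows "den (save f e) c = c\<lparr>mem := (mem c)(addr f j := F i, addr (f + 1) j := R i, addr (f + 2) j := P i)\<rparr>"
proof -
  have regs: "mem c 1 = 64 * B" "mem c 2 = M" "mem c 7 = F i" "mem c 8 = R i" "mem c 9 = P i"
    using c by (simp_all add: env_def cursor_def)
  have e1: "eval e (mem c) = j" by (rule e) simp
  have e2: "eval e ((mem c)(addr f j := x)) = j" for x by (rule e) (auto simp: addr_neq)
  have e3: "eval e ((mem c)(addr f j := x, addr (f + 1) j := y)) = j" for x y by (rule e) (auto simp: addr_neq)
  show ?thesis
    using e1 e2 e3 j regs less_M by (simp add: save_def addr_neq)
qed

lemma hashed_save:
  assumes c: "env c" "cursor i c" and e: "\<And>m. (\<And>v. v < 32 \<Longrightarrow> m v = mem c v) \<Longrightarrow> eval e m = j"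
    and j: "j < 64 * B" and f: "f < 14"
  shows "hashed f j i (den (save f e) c)"
    and "j' \<noteq> j \<Longrightarrow> hashed f j' a (den (save f e) c) = hashed f j' a c"
proof -
  show "hashed f j i (den (save f e) c)"
    using f by (simp add: den_save[OF assms] hashed_def addr_eq_iff)
  show "j' \<noteq> j \<Longrightarrow> hashed f j' a (den (save f e) c) = hashed f j' a c"
    using f by (simp add: den_save[OF assms] hashed_def addr_eq_iff)
qed

lemma checkpoint:
  assumes c: "env c" "cursor i c" "i \<le> n"
    and old: "\<And>k. k * B + B - 1 < i \<Longrightarrow> hashed 0 k (k * B + B - 1) c"
    and k: "k * B + B - 1 \<le> i"
  shows "hashed 0 k (k * B + B - 1) (den checkpoint c)"
proof -
  have regs: "mem c 4 = B" "mem c 6 = i" using c by (simp_all add: env_def cursor_def)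
  have small: "i div B < 64 * B"
  proof -
    have "i div B \<le> B * B div B" using c(3) B by (intro div_le_mono) simp
    then show ?thesis using B by simp
  qed
  show ?thesis
  proof (cases "(i + 1) mod B = 0")
    case False
    have "k * B + B - 1 \<noteq> i"
    proof
      assume "k * B + B - 1 = i"
      then have "i + 1 = (k + 1) * B" using B by simp
      then show False using False by simp
    qed
    then have "hashed 0 k (k * B + B - 1) c" using k by (intro old) simp
    then show ?thesis using False regs by (simp add: checkpoint_def)
  next
    case True
    then have eq: "den checkpoint c = den (save 0 (Var 6 [div] Var 4)) c" using regs by (simp add: checkpoint_def)
    have e: "eval (Var 6 [div] Var 4) m = i div B" if "\<And>v. v < 32 \<Longrightarrow> m v = mem c v" for m
      using regs that by simp
    show ?thesis
    proof (cases "k = i div B")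
      case True
      have "B dvd i + 1" using \<open>(i + 1) mod B = 0\<close> by (simp only: mod_eq_0_iff_dvd)
      then obtain q where q: "i + 1 = B * q" by (rule dvdE)
      then obtain q' where "q = Suc q'" by (cases q) auto
      with q have i: "i = q' * B + B - 1" by (simp add: algebra_simps)
      then have "k = q'" using True block_end_div[OF B(1)] by simp
      then have "k * B + B - 1 = i" using i by simp
      then show ?thesis unfolding eq using hashed_save(1)[OF c(1,2) e small] True by simp
    next
      case False
      have "k * B + B - 1 \<noteq> i"
      proof
        assume "k * B + B - 1 = i"
        then have "i div B = k" using block_end_div[OF B(1)] by metis
        then show False using False by simp
      qed
      then have "hashed 0 k (k * B + B - 1) c" using k by (intro old) simp
      then show ?thesis unfolding eq using hashed_save(2)[OF c(1,2) e small] False by simp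
    qed
  qed
qed

text \<open>The hashes of the positions in a flagged block are kept in slot \<open>nflags fl (Suc k) mod 32\<close>,
  where \<open>k\<close> is the number of the block, until 32 further blocks have been flagged.\<close>

definition slot_index :: "(nat \<Rightarrow> bool) \<Rightarrow> nat \<Rightarrow> nat" where
  "slot_index fl a = nflags fl (Suc (a div B)) mod 32 * B + a mod B"

text \<open>Here \<open>i\<close> is the number of positions stored, and
  \<open>(i + B - 1) div B\<close> that of the blocks begun.\<close>

definition ring :: "(nat \<Rightarrow> bool) \<Rightarrow> nat \<Rightarrow> config \<Rightarrow> bool" where
  "ring fl i c \<longleftrightarrow>
     mem c 14 = nflags fl ((i + B - 1) div B) \<and>
     (0 < i \<longrightarrow> mem c 16 = (if fl ((i - 1) div B) then 1 else 0)) \<and>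
     (\<forall>k < (i + B - 1) div B. mem c (addr 4 k) = (if fl k then nflags fl (Suc k) else 0)) \<and>
     (\<forall>a<i. fl (a div B) \<and> nflags fl ((i + B - 1) div B) < nflags fl (Suc (a div B)) + 32 \<longrightarrow>
        hashed 5 (slot_index fl a) a c)"

lemma ring_den:
  assumes "wf_com p" "{14, 16} \<inter> assigned p = {}" "{4, 5, 6, 7} \<inter> arrays p = {}"
  shows "ring fl i (den p c) = ring fl i c"
  using assms by (simp add: ring_def den_unassigned mem_addr_den hashed_den)

text \<open>Positions sharing a slot have the same offset and hence lie in different blocks. The
  flag counts of these agree modulo 32, so they differ by at least 32.\<close>

lemma slot_index_inj:
  assumes i: "a < i" and fl: "fl (i div B)" "fl (a div B)"
    and near: "nflags fl (Suc (i div B)) < nflags fl (Suc (a div B)) + 32"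
  shows "slot_index fl a \<noteq> slot_index fl i"
proof
  assume eq: "slot_index fl a = slot_index fl i"
  have "(x mod 32 * B + a mod B) mod B = a mod B" "(x mod 32 * B + a mod B) div B = x mod 32" for x a
    using B by simp_all
  then have mods: "a mod B = i mod B" "nflags fl (Suc (a div B)) mod 32 = nflags fl (Suc (i div B)) mod 32"
    using eq unfolding slot_index_def by metis+
  have "a div B \<noteq> i div B" using mods(1) i by (metis div_mult_mod_eq less_irrefl)
  moreover have "a div B \<le> i div B" using i by (simp add: div_le_mono)
  ultimately have "nflags fl (Suc (a div B)) \<le> nflags fl (i div B)" by (intro nflags_mono) simp
  then have "nflags fl (Suc (a div B)) < nflags fl (Suc (i div B))" using fl by (simp add: nflags_Suc)
  moreover have "32 dvd nflags fl (Suc (i div B)) - nflags fl (Suc (a div B))"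
    using mods(2) mod_eq_dvd_iff_nat[OF less_imp_le[OF calculation], of 32] by metis
  ultimately show False using near by (auto dest: dvd_imp_le)
qed

lemma store:
  assumes c: "env c" "cursor i c" "i \<le> n" and ring: "ring fl i c"
    and e: "i mod B = 0 \<Longrightarrow> eval e (mem c) = (if fl (i div B) then 1 else 0)"
  shows "ring fl (Suc i) (den (store e) c)"
proof -
  define k where "k = i div B"
  let ?new = "Assign 16 e ;; Assign 14 (Var 14 [+] Var 16) ;; Put 4 (Var 6 [div] Var 4) (Var 14 [*] Var 16)"
  let ?idx = "Var 14 [mod] Num 32 [*] Var 4 [+] Var 6 [mod] Var 4"
  define c1 where "c1 = den (Branch (Var 6 [mod] Var 4) Nop ?new) c"
  have regs: "mem c 1 = 64 * B" "mem c 2 = M" "mem c 4 = B" "mem c 6 = i" using c by (simp_all add: env_def cursor_def)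
  have kB: "k \<le> B"
  proof -
    have "i div B \<le> B * B div B" using c(3) B by (intro div_le_mono) simp
    then show ?thesis using B by (simp add: k_def)
  qed
  have env1: "env c1" "cursor i c1" unfolding c1_def
    by (subst env_den, simp, rule c) (subst cursor_den, simp, rule c)
  have sk: "(Suc i + B - 1) div B = Suc k" using B by (simp add: k_def)
  have c1: "mem c1 14 = nflags fl (Suc k) \<and> mem c1 16 = (if fl k then 1 else 0) \<and>
     (\<forall>k' < Suc k. mem c1 (addr 4 k') = (if fl k' then nflags fl (Suc k') else 0)) \<and>
     (\<forall>f j a. 5 \<le> f \<and> f < 14 \<longrightarrow> hashed f j a c1 = hashed f j a c)"
  proof (cases "i mod B = 0")
    case True
    then have "i = B * k" using mult_div_mod_eq[where a = i and b = B] by (simp add: k_def)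
    then have pk: "(i + B - 1) div B = k" using block_end_div[OF B(1), of k] by (simp add: mult.commute)
    have q: "mem c 14 = nflags fl k" using ring pk by (simp add: ring_def)
    have b: "nflags fl (Suc k) < M" "k < 64 * B"
      using nflags_le[of fl "Suc k"] kB B M by auto
    have e': "eval e (mem c) = (if fl k then 1 else 0)" using e True by (simp add: k_def)
    have "1 < M" using B M by simp
    have "c1 = den ?new c" using True regs by (simp add: c1_def)
    also have "\<dots> = c\<lparr>mem := (mem c)(16 := if fl k then 1 else 0, 14 := nflags fl (Suc k),
        addr 4 k := if fl k then nflags fl (Suc k) else 0)\<rparr>"
      using True regs q b e' \<open>1 < M\<close>
      by (cases "fl k") (simp_all add: nflags_Suc k_def[symmetric])
    finally show ?thesis using ring pk
      by (simp add: ring_def addr_neq addr_eq_iff hashed_def less_Suc_eq)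
  next
    case False
    then have "0 < i" by (cases i) auto
    have "i = B * k + i mod B" by (simp add: k_def)
    moreover have "i mod B < B" using B by simp
    moreover have "0 < i mod B" using False by simp
    ultimately obtain r where r: "i = B * k + Suc r" "Suc r < B" by (metis gr0_implies_Suc)
    have "i + B - 1 = r + B * Suc k" using r(1) by simp
    then have "(i + B - 1) div B = (r + B * Suc k) div B" by (rule arg_cong)
    also have "\<dots> = Suc k" using r(2) by (subst div_mult_self2) auto
    finally have pk: "(i + B - 1) div B = Suc k" .
    have "(i - 1) div B = (r + B * k) div B" by (simp add: r add.commute)
    also have "\<dots> = k" using r(2) by (subst div_mult_self2) auto
    finally have "(i - 1) div B = k" .
    moreover have "c1 = c" using False regs by (simp add: c1_def)
    ultimately show ?thesis using ring pk \<open>0 < i\<close> by (simp add: ring_def)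
  qed
  \<comment> \<open>Flag counts only grow, so whatever is recent after this step was recent before
    it.\<close>
  have old: "hashed 5 (slot_index fl a) a c"
    if "a < i" "fl (a div B)" "nflags fl (Suc k) < nflags fl (Suc (a div B)) + 32" for a
  proof -
    have "(i + B - 1) div B \<le> (Suc i + B - 1) div B" by (intro div_le_mono) simp
    then have "nflags fl ((i + B - 1) div B) \<le> nflags fl (Suc k)" unfolding sk by (rule nflags_mono)
    then show ?thesis using ring that by (simp add: ring_def)
  qed
  define c2 where "c2 = den (Branch (Var 16) (save 5 ?idx) Nop) c1"
  have c2: "den (store e) c = c2" by (simp add: store_def c2_def c1_def)
  have reg2: "mem c2 14 = mem c1 14" "mem c2 16 = mem c1 16"
    unfolding c2_def by (rule den_unassigned; simp add: save_def)+
  have slots2: "mem c2 (addr 4 j) = mem c1 (addr 4 j)" for j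
    unfolding c2_def by (rule mem_addr_den; simp add: save_def)
  have "hashed 5 (slot_index fl a) a c2"
    if a: "a < Suc i" "fl (a div B)" "nflags fl (Suc k) < nflags fl (Suc (a div B)) + 32" for a
  proof (cases "fl k")
    case False
    then have "a \<noteq> i" using a by (auto simp: k_def)
    then have "hashed 5 (slot_index fl a) a c" using a by (intro old) auto
    then show ?thesis using False c1 by (simp add: c2_def)
  next
    case True
    then have s: "c2 = den (save 5 ?idx) c1" using c1 by (simp add: c2_def)
    have regs1: "mem c1 4 = B" "mem c1 6 = i" using env1 by (simp_all add: env_def cursor_def)
    have idx: "eval ?idx m = slot_index fl i" if "\<And>v. v < 32 \<Longrightarrow> m v = mem c1 v" for m
      using that regs1 c1 by (simp add: slot_index_def k_def)
    have "nflags fl (Suc k) mod 32 * B \<le> 31 * B" by (intro mult_le_mono1) simp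
    moreover have "i mod B < B" using B by simp
    ultimately have small: "slot_index fl i < 64 * B"
      unfolding slot_index_def k_def[symmetric] by linarith
    show ?thesis
    proof (cases "a = i")
      case True
      then show ?thesis unfolding s using hashed_save(1)[OF env1 idx small] by simp
    next
      case False
      then have "slot_index fl a \<noteq> slot_index fl i"
        using a True by (intro slot_index_inj) (auto simp: k_def)
      moreover have "hashed 5 (slot_index fl a) a c1" using old[of a] a False c1 by simp
      ultimately show ?thesis unfolding s using hashed_save(2)[OF env1 idx small] by simp
    qed
  qed
  then show ?thesis
    unfolding c2 ring_def sk using reg2 slots2 c1 by (simp add: k_def)
qed

text \<open>A flagged block has a slot number of at least 1, so 0 in array 4 identifies an unflagged
  one. By \<open>near\<close> the hash at the left end has not been overwritten yet.\<close>

lemma test_at: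
  assumes c: "env c" "cursor i c" "ring fl (Suc i) c" and e: "eval e (mem c) = a"
    and a: "a + 2 * l = i" "i \<le> n"
    and near: "fl (a div B) \<Longrightarrow> nflags fl (Suc (i div B)) < nflags fl (Suc (a div B)) + 32"
  shows "den (test_at e p) c = (if fl (a div B) \<and> centered sy (a + l) l then den p c else c)"
proof -
  have sk: "(Suc i + B - 1) div B = Suc (i div B)" using B by simp
  have regs: "mem c 4 = B" using c by (simp add: env_def)
  have "a div B \<le> i div B" using a by (intro div_le_mono) simp
  then have slot: "mem c (addr 4 (a div B)) = (if fl (a div B) then nflags fl (Suc (a div B)) else 0)"
    using c(3) unfolding ring_def sk by (simp add: less_Suc_eq_le)
  show ?thesis
  proof (cases "fl (a div B)")
    case False
    then show ?thesis using slot regs e by (simp add: test_at_def)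
  next
    case True
    let ?idx = "Cell 4 (e [div] Var 4) [mod] Num 32 [*] Var 4 [+] e [mod] Var 4"
    have idx: "eval ?idx (mem c) = slot_index fl a"
      using slot True regs e by (simp add: slot_index_def)
    have "hashed 5 (slot_index fl a) a c"
      using c(3) near[OF True] True a unfolding ring_def sk by simp
    then have "hashed 5 (eval ?idx (mem c)) a c" by (simp only: idx)
    then have "eval (match 5 ?idx) (mem c) \<noteq> 0 \<longleftrightarrow> centered sy (a + l) l"
      using a by (rule eval_match[OF c(1,2)])
    moreover have "0 < nflags fl (Suc (a div B))" using True by (simp add: nflags_Suc)
    ultimately show ?thesis
      using True slot regs e unfolding test_at_def den.simps
      by (simp del: eval.simps(3) arith.simps) (simp add: slot)
  qed
qed

end

section \<open>First pass\<close>

context two_pass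
begin

abbreviation "edge k \<equiv> k * B + B - 1"

text \<open>\<open>L\<close> is the length of the longest palindrome found so far and \<open>best k\<close> that of the longest one
  found with left end \<open>edge k\<close>; \<open>K\<close> is the set of edges already tested against position \<open>i\<close>.\<close>

definition approx :: "nat \<Rightarrow> nat set \<Rightarrow> nat \<Rightarrow> (nat \<Rightarrow> nat) \<Rightarrow> bool" where
  "approx i K L best \<longleftrightarrow>
     (\<exists>m. centered sy m L \<and> m + L \<le> i) \<and>
     (\<forall>k e. centered sy (edge k + e) e \<and> (edge k + 2 * e < i \<or> edge k + 2 * e = i \<and> k \<in> K) \<longrightarrow>
        e \<le> L \<and> (L \<le> e + B \<longrightarrow> e \<le> best k)) \<and>
     (\<forall>k. best k \<noteq> 0 \<longrightarrow> centered sy (edge k + best k) (best k) \<and> edge k + 2 * best k \<le> i) \<and>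
     (L < 8 * B \<longrightarrow> (\<forall>m e. centered sy m e \<and> m + e \<le> i \<longrightarrow> e \<le> L))"

lemma approxD:
  assumes "approx i K L best"
  shows "\<exists>m. centered sy m L \<and> m + L \<le> i"
    and "\<And>k e. centered sy (edge k + e) e \<Longrightarrow> edge k + 2 * e < i \<or> edge k + 2 * e = i \<and> k \<in> K \<Longrightarrow>
        e \<le> L \<and> (L \<le> e + B \<longrightarrow> e \<le> best k)"
    and "\<And>k. best k \<noteq> 0 \<Longrightarrow> centered sy (edge k + best k) (best k) \<and> edge k + 2 * best k \<le> i"
    and "\<And>m e. L < 8 * B \<Longrightarrow> centered sy m e \<Longrightarrow> m + e \<le> i \<Longrightarrow> e \<le> L"
  using assms unfolding approx_def by blast+

lemma approx_edge:
  assumes "approx i UNIV L best" "centered sy (edge k + e) e" "edge k + 2 * e \<le> i"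
  shows "e \<le> L \<and> (L \<le> e + B \<longrightarrow> e \<le> best k)"
proof -
  have "edge k + 2 * e < i \<or> edge k + 2 * e = i \<and> k \<in> UNIV" using assms(3) by (simp add: le_less)
  then show ?thesis by (rule approxD(2)[OF assms(1,2)])
qed

text \<open>Trimming a palindrome of length at least \<open>B\<close> by less than \<open>B\<close>
  brings its left end to the last position of its block.\<close>

lemma edge_near:
  assumes "a + e = m" "B \<le> e"
  shows "edge (a div B) \<le> m" "a \<le> edge (a div B)" "m - edge (a div B) \<le> e" "e < m - edge (a div B) + B"
proof -
  have "a = a div B * B + a mod B" "a mod B < B" using B by simp_all
  then have "a \<le> edge (a div B)" "edge (a div B) < a + B" using B by linarith+
  then show "edge (a div B) \<le> m" "a \<le> edge (a div B)" "m - edge (a div B) \<le> e" "e < m - edge (a div B) + B"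
    using assms by linarith+
qed

text \<open>Trimmed to an edge, the palindrome has been tested and hence is at most \<open>L\<close>
  long; trimming costs less than \<open>B\<close>.\<close>

lemma approx_bound:
  assumes a: "approx i UNIV L best" and m: "centered sy m e" "m + e \<le> i"
  shows "e < L + B"
proof (cases "B \<le> e")
  case False
  then show ?thesis by simp
next
  case True
  have "e \<le> m" using m by (simp add: centered_def)
  then obtain x where x: "x + e = m" by (metis le_add_diff_inverse2)
  let ?e = "m - edge (x div B)"
  note near = edge_near[OF x True]
  have "centered sy (edge (x div B) + ?e) ?e" using near m by (auto intro: centered_mono)
  moreover have "edge (x div B) + 2 * ?e \<le> i" using near m by linarith
  ultimately have "?e \<le> L" using approx_edge[OF a] by blast
  then show ?thesis using near by linarith
qed

lemma approx_extend:
  assumes a: "approx i UNIV L best"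
    and L': "L' = (if L < 8 * B \<and> 2 * L + 2 \<le> Suc i \<and> centered sy (Suc i - Suc L) (Suc L) then Suc L else L)"
  shows "approx (Suc i) {} L' best"
proof -
  have LL: "L \<le> L'" "L' \<le> Suc L" by (auto simp: L')
  have 1: "\<exists>m. centered sy m L' \<and> m + L' \<le> Suc i"
  proof (cases "L' = L")
    case True
    obtain m where "centered sy m L" "m + L \<le> i" using approxD(1)[OF a] by blast
    then show ?thesis unfolding True by (intro exI[of _ m]) simp
  next
    case False
    then have *: "L' = Suc L" "2 * L + 2 \<le> Suc i" "centered sy (Suc i - Suc L) (Suc L)" unfolding L' by (simp_all split: if_splits)
    then show ?thesis by (intro exI[of _ "Suc i - Suc L"]) simp
  qed
  have 2: "e \<le> L' \<and> (L' \<le> e + B \<longrightarrow> e \<le> best k)"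
    if "centered sy (edge k + e) e" "edge k + 2 * e < Suc i" for k e
  proof -
    have "edge k + 2 * e \<le> i" using that(2) by (rule less_Suc_eq_le[THEN iffD1])
    then show ?thesis using approx_edge[OF a that(1)] LL by linarith
  qed
  \<comment> \<open>A longer palindrome must end exactly at \<open>Suc i\<close>. Trimmed by one on
    both sides it ended earlier, so its length is \<open>Suc L\<close>, which is the length that was
    tested.\<close>
  have 4: "e \<le> L'" if small: "L' < 8 * B" and e: "centered sy m e" "m + e \<le> Suc i" for m e
  proof (rule ccontr)
    assume "\<not> e \<le> L'"
    moreover have L8: "L < 8 * B" using small LL by simp
    ultimately have "m + e = Suc i" using approxD(4)[OF a L8 e(1)] e LL by linarith
    have "centered sy m (e - 1)" using e by (auto intro: centered_mono)
    then have "e - 1 \<le> L" using \<open>m + e = Suc i\<close> \<open>\<not> e \<le> L'\<close> by (intro approxD(4)[OF a L8]) auto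
    then have "e = Suc L" using \<open>\<not> e \<le> L'\<close> LL by simp
    moreover have "e \<le> m" using e by (simp add: centered_def)
    ultimately have "L' = Suc L" using L8 e(1) \<open>m + e = Suc i\<close> by (auto simp: L')
    then show False using \<open>\<not> e \<le> L'\<close> \<open>e = Suc L\<close> by simp
  qed
  show ?thesis unfolding approx_def using 1 2 4 approxD(3)[OF a] le_SucI by blast
qed

definition reaches :: "nat \<Rightarrow> nat \<Rightarrow> nat \<Rightarrow> bool" where
  "reaches i k e \<longleftrightarrow> edge k + 2 * e = i \<and> centered sy (edge k + e) e"

lemma approx_aligned:
  assumes a: "approx i K L best" and t: "t \<longleftrightarrow> reaches i k e"
    and e: "\<And>e'. edge k + 2 * e' = i \<Longrightarrow> e' = e"
  shows "approx i (insert k K) (if t \<and> L < e then e else L) (\<lambda>j. if t \<and> j = k then e else best j)"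
    (is "approx i ?K ?L ?best")
proof -
  have LL: "L \<le> ?L" by simp
  have 1: "\<exists>m. centered sy m ?L \<and> m + ?L \<le> i"
  proof (cases "t \<and> L < e")
    case True
    then have "centered sy (edge k + e) e" "edge k + e + e \<le> i" using t by (auto simp: reaches_def)
    then show ?thesis using True by auto
  next
    case False
    then show ?thesis using approxD(1)[OF a] by auto
  qed
  have 2: "e' \<le> ?L \<and> (?L \<le> e' + B \<longrightarrow> e' \<le> ?best k')"
    if c: "centered sy (edge k' + e') e'" "edge k' + 2 * e' < i \<or> edge k' + 2 * e' = i \<and> k' \<in> ?K" for k' e'
  proof (cases "k' = k \<and> edge k' + 2 * e' = i")
    case True
    then have k: "k' = k" and ei: "edge k' + 2 * e' = i" by blast+
    have "e' = e" by (rule e) (rule ei[unfolded k])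
    have tt: t using ei c(1) unfolding t reaches_def k \<open>e' = e\<close> by blast
    show ?thesis using tt by (simp add: k \<open>e' = e\<close>)
  next
    case False
    then have "e' \<le> L \<and> (L \<le> e' + B \<longrightarrow> e' \<le> best k')" using approxD(2)[OF a c(1)] c(2) by blast
    \<comment> \<open>Overwriting \<open>best k\<close> loses nothing: other palindromes from the
      same edge ended earlier and so are shorter.\<close>
    moreover have "e' \<le> e" if "t" and k: "k' = k"
    proof -
      have "edge k + 2 * e = i" using \<open>t\<close> t by (simp add: reaches_def)
      then show ?thesis using c(2) unfolding k by linarith
    qed
    ultimately show ?thesis using LL by auto
  qed
  have 3: "centered sy (edge k' + ?best k') (?best k') \<and> edge k' + 2 * ?best k' \<le> i" if "?best k' \<noteq> 0" for k'
    using that t approxD(3)[OF a, of k'] by (auto simp: reaches_def split: if_splits)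
  have 4: "e' \<le> ?L" if "?L < 8 * B" "centered sy m e'" "m + e' \<le> i" for m e'
    using approxD(4)[OF a _ that(2,3)] that(1) LL by linarith
  show ?thesis unfolding approx_def using 1 2 3 4 by blast
qed

text \<open>Only lengths from \<open>L - B\<close> on have to be recorded, and none exceeds
  \<open>L0 + B\<close>. The relevant left ends \<open>i - 2 * e\<close> lie within about
  \<open>4 * B\<close> positions, which contain at most five edges, those from index
  \<open>(i + 2 * B - 2 * L0) div B\<close> downwards.\<close>

lemma approx_complete:
  assumes a: "approx i K L best" and L: "L0 \<le> L" "2 * L0 \<le> i"
    and bound: "\<And>m e. centered sy m e \<Longrightarrow> m + e \<le> i \<Longrightarrow> e \<le> L0 + B"
    and K: "\<And>j. j < 5 \<Longrightarrow> (i + 2 * B - 2 * L0) div B - j \<in> K"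
  shows "approx i UNIV L best"
proof -
  let ?k0 = "(i + 2 * B - 2 * L0) div B"
  have 2: "e \<le> L \<and> (L \<le> e + B \<longrightarrow> e \<le> best k)"
    if c: "centered sy (edge k + e) e" "edge k + 2 * e = i" for k e
  proof (cases "L \<le> e + B")
    case False
    then show ?thesis by simp
  next
    case True
    have e: "e \<le> L0 + B" using c by (intro bound[of "edge k + e"]) auto
    have "k * B \<le> i + 2 * B - 2 * L0" using c(2) True L B by linarith
    then have k0: "k \<le> ?k0" using B by (simp add: less_eq_div_iff_mult_less_eq)
    have "i + 2 * B - 2 * L0 < k * B + 5 * B" using c(2) e B L by linarith
    also have "\<dots> = (k + 5) * B" by (simp add: algebra_simps)
    finally have "?k0 < k + 5" using B by (simp add: div_less_iff_less_mult)
    then have "k = ?k0 - (?k0 - k)" "?k0 - k < 5" using k0 by auto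
    then have "k \<in> K" using K[of "?k0 - k"] by simp
    then show ?thesis using approxD(2)[OF a c(1)] c(2) by blast
  qed
  have "e \<le> L \<and> (L \<le> e + B \<longrightarrow> e \<le> best k)"
    if "centered sy (edge k + e) e" "edge k + 2 * e < i \<or> edge k + 2 * e = i \<and> k \<in> UNIV" for k e
    using 2[OF that(1)] approxD(2)[OF a that(1)] that(2) by blast
  then show ?thesis
    unfolding approx_def using approxD(1,3,4)[OF a] by blast
qed

lemma den_record:
  assumes X: "\<And>m. (\<And>v. v < 32 \<Longrightarrow> m v = mem c v) \<Longrightarrow> eval X m = e"
    and "mem c 18 = k" "k < mem c 1" "e < mem c 2"
  shows "den (Put 3 (Var 18) X ;; Branch (Var 10 [<] X) (Assign 10 X) Nop) c =
    c\<lparr>mem := (mem c)(addr 3 k := e, 10 := if mem c 10 < e then e else mem c 10)\<rparr>"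
proof -
  have e1: "eval X (mem c) = e" by (rule X) simp
  have e2: "eval X ((mem c)(addr 3 k := x)) = e" for x by (rule X) (auto simp: addr_neq)
  show ?thesis
  proof (cases "mem c 10 < e")
    case True
    then show ?thesis using assms(2-4) by (simp add: e1 e2 addr_neq)
  next
    case False
    then have "den (Put 3 (Var 18) X ;; Branch (Var 10 [<] X) (Assign 10 X) Nop) c = c\<lparr>mem := (mem c)(addr 3 k := e)\<rparr>"
      using assms(2-4) by (simp add: e1 e2 addr_neq)
    also have "\<dots> = c\<lparr>mem := (mem c)(addr 3 k := e, 10 := if mem c 10 < e then e else mem c 10)\<rparr>"
      using False by (intro mem_update_eqI) (auto simp: addr_neq)
    finally show ?thesis .
  qed
qed

lemma aligned:
  assumes c: "env c" "cursor i c" "i \<le> n" and k: "mem c 18 = k" "k < M"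
    and h: "edge k \<le> i \<Longrightarrow> hashed 0 k (edge k) c"
  defines "e \<equiv> (i + 1 - (k * B + B)) div 2"
  defines "t \<equiv> reaches i k e"
  shows "mem (den aligned c) 18 = k - 1"
    and "mem (den aligned c) 10 = (if t \<and> mem c 10 < e then e else mem c 10)"
    and "mem (den aligned c) (addr 3 j) = (if t \<and> j = k then e else mem c (addr 3 j))"
proof -
  let ?e = "Var 6 [+] Num 1 [-] (Var 18 [*] Var 4 [+] Var 4)"
  let ?upd = "Put 3 (Var 18) (?e [div] Num 2) ;; Branch (Var 10 [<] ?e [div] Num 2) (Assign 10 (?e [div] Num 2)) Nop"
  let ?p = "Branch (Var 18 [*] Var 4 [+] Var 4 [<=] Var 6 [+] Num 1)
      (Branch (?e [mod] Num 2) Nop (Branch (match 0 (Var 18)) ?upd Nop)) Nop"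
  have regs: "mem c 1 = 64 * B" "mem c 2 = M" "mem c 4 = B" "mem c 6 = i" using c by (simp_all add: env_def cursor_def)
  have al: "den aligned c = den (Assign 18 (Var 18 [-] Num 1)) (den ?p c)" by (simp only: aligned_def den.simps(6))
  have eM: "e < M" using c(3) M by (simp add: e_def)
  have p: "den ?p c = (if t then den ?upd c else c)"
  proof (cases "k * B + B \<le> i + 1")
    case False
    then have "\<not> t" using B by (auto simp: t_def reaches_def)
    then show ?thesis using False regs k by simp
  next
    case le: True
    then have ki: "edge k \<le> i" using B by simp
    show ?thesis
    proof (cases "even (i + 1 - (k * B + B))")
      case False
      have "edge k + 2 * e \<noteq> i"
      proof
        assume "edge k + 2 * e = i"
        then have "i + 1 - (k * B + B) = 2 * e" using B by linarith
        then show False using False by simp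
      qed
      then have "\<not> t" by (simp add: t_def reaches_def)
      moreover have "(i + 1 - (k * B + B)) mod 2 = 1" using False by (simp only: odd_iff_mod_2_eq_one)
      ultimately show ?thesis using le regs k by simp
    next
      case True
      then have "2 * e = i + 1 - (k * B + B)" by (simp add: e_def)
      then have ie: "edge k + 2 * e = i" using le B by linarith
      have hk: "hashed 0 (eval (Var 18) (mem c)) (edge k) c" using h[OF ki] k by simp
      have m: "eval (match 0 (Var 18)) (mem c) \<noteq> 0 \<longleftrightarrow> t"
        using eval_match[OF c(1,2) hk ie c(3)] ie by (simp add: t_def reaches_def)
      have "(i + 1 - (k * B + B)) mod 2 = 0" using True by (simp only: even_iff_mod_2_eq_zero)
      then have "den ?p c = den (Branch (match 0 (Var 18)) ?upd Nop) c" using le regs k by simp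
      also have "\<dots> = (if t then den ?upd c else c)" unfolding den.simps using m by simp
      finally show ?thesis .
    qed
  qed
  have u: "den ?upd c = c\<lparr>mem := (mem c)(addr 3 k := e, 10 := if mem c 10 < e then e else mem c 10)\<rparr>" if t
  proof -
    have "edge k \<le> i" using that by (simp add: t_def reaches_def)
    then have "k * B \<le> B * B" using c(3) B by linarith
    then have "k < 64 * B" using B by simp
    then show ?thesis using regs k eM by (intro den_record) (auto simp: e_def)
  qed
  show "mem (den aligned c) 18 = k - 1"
    using u p k regs unfolding al by (cases t) (simp_all add: addr_neq del: den.simps(6,7))
  show "mem (den aligned c) 10 = (if t \<and> mem c 10 < e then e else mem c 10)"
    using u p k regs unfolding al by (cases t) (simp_all add: addr_neq del: den.simps(6,7))
  show "mem (den aligned c) (addr 3 j) = (if t \<and> j = k then e else mem c (addr 3 j))"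
    using u p k regs unfolding al by (cases t) (simp_all add: addr_neq addr_eq_iff del: den.simps(6,7))
qed

end

section \<open>Effect of the commands and invariant of the first pass\<close>

context two_pass
begin

definition core :: "(nat \<Rightarrow> bool) \<Rightarrow> nat \<Rightarrow> config \<Rightarrow> bool" where
  "core fl i c \<longleftrightarrow> env c \<and> cursor i c \<and> ring fl (Suc i) c"

lemma coreD: "core fl i c \<Longrightarrow> env c" "core fl i c \<Longrightarrow> cursor i c" "core fl i c \<Longrightarrow> ring fl (Suc i) c"
  "core fl i c \<Longrightarrow> mem c 6 = i \<and> mem c 4 = B \<and> mem c 2 = M \<and> mem c 1 = 64 * B \<and> mem c 0 = n"
  by (simp_all add: core_def env_def cursor_def)

lemma core_den:
  assumes "wf_com p" "{0, 1, 2, 4, 5, 6, 7, 8, 9, 14, 16} \<inter> assigned p = {}" "{4, 5, 6, 7} \<inter> arrays p = {}"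
  shows "core fl i (den p c) = core fl i c"
proof -
  have "env (den p c) = env c" by (rule env_den) (use assms(2) in auto)
  moreover have "cursor i (den p c) = cursor i c" by (rule cursor_den) (use assms(2) in auto)
  moreover have "ring fl (Suc i) (den p c) = ring fl (Suc i) c" by (rule ring_den) (use assms in auto)
  ultimately show ?thesis by (simp only: core_def)
qed

definition checkpoints :: "nat \<Rightarrow> config \<Rightarrow> bool" where
  "checkpoints i c \<longleftrightarrow> (\<forall>k. edge k \<le> i \<longrightarrow> hashed 0 k (edge k) c)"

lemma checkpoints_den:
  assumes "wf_com p" "{0, 1, 2} \<inter> arrays p = {}"
  shows "checkpoints i (den p c) = checkpoints i c"
  unfolding checkpoints_def using assms by (subst hashed_den) (auto simp: numeral_2_eq_2)

lemma advance:
  assumes c: "core fl i c" "stream c = sy i # xs" "i < n"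
    and e: "Suc i mod B = 0 \<Longrightarrow> eval e (mem (den read_symbol c)) = (if fl (Suc i div B) then 1 else 0)"
  shows "core fl (Suc i) (den (store e) (den read_symbol c))"
proof -
  let ?c = "den read_symbol c"
  have env: "env ?c" using coreD(1)[OF c(1)] by (subst env_den) (simp_all add: read_symbol_def)
  have cur: "cursor (Suc i) ?c" using c by (intro read_symbol(1)) (auto dest: coreD)
  have rng: "ring fl (Suc i) ?c"
    using coreD(3)[OF c(1)] by (subst ring_den) (simp_all add: read_symbol_def variable_def)
  have "ring fl (Suc (Suc i)) (den (store e) ?c)"
    using c(3) e by (intro store env cur rng) auto
  moreover have "env (den (store e) ?c)" using env by (subst env_den) (simp_all add: store_def save_def)
  moreover have "cursor (Suc i) (den (store e) ?c)" using cur by (subst cursor_den) (simp_all add: store_def save_def)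
  ultimately show ?thesis by (simp add: core_def)
qed

lemma extend:
  assumes c: "core fl i c" "i \<le> n" and L: "mem c 10 = L" "Suc L < M"
    and near: "2 * L + 2 \<le> i \<Longrightarrow> fl ((i - (2 * L + 2)) div B) \<Longrightarrow>
       nflags fl (Suc (i div B)) < nflags fl (Suc ((i - (2 * L + 2)) div B)) + 32"
  shows "den extend c = (if 2 * L + 2 \<le> i \<and> fl ((i - (2 * L + 2)) div B) \<and> centered sy (i - Suc L) (Suc L)
     then c\<lparr>mem := (mem c)(10 := Suc L, 13 := 0)\<rparr> else c)"
proof (cases "2 * L + 2 \<le> i")
  case False
  then show ?thesis using coreD(4)[OF c(1)] L by (simp add: extend_def)
next
  case True
  let ?p = "Assign 10 (Var 10 [+] Num 1) ;; Assign 13 (Num 0)"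
  let ?e = "Var 6 [-] (Num 2 [*] Var 10 [+] Num 2)"
  have "den extend c = den (test_at ?e ?p) c"
    using True coreD(4)[OF c(1)] L by (simp add: extend_def)
  also have "\<dots> = (if fl ((i - (2 * L + 2)) div B) \<and> centered sy (i - (2 * L + 2) + Suc L) (Suc L) then den ?p c else c)"
  proof (rule test_at[OF coreD(1)[OF c(1)] coreD(2)[OF c(1)] coreD(3)[OF c(1)] _ _ c(2) near[OF True]])
    show "eval ?e (mem c) = i - (2 * L + 2)" using coreD(4)[OF c(1)] L by simp
    show "i - (2 * L + 2) + 2 * Suc L = i" using True by simp
  qed
  also have "den ?p c = c\<lparr>mem := (mem c)(10 := Suc L, 13 := 0)\<rparr>"
    using coreD(4)[OF c(1)] L by simp
  also have "i - (2 * L + 2) + Suc L = i - Suc L" using True by simp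
  finally show ?thesis using True by simp
qed

lemma hit:
  assumes c: "core fl i c" "i \<le> n" and L: "mem c 10 = L"
    and near: "2 * L \<le> i \<Longrightarrow> fl ((i - 2 * L) div B) \<Longrightarrow>
       nflags fl (Suc (i div B)) < nflags fl (Suc ((i - 2 * L) div B)) + 32"
  shows "den hit c = (if 2 * L \<le> i \<and> fl ((i - 2 * L) div B) \<and> centered sy (i - L) L
     then den (Branch (Var 12) (Output (Var 6 [-] Var 10))
           (Put 8 (Var 13) (Var 6 [-] Var 10) ;; Assign 13 (Var 13 [+] Num 1))) c else c)"
proof (cases "2 * L \<le> i")
  case False
  then show ?thesis using coreD(4)[OF c(1)] L by (simp add: hit_def)
next
  case True
  let ?p = "Branch (Var 12) (Output (Var 6 [-] Var 10))
           (Put 8 (Var 13) (Var 6 [-] Var 10) ;; Assign 13 (Var 13 [+] Num 1))"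
  have "i + 1 - 2 * L \<noteq> 0" using True by simp
  then have "den hit c = den (test_at (Var 6 [-] Num 2 [*] Var 10) ?p) c"
    using coreD(4)[OF c(1)] L unfolding hit_def den.simps(7) eval.simps arith.simps by simp
  also have "\<dots> = (if fl ((i - 2 * L) div B) \<and> centered sy (i - 2 * L + L) L then den ?p c else c)"
  proof (rule test_at[OF coreD(1)[OF c(1)] coreD(2)[OF c(1)] coreD(3)[OF c(1)] _ _ c(2) near[OF True]])
    show "eval (Var 6 [-] Num 2 [*] Var 10) (mem c) = i - 2 * L" using coreD(4)[OF c(1)] L by simp
    show "i - 2 * L + 2 * L = i" using True by simp
  qed
  also have "i - 2 * L + L = i - L" using True by simp
  finally show ?thesis using True by simp
qed

lemma init_pass:
  assumes c: "env c"
  shows "env (den init_pass c)" "cursor 0 (den init_pass c)" "ring fl 0 (den init_pass c)"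
proof -
  have M1: "1 < M" using M B by simp
  have m1: "1 mod md < M" using less_M(4) .
  have eq: "den init_pass c = c\<lparr>mem := (mem c)(6 := 0, 7 := 0, 8 := 0, 9 := 1 mod md, 14 := 0, 16 := 0, 17 := n)\<rparr>"
    using c M M1 m1 by (simp add: init_pass_def env_def)
  show "env (den init_pass c)" using c unfolding eq by (simp add: env_def)
  show "cursor 0 (den init_pass c)" unfolding eq by (simp add: cursor_def)
  show "ring fl 0 (den init_pass c)" unfolding eq ring_def using B by (simp add: div_less)
qed

lemma start_core:
  assumes c: "env c" "cursor 0 c" "ring fl 0 c" and e: "eval e (mem c) = (if fl 0 then 1 else 0)"
  shows "core fl 0 (den (store e) c)"
proof -
  have "ring fl (Suc 0) (den (store e) c)"
    using e by (intro store c) auto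
  moreover have "env (den (store e) c)" using c(1) by (subst env_den) (simp_all add: store_def save_def)
  moreover have "cursor 0 (den (store e) c)" using c(2) by (subst cursor_den) (simp_all add: store_def save_def)
  ultimately show ?thesis by (simp add: core_def)
qed

lemma checkpoint_step:
  assumes c: "core fl i c" "i \<le> n" and old: "\<And>k. edge k < i \<Longrightarrow> hashed 0 k (edge k) c"
  shows "checkpoints i (den checkpoint c)"
  unfolding checkpoints_def using checkpoint[OF coreD(1,2)[OF c(1)] c(2) old] by blast

text \<open>In the first pass every block is flagged, so the ring is a window of the last 32
  blocks.\<close>

lemma nflags_all: "nflags (\<lambda>_. True) k = k"
  by (simp add: nflags_def)

definition best_of :: "config \<Rightarrow> nat \<Rightarrow> nat" where
  "best_of c = (\<lambda>k. mem c (addr 3 k))"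

lemma aligned_step:
  assumes c: "core fl i c" "checkpoints i c" "i \<le> n" "mem c 18 = k" "k < M"
    and a: "approx i K (mem c 10) (best_of c)"
  defines "c' \<equiv> den aligned c"
  shows "core fl i c'" "checkpoints i c'" "mem c' 18 = k - 1" "mem c 10 \<le> mem c' 10"
    "approx i (insert k K) (mem c' 10) (best_of c')"
proof -
  show "core fl i c'"
    unfolding c'_def using c(1)
    by (subst core_den) (simp_all add: aligned_def variable_def match_def)
  show "checkpoints i c'"
    unfolding c'_def using c(2)
    by (subst checkpoints_den) (simp_all add: aligned_def variable_def match_def)
  define e where "e = (i + 1 - (k * B + B)) div 2"
  have h: "edge k \<le> i \<Longrightarrow> hashed 0 k (edge k) c" using c(2) by (simp add: checkpoints_def)
  note al = aligned[OF coreD(1)[OF c(1)] coreD(2)[OF c(1)] c(3,4,5) h]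
  show "mem c' 18 = k - 1" unfolding c'_def by (rule al(1))
  have al2: "mem c' 10 = (if reaches i k e \<and> mem c 10 < e then e else mem c 10)"
    unfolding c'_def e_def by (rule al(2))
  show "mem c 10 \<le> mem c' 10" unfolding al2 by simp
  have best: "best_of c' = (\<lambda>j. if reaches i k e \<and> j = k then e else best_of c j)"
    unfolding best_of_def c'_def e_def by (rule ext) (rule al(3))
  have e': "e' = e" if "edge k + 2 * e' = i" for e'
  proof -
    have "i + 1 - (k * B + B) = 2 * e'" using that B by linarith
    then show ?thesis by (simp add: e_def)
  qed
  show "approx i (insert k K) (mem c' 10) (best_of c')"
    unfolding al2 best by (rule approx_aligned[OF a refl e'])
qed

definition inv1 :: "nat \<Rightarrow> config \<Rightarrow> bool" where
  "inv1 i c \<longleftrightarrow> core (\<lambda>_. True) i c \<and> checkpoints i c \<and> stream c = drop i S @ S \<and> emitted c = [] \<and>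
     approx i UNIV (mem c 10) (best_of c)"

lemma approx_length:
  assumes "approx i K L best"
  shows "2 * L \<le> i"
proof -
  obtain m where "centered sy m L" "m + L \<le> i" using approxD(1)[OF assms] by blast
  then show ?thesis by (simp add: centered_def)
qed

lemma inv1_step:
  assumes inv: "inv1 i c" and i: "i < n"
  shows "inv1 (Suc i) (den (countdown 17 pass1) c)"
proof -
  let ?fl = "\<lambda>_::nat. True"
  have c0: "core ?fl i c" "checkpoints i c" "stream c = drop i S @ S" "emitted c = []"
    and a0: "approx i UNIV (mem c 10) (best_of c)" using inv by (auto simp: inv1_def)
  have str: "stream c = sy i # (drop (Suc i) S @ S)"
    using i length_S c0(3) by (simp add: Cons_nth_drop_Suc[symmetric])
  define L where "L = mem c 10"
  define c1 where "c1 = den read_symbol c"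
  define c2 where "c2 = den (store (Num 1)) c1"
  define c3 where "c3 = den checkpoint c2"
  define c4 where "c4 = den (Branch (Var 10 [<] Num 8 [*] Var 4) extend Nop) c3"
  define c5 where "c5 = den (Assign 18 ((Var 6 [+] Num 2 [*] Var 4 [-] Num 2 [*] Var 10) [div] Var 4)) c4"
  define d where "d = (\<lambda>j. (den aligned ^^ j) c5)"
  have res: "den pass1 c = d 5"
  proof -
    have "d 5 = den aligned (den aligned (den aligned (den aligned (den aligned c5))))"
      by (simp add: d_def numeral_eq_Suc)
    then show ?thesis by (simp only: pass1_def den.simps(6) c5_def c4_def c3_def c2_def c1_def)
  qed
  have core2: "core ?fl (Suc i) c2"
    unfolding c2_def c1_def using c0(1) str i by (intro advance) auto
  have s1: "stream c1 = drop (Suc i) S @ S" "emitted c1 = []"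
    unfolding c1_def using read_symbol(2,3)[OF coreD(1,2)[OF c0(1)] str i] c0(4) by simp_all
  have s2: "stream c2 = stream c1 \<and> emitted c2 = emitted c1"
    unfolding c2_def by (rule silent_den) (simp add: store_def save_def)
  have s3: "stream c3 = stream c2 \<and> emitted c3 = emitted c2"
    unfolding c3_def by (rule silent_den) (simp add: checkpoint_def save_def)
  have core3: "core ?fl (Suc i) c3"
    unfolding c3_def using core2 by (subst core_den) (simp_all add: checkpoint_def save_def)
  have wf12: "wf_com read_symbol" "wf_com (store (Num 1))" "wf_com checkpoint"
    by (simp_all add: read_symbol_def store_def save_def variable_def checkpoint_def)
  have L3: "mem c3 10 = L"
    unfolding c3_def c2_def c1_def L_def
    by (simp add: den_unassigned read_symbol_def[THEN arg_cong[where f = assigned]]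
        store_def[THEN arg_cong[where f = assigned]] checkpoint_def[THEN arg_cong[where f = assigned]] save_def)
  have best3: "best_of c3 = best_of c"
    unfolding best_of_def c3_def c2_def c1_def using wf12
    by (simp add: mem_addr_den read_symbol_def[THEN arg_cong[where f = arrays]]
        store_def[THEN arg_cong[where f = arrays]] checkpoint_def[THEN arg_cong[where f = arrays]] save_def)
  have ck3: "checkpoints (Suc i) c3"
    unfolding c3_def
  proof (rule checkpoint_step[OF core2])
    fix k assume "edge k < Suc i"
    then have "hashed 0 k (edge k) c" using c0(2) unfolding checkpoints_def by (simp only: less_Suc_eq_le)
    then show "hashed 0 k (edge k) c2"
      unfolding c2_def c1_def using wf12
      by (simp add: hashed_den read_symbol_def[THEN arg_cong[where f = arrays]]
          store_def[THEN arg_cong[where f = arrays]] save_def)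
  qed (use i in simp)
  have L2: "2 * L \<le> i" using approx_length[OF a0] by (simp add: L_def)
  define L' where "L' = (if L < 8 * B \<and> 2 * L + 2 \<le> Suc i \<and> centered sy (Suc i - Suc L) (Suc L) then Suc L else L)"
  have c4: "core ?fl (Suc i) c4 \<and> checkpoints (Suc i) c4 \<and> mem c4 10 = L' \<and> best_of c4 = best_of c3 \<and>
     stream c4 = stream c3 \<and> emitted c4 = emitted c3"
  proof (cases "L < 8 * B")
    case False
    then have "c4 = c3" using L3 coreD(4)[OF core3] by (simp add: c4_def)
    then show ?thesis using False core3 ck3 L3 by (simp add: L'_def)
  next
    case True
    then have c4e: "c4 = den extend c3" using L3 coreD(4)[OF core3] by (simp add: c4_def)
    have "den extend c3 = (if 2 * L + 2 \<le> Suc i \<and> ?fl ((Suc i - (2 * L + 2)) div B) \<and>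
        centered sy (Suc i - Suc L) (Suc L) then c3\<lparr>mem := (mem c3)(10 := Suc L, 13 := 0)\<rparr> else c3)"
    proof (rule extend[OF core3 _ L3])
      show "Suc L < M" using L2 i M B by simp
      assume le: "2 * L + 2 \<le> Suc i"
      \<comment> \<open>\<open>L < 8 * B\<close> puts the left end at most 16 blocks back, inside
        the ring of 32.\<close>
      have "Suc i \<le> (Suc i - (2 * L + 2)) + 16 * B" using True le by simp
      then have "Suc i div B \<le> ((Suc i - (2 * L + 2)) + 16 * B) div B" by (rule div_le_mono)
      also have "\<dots> = (Suc i - (2 * L + 2)) div B + 16" using B by simp
      finally show "nflags ?fl (Suc (Suc i div B)) < nflags ?fl (Suc ((Suc i - (2 * L + 2)) div B)) + 32"
        unfolding nflags_all by simp
    qed (use i in simp)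
    then have eq: "c4 = (if L' = Suc L then c3\<lparr>mem := (mem c3)(10 := Suc L, 13 := 0)\<rparr> else c3)"
      unfolding c4e L'_def using True by simp
    have core4: "core ?fl (Suc i) c4"
      unfolding c4e using core3 by (subst core_den) (simp_all add: extend_def test_at_def match_def variable_def)
    moreover have "checkpoints (Suc i) c4"
      unfolding c4e using ck3 by (subst checkpoints_den) (simp_all add: extend_def test_at_def match_def variable_def)
    moreover have "mem c4 10 = L'" using L3 unfolding eq L'_def by simp
    moreover have "best_of c4 = best_of c3" unfolding eq best_of_def by (simp add: addr_neq)
    moreover have "stream c4 = stream c3 \<and> emitted c4 = emitted c3" unfolding eq by simp
    ultimately show ?thesis by blast
  qed
  have a4: "approx (Suc i) {} L' (best_of c)"
    using a0 unfolding L'_def L_def by (rule approx_extend) simp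
  have L'2: "2 * L' \<le> Suc i" using approx_length[OF a4] .
  define k0 where "k0 = (Suc i + 2 * B - 2 * L') div B"
  have "k0 \<le> Suc i + 2 * B - 2 * L'" unfolding k0_def by simp
  then have k0M: "k0 < M" using i M B by simp
  have c5: "c5 = c4\<lparr>mem := (mem c4)(18 := k0)\<rparr>"
    using c4 coreD(4) k0M by (auto simp: c5_def k0_def)
  \<comment> \<open>Truncated subtraction, in step with register 18: near the beginning of the
    stream edge 0 is tested several times.\<close>
  let ?K = "\<lambda>j. (\<lambda>x. k0 - x) ` {..<j}"
  have dj: "core ?fl (Suc i) (d j) \<and> checkpoints (Suc i) (d j) \<and> mem (d j) 18 = k0 - j \<and> L' \<le> mem (d j) 10 \<and>
      approx (Suc i) (?K j) (mem (d j) 10) (best_of (d j)) \<and> stream (d j) = stream c4 \<and> emitted (d j) = emitted c4" for j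
  proof (induction j)
    case 0
    have "core ?fl (Suc i) c5"
      unfolding c5_def using c4 by (subst core_den) (simp_all add: variable_def)
    moreover have "checkpoints (Suc i) c5"
      unfolding c5_def using c4 by (subst checkpoints_den) (simp_all add: variable_def)
    moreover have "best_of c5 = best_of c" using c4 best3 unfolding c5 best_of_def by (simp add: addr_neq)
    ultimately show ?case using c4 a4 by (simp add: d_def c5)
  next
    case (Suc j)
    have dS: "d (Suc j) = den aligned (d j)" by (simp add: d_def)
    have "insert (k0 - j) (?K j) = ?K (Suc j)" by (auto simp: lessThan_Suc)
    moreover have "k0 - j < M" using k0M by simp
    moreover have "stream (den aligned (d j)) = stream (d j) \<and> emitted (den aligned (d j)) = emitted (d j)"
      by (rule silent_den) (simp add: aligned_def)
    ultimately show ?case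
      using Suc.IH aligned_step[of ?fl "Suc i" "d j" "k0 - j" "?K j"] i unfolding dS by auto
  qed
  have a5: "approx (Suc i) UNIV (mem (d 5) 10) (best_of (d 5))"
  proof (rule approx_complete)
    show "approx (Suc i) (?K 5) (mem (d 5) 10) (best_of (d 5))" "L' \<le> mem (d 5) 10" using dj[of 5] by blast+
    show "2 * L' \<le> Suc i" by (rule L'2)
    \<comment> \<open>Trimmed by one on both sides the palindrome ended at or before
      \<open>i\<close>, where \<open>approx_bound\<close> applies.\<close>
    show "e \<le> L' + B" if e: "centered sy m e" "m + e \<le> Suc i" for m e
    proof -
      have "centered sy m (e - 1)" using e by (auto intro: centered_mono)
      moreover have "e - 1 < L + B \<or> e = 0"
        using approx_bound[OF a0 calculation] e by (cases e) (auto simp: L_def)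
      moreover have "L \<le> L'" by (simp add: L'_def)
      ultimately show ?thesis by linarith
    qed
    show "(Suc i + 2 * B - 2 * L') div B - j \<in> ?K 5" if "j < 5" for j
      using that by (simp add: k0_def)
  qed
  define c6 where "c6 = den (Assign 17 (Var 17 [-] Num 1)) (d 5)"
  have "den (countdown 17 pass1) c = c6" by (simp only: countdown_def den.simps(6) res c6_def)
  moreover have "core ?fl (Suc i) c6"
    unfolding c6_def using dj[of 5] by (subst core_den) (simp_all add: variable_def)
  moreover have "checkpoints (Suc i) c6"
    unfolding c6_def using dj[of 5] by (subst checkpoints_den) (simp_all add: variable_def)
  moreover have "best_of c6 = best_of (d 5)" "mem c6 10 = mem (d 5) 10" "stream c6 = stream (d 5)" "emitted c6 = emitted (d 5)"
    by (simp_all add: c6_def best_of_def addr_neq)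
  ultimately show ?thesis
    using a5 dj[of 5] c4 s1 s2 s3 by (simp add: inv1_def)
qed

lemma inv1_start:
  assumes c: "env c" "stream c = S @ S" "emitted c = []" "\<And>k. mem c (addr 3 k) = 0"
  shows "inv1 0 (den start1 c)"
proof -
  let ?fl = "\<lambda>_::nat. True"
  define c1 where "c1 = den (Assign 10 (Num 0)) c"
  define c2 where "c2 = den init_pass c1"
  define c3 where "c3 = den (store (Num 1)) c2"
  have eq: "den start1 c = den checkpoint c3" by (simp only: start1_def den.simps(6) c3_def c2_def c1_def)
  have "env c1" unfolding c1_def using c(1) by (subst env_den) simp_all
  note c2 = init_pass(1)[OF this, folded c2_def] init_pass(2)[OF this, folded c2_def]
    init_pass(3)[OF this, of ?fl, folded c2_def]
  have core3: "core ?fl 0 c3" unfolding c3_def by (intro start_core c2) simp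
  have core4: "core ?fl 0 (den checkpoint c3)"
    using core3 by (subst core_den) (simp_all add: checkpoint_def save_def)
  have ck: "checkpoints 0 (den checkpoint c3)" by (rule checkpoint_step[OF core3]) simp_all
  have wf: "wf_com init_pass" "wf_com (store (Num 1))" "wf_com checkpoint"
    by (simp_all add: init_pass_def store_def save_def variable_def checkpoint_def)
  have best: "best_of (den checkpoint c3) = (\<lambda>_. 0)"
    unfolding best_of_def c3_def c2_def using wf c(4)
    by (simp add: mem_addr_den init_pass_def[THEN arg_cong[where f = arrays]]
        store_def[THEN arg_cong[where f = arrays]] checkpoint_def[THEN arg_cong[where f = arrays]] save_def c1_def addr_neq)
  have L: "mem (den checkpoint c3) 10 = 0"
    unfolding c3_def c2_def
    by (simp add: den_unassigned init_pass_def[THEN arg_cong[where f = assigned]]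
        store_def[THEN arg_cong[where f = assigned]] checkpoint_def[THEN arg_cong[where f = assigned]] save_def c1_def)
  have "silent init_pass" "silent (store (Num 1))" "silent checkpoint"
    by (simp_all add: init_pass_def store_def save_def checkpoint_def)
  then have st: "stream (den checkpoint c3) = S @ S" "emitted (den checkpoint c3) = []"
    unfolding c3_def c2_def using c(2,3) by (simp_all add: silent_den c1_def)
  have "e = 0" if "m + e \<le> 0" for m e :: nat using that by simp
  then have "approx 0 UNIV 0 (\<lambda>_. 0)"
    unfolding approx_def by auto
  then show ?thesis unfolding inv1_def eq using core4 ck best L st by simp
qed

lemma after_pass1:
  assumes c: "env c" "stream c = S @ S" "emitted c = []" "\<And>k. mem c (addr 3 k) = 0"
  shows "inv1 n (after_pass1 n c)"
  unfolding after_pass1_def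
  by (rule funpow_invariant[where I = inv1]) (auto intro: inv1_start inv1_step c)

end

section \<open>Second pass\<close>

text \<open>Length 0 is separate because \<open>palindrome_at S m 0\<close> holds for every
  \<open>m\<close>, even beyond the end of the string.\<close>

lemma palindrome_at_iff:
  "palindrome_at S m l \<longleftrightarrow> l = 0 \<or> m + l \<le> length S \<and> centered (\<lambda>i. S ! i) m l"
proof (cases l)
  case 0
  then show ?thesis by (simp add: palindrome_at_0)
next
  case (Suc k)
  show ?thesis
  proof
    assume P: "palindrome_at S m l"
    have "l \<in> {1..l}" using Suc by simp
    then have at_l: "l \<le> m" "m + l \<le> length S" using P unfolding palindrome_at_def by blast+
    have "S ! (m - 1 - i) = S ! (m + i)" if "i < l" for i
    proof -
      have "Suc i \<in> {1..l}" using that by simp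
      then have "S ! (m - Suc i) = S ! (m + Suc i - 1)" using P unfolding palindrome_at_def by blast
      then show ?thesis by simp
    qed
    then show "l = 0 \<or> m + l \<le> length S \<and> centered (\<lambda>i. S ! i) m l" using at_l by (simp add: centered_def)
  next
    assume "l = 0 \<or> m + l \<le> length S \<and> centered (\<lambda>i. S ! i) m l"
    then have C: "m + l \<le> length S" "l \<le> m" "\<And>i. i < l \<Longrightarrow> S ! (m - 1 - i) = S ! (m + i)"
      using Suc by (auto simp: centered_def)
    show "palindrome_at S m l"
      unfolding palindrome_at_def
    proof
      fix i assume "i \<in> {1..l}"
      then obtain j where j: "i = Suc j" "j < l" by (cases i) auto
      then have "S ! (m - i) = S ! (m + i - 1)" using C(3)[OF j(2)] by simp
      then show "i \<le> m \<and> m + i \<le> length S \<and> S ! (m - i) = S ! (m + i - 1)" using j C by simp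
    qed
  qed
qed

text \<open>\<open>1 \<le> m\<close> excludes the gap before the first symbol; this matters for
  \<open>L = 0\<close>, when all midpoints from 1 on are reported.\<close>

lemma longest_palindromes:
  assumes m0: "centered (\<lambda>i. S ! i) m0 L" "m0 + L \<le> length S"
    and max: "\<And>m e. centered (\<lambda>i. S ! i) m e \<Longrightarrow> m + e \<le> length S \<Longrightarrow> e \<le> L"
    and S: "1 \<le> length S"
  shows "max_pal_length S = L"
    and "{m \<in> {1..length S}. pal_length S m = max_pal_length S} =
      {m. 1 \<le> m \<and> centered (\<lambda>i. S ! i) m L \<and> m + L \<le> length S}"
proof -
  have le: "pal_length S m \<le> L" for m
  proof -
    have "pal_length S m \<in> {l. palindrome_at S m l}"
      unfolding pal_length_def using palindrome_at_0 by (intro Max_in finite_palindromes_at) blast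
    then show ?thesis using max by (auto simp: palindrome_at_iff)
  qed
  have eq: "pal_length S m = L \<longleftrightarrow> palindrome_at S m L" for m
  proof
    assume "pal_length S m = L"
    moreover have "pal_length S m \<in> {l. palindrome_at S m l}"
      unfolding pal_length_def using palindrome_at_0 by (intro Max_in finite_palindromes_at) blast
    ultimately show "palindrome_at S m L" by simp
  next
    assume "palindrome_at S m L"
    then have "L \<le> pal_length S m" unfolding pal_length_def by (intro Max_ge finite_palindromes_at) simp
    then show "pal_length S m = L" using le[of m] by simp
  qed
  have "\<exists>m\<in>{1..length S}. pal_length S m = L"
  proof (cases "L = 0")
    case True
    then show ?thesis using le[of 1] S by (intro bexI[of _ 1]) auto
  next
    case False
    then have "m0 \<in> {1..length S}" using m0 by (auto simp: centered_def)
    then show ?thesis using m0 by (intro bexI[of _ m0]) (auto simp: eq palindrome_at_iff)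
  qed
  then show m: "max_pal_length S = L"
    unfolding max_pal_length_def using le by (intro Max_eqI) auto
  show "{m \<in> {1..length S}. pal_length S m = max_pal_length S} =
      {m. 1 \<le> m \<and> centered (\<lambda>i. S ! i) m L \<and> m + L \<le> length S}"
    unfolding m eq palindrome_at_iff by auto
qed

lemma nflags_diff:
  assumes "k \<le> k'"
  shows "nflags fl (Suc k') \<le> nflags fl (Suc k) + card ({j. fl j} \<inter> {k<..k'})"
proof -
  have "{j. j < Suc k' \<and> fl j} \<subseteq> {j. j < Suc k \<and> fl j} \<union> ({j. fl j} \<inter> {k<..k'})" by auto
  then have "nflags fl (Suc k') \<le> card ({j. j < Suc k \<and> fl j} \<union> ({j. fl j} \<inter> {k<..k'}))"
    unfolding nflags_def by (intro card_mono) auto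
  also have "\<dots> \<le> nflags fl (Suc k) + card ({j. fl j} \<inter> {k<..k'})"
    unfolding nflags_def by (rule card_Un_le)
  finally show ?thesis .
qed

locale second_pass = two_pass +
  fixes L1 :: nat and best :: "nat \<Rightarrow> nat"
  assumes approx: "approx n UNIV L1 best"
begin

definition small :: bool where
  "small \<longleftrightarrow> L1 < 8 * B"

text \<open>In the small case all blocks are flagged, and the ring is again a window of recent
  hashes. Otherwise the margin \<open>B\<close> accounts for trimming a longest palindrome to the
  edge of its block.\<close>

definition flagged :: "nat \<Rightarrow> bool" where
  "flagged k \<longleftrightarrow> small \<or> L1 < best k + B"

text \<open>A palindrome of length at least \<open>L1\<close>, trimmed to the edge of its block, is
  still longer than \<open>L1 - B\<close>, so the first pass has recorded it.\<close>

lemma flagged_if_centered: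
  assumes c: "centered sy (a + l) l" and l: "a + 2 * l \<le> n" "L1 \<le> l"
  shows "flagged (a div B)"
proof (cases small)
  case True
  then show ?thesis by (simp add: flagged_def)
next
  case False
  then have "B \<le> l" using l by (simp add: small_def)
  note near = edge_near[OF refl this, of a]
  let ?e = "a + l - edge (a div B)"
  have "centered sy (edge (a div B) + ?e) ?e" using near c by (auto intro: centered_mono)
  moreover have "edge (a div B) + 2 * ?e \<le> n" using near l by linarith
  ultimately have "?e \<le> L1 \<and> (L1 \<le> ?e + B \<longrightarrow> ?e \<le> best (a div B))" by (rule approx_edge[OF approx])
  then show ?thesis using near(4) l(2) unfolding flagged_def by linarith
qed

text \<open>The origin of the 32 slots. If \<open>L1 < 8 * B\<close>, the distance spans at most 18
  blocks. Otherwise it is covered by five windows of \<open>L1 div B - 2\<close> blocks, each with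
  at most 6 flagged ones by \<open>card_sparse_blocks\<close>, which makes 30.\<close>

lemma flagged_near:
  assumes a: "i \<le> a + 2 * L1 + 2 * B" "a \<le> i"
  shows "nflags flagged (Suc (i div B)) < nflags flagged (Suc (a div B)) + 32"
proof -
  have le: "a div B \<le> i div B" using a(2) by (rule div_le_mono)
  show ?thesis
  proof (cases small)
    case True
    have "{j. flagged j} \<inter> {a div B<..i div B} \<subseteq> {a div B<..i div B}" by blast
    then have "card ({j. flagged j} \<inter> {a div B<..i div B}) \<le> i div B - a div B"
      using card_mono[of "{a div B<..i div B}"] by fastforce
    moreover have "i div B \<le> (a + 18 * B) div B"
      using a True by (intro div_le_mono) (simp add: small_def)
    moreover have "(a + 18 * B) div B = a div B + 18" using B by simp
    ultimately show ?thesis using nflags_diff[OF le, of flagged] by linarith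
  next
    case False
    let ?q = "L1 div B"
    have q: "8 \<le> ?q" using False B by (simp add: small_def less_eq_div_iff_mult_less_eq)
    have "L1 = ?q * B + L1 mod B" "L1 mod B < B" using B by simp_all
    then have "i \<le> a + (2 * ?q + 4) * B" using a unfolding add_mult_distrib mult.assoc by linarith
    then have "i div B \<le> (a + (2 * ?q + 4) * B) div B" by (rule div_le_mono)
    also have "\<dots> = a div B + (2 * ?q + 4)" using B by simp
    also have "\<dots> \<le> a div B + 5 * (?q - 2)" using q by linarith
    finally have sub: "{a div B<..i div B} \<subseteq> {a div B<..a div B + 5 * (?q - 2)}" by auto
    have sparse: "card ({j. flagged j} \<inter> {x<..x + (?q - 2)}) \<le> 6" for x
    proof (rule card_sparse_blocks)
      show "8 * B \<le> L1" using False by (simp add: small_def)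
      show "e < L1 + B" if "centered sy m e" "m + e \<le> n" for m e using approx_bound[OF approx that] .
      fix k assume "k \<in> {j. flagged j}"
      then have k: "L1 < best k + B" using False by (simp add: flagged_def)
      then have "best k \<noteq> 0" using False B by (auto simp: small_def)
      from approxD(3)[OF approx this]
      have b: "centered sy (edge k + best k) (best k)" "edge k + 2 * best k \<le> n" by blast+
      then have "best k \<le> L1" using approx_edge[OF approx] by blast
      then show "\<exists>m e. centered sy m e \<and> m = k * B + B - 1 + e \<and> m + e \<le> n \<and> e \<le> L1 \<and> L1 < e + B"
        using k b by (intro exI[of _ "edge k + best k"] exI[of _ "best k"]) auto
    qed
    have "card ({j. flagged j} \<inter> {a div B<..i div B}) \<le> card ({j. flagged j} \<inter> {a div B<..a div B + 5 * (?q - 2)})"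
      using sub by (intro card_mono) auto
    also have "\<dots> \<le> 5 * 6" using sparse by (rule card_windows)
    finally show ?thesis using nflags_diff[OF le, of flagged] by linarith
  qed
qed

section \<open>Centres to be reported and invariant of the second pass\<close>

definition centers :: "nat \<Rightarrow> nat \<Rightarrow> nat set" where
  "centers L i = {m. 1 \<le> m \<and> centered sy m L \<and> m + L \<le> i}"

lemma finite_centers: "finite (centers L i)"
  by (rule finite_subset[of _ "{..i}"]) (auto simp: centers_def)

text \<open>\<open>B\<close> windows of size \<open>L\<close> cover the stream because
  \<open>n \<le> B * B \<le> B * L\<close>, and each contains at most two centres of longest
  palindromes.\<close>

lemma card_centers:
  assumes L: "8 * B \<le> L" and i: "i \<le> n" and max: "\<And>m e. centered sy m e \<Longrightarrow> m + e \<le> i \<Longrightarrow> e \<le> L"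
  shows "card (centers L i) \<le> 2 * B"
proof -
  have L0: "0 < L" using L B by simp
  have "B * B \<le> B * L" using L by (intro mult_le_mono2) simp
  then have "n \<le> B * L" using B(2) by (rule order_trans[rotated])
  then have "centers L i = {m. centered sy m L \<and> m + L \<le> i} \<inter> {0<..0 + B * L}"
    using i L0 by (auto simp: centers_def centered_def)
  also have "card \<dots> \<le> B * 2"
  proof (rule card_windows, rule card_longest_centers[OF L0])
    fix m assume "m + Suc L \<le> i"
    then show "\<not> centered sy m (Suc L)" using max[of m "Suc L"] by auto
  qed
  finally show ?thesis by simp
qed

definition report :: "nat \<Rightarrow> config \<Rightarrow> bool" where
  "report i c \<longleftrightarrow> (if small then (\<exists>ms. emitted c = L1 # ms \<and> set ms = centers L1 i)
     else emitted c = [] \<and> mem c 13 = card (centers (mem c 10) i) \<and>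
       (\<lambda>j. mem c (addr 8 j)) ` {..<mem c 13} = centers (mem c 10) i)"

definition known :: "config \<Rightarrow> bool" where
  "known c \<longleftrightarrow> mem c 11 = L1 \<and> mem c 12 = (if small then 1 else 0) \<and> best_of c = best"

text \<open>Register 10 starts from the length found by the first pass, which may be attained only
  after position \<open>i\<close>. Hence attainment refers to \<open>n\<close>, and maximality to
  \<open>i\<close>.\<close>

definition inv2 :: "nat \<Rightarrow> config \<Rightarrow> bool" where
  "inv2 i c \<longleftrightarrow> core flagged i c \<and> stream c = drop i S \<and> known c \<and> L1 \<le> mem c 10 \<and>
     (\<exists>m. centered sy m (mem c 10) \<and> m + mem c 10 \<le> n) \<and>
     (\<forall>m e. centered sy m e \<and> m + e \<le> i \<longrightarrow> e \<le> mem c 10) \<and> report i c"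

lemma known_den:
  assumes "wf_com p" "{11, 12} \<inter> assigned p = {}" "3 \<notin> arrays p"
  shows "known (den p c) = known c"
  using assms by (simp add: known_def best_of_def den_unassigned mem_addr_den)

lemma eval_flag_expr:
  assumes "known c" "mem c 6 = i" "mem c 4 = B"
  shows "eval flag_expr (mem c) = (if flagged (i div B) then 1 else 0)"
proof -
  have "mem c (addr 3 (i div B)) = best (i div B)" using assms(1) by (simp add: known_def best_of_def fun_eq_iff)
  then show ?thesis using assms by (auto simp: flag_expr_def flagged_def known_def)
qed

lemma silent_store: "silent (store e)" "silent extend"
  by (simp_all add: store_def save_def extend_def test_at_def)

lemma wf_pass2: "wf_com read_symbol" "wf_com (store flag_expr)" "wf_com extend" "wf_com hit"
  by (simp_all add: read_symbol_def store_def save_def extend_def hit_def test_at_def match_def flag_expr_def variable_def)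

lemma inv2_step:
  assumes inv: "inv2 i c" and i: "i < n"
  shows "inv2 (Suc i) (den (countdown 17 pass2) c)"
proof -
  have c0: "core flagged i c" "stream c = drop i S" "known c" "L1 \<le> mem c 10" "report i c"
    and att: "\<exists>m. centered sy m (mem c 10) \<and> m + mem c 10 \<le> n"
    and bd: "\<And>m e. centered sy m e \<Longrightarrow> m + e \<le> i \<Longrightarrow> e \<le> mem c 10"
    using inv unfolding inv2_def by blast+
  have str: "stream c = sy i # drop (Suc i) S"
    using i length_S c0(2) by (simp add: Cons_nth_drop_Suc)
  define L where "L = mem c 10"
  obtain mL where mL: "centered sy mL L" "mL + L \<le> n" using att unfolding L_def by blast
  have LB: "L < L1 + B" using approx_bound[OF approx mL] .
  have Lsmall: "L = L1" if small
    using approxD(4)[OF approx _ mL] that c0(4) by (simp add: small_def L_def)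
  have nM: "L1 \<le> n"
    using c0(4) mL by (simp add: L_def)
  define c1 where "c1 = den read_symbol c"
  define c2 where "c2 = den (store flag_expr) c1"
  define c3 where "c3 = den extend c2"
  define c4 where "c4 = den hit c3"
  define c5 where "c5 = den (Assign 17 (Var 17 [-] Num 1)) c4"
  have res: "den (countdown 17 pass2) c = c5"
    by (simp only: countdown_def pass2_def den.simps(6) c5_def c4_def c3_def c2_def c1_def)
  have k1: "known c1" unfolding c1_def using c0(3) by (subst known_den) (simp_all add: wf_pass2 read_symbol_def[THEN arg_cong[where f = assigned]] read_symbol_def[THEN arg_cong[where f = arrays]])
  have r1: "cursor (Suc i) c1" "stream c1 = drop (Suc i) S" "emitted c1 = emitted c"
    unfolding c1_def using read_symbol[OF coreD(1,2)[OF c0(1)] str i] by blast+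
  have e1: "env c1" unfolding c1_def using coreD(1)[OF c0(1)] by (subst env_den) (simp_all add: read_symbol_def)
  have core2: "core flagged (Suc i) c2"
    unfolding c2_def c1_def
  proof (rule advance[OF c0(1) str i])
    show "eval flag_expr (mem (den read_symbol c)) = (if flagged (Suc i div B) then 1 else 0)"
      using eval_flag_expr[OF k1] r1(1) e1 by (simp add: c1_def cursor_def env_def)
  qed
  have k2: "known c2" unfolding c2_def using k1 by (subst known_den) (simp_all add: wf_pass2, simp_all add: store_def save_def)
  have s2: "stream c2 = drop (Suc i) S" "emitted c2 = emitted c"
    unfolding c2_def using silent_den[OF silent_store(1), of flag_expr c1] r1 by simp_all
  have keep2: "mem c2 v = mem c v" if "v = 10 \<or> v = 13" for v
    unfolding c2_def c1_def using that
    by (auto simp: den_unassigned read_symbol_def[THEN arg_cong[where f = assigned]]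
        store_def[THEN arg_cong[where f = assigned]] save_def)
  have list2: "mem c2 (addr 8 j) = mem c (addr 8 j)" for j
    unfolding c2_def c1_def
    by (simp add: mem_addr_den wf_pass2 read_symbol_def[THEN arg_cong[where f = arrays]]
        store_def[THEN arg_cong[where f = arrays]] save_def)
  define T where "T \<longleftrightarrow> 2 * L + 2 \<le> Suc i \<and> centered sy (Suc i - Suc L) (Suc L)"
  have fl: "flagged ((Suc i - (2 * L + 2)) div B)" if T
  proof (rule flagged_if_centered)
    have "Suc i - (2 * L + 2) + Suc L = Suc i - Suc L" using that unfolding T_def by linarith
    then show "centered sy (Suc i - (2 * L + 2) + Suc L) (Suc L)" using that by (simp add: T_def)
  qed (use that c0(4) i in \<open>simp_all add: T_def L_def\<close>)
  have c3: "c3 = (if T then c2\<lparr>mem := (mem c2)(10 := Suc L, 13 := 0)\<rparr> else c2)"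
  proof -
    have "den extend c2 = (if 2 * L + 2 \<le> Suc i \<and> flagged ((Suc i - (2 * L + 2)) div B) \<and> centered sy (Suc i - Suc L) (Suc L)
       then c2\<lparr>mem := (mem c2)(10 := Suc L, 13 := 0)\<rparr> else c2)"
    proof (rule extend[OF core2])
      show "Suc i \<le> n" using i by simp
      show "mem c2 10 = L" using keep2 by (simp add: L_def)
      show "Suc L < M" using LB nM M B by simp
      assume "2 * L + 2 \<le> Suc i"
      then show "nflags flagged (Suc (Suc i div B)) < nflags flagged (Suc ((Suc i - (2 * L + 2)) div B)) + 32"
        using LB by (intro flagged_near) auto
    qed
    then show ?thesis using fl unfolding c3_def T_def by auto
  qed
  define L' where "L' = (if T then Suc L else L)"
  have m3: "mem c3 10 = L'" using keep2[of 10] by (simp add: c3 L'_def L_def)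
  \<comment> \<open>In the small case the first pass was exact, so an extension is
    impossible.\<close>
  have not_small: "\<not> small" if T
  proof
    assume sm: small
    have "Suc L \<le> L1"
      using that i sm by (intro approxD(4)[OF approx, of "Suc i - Suc L"]) (auto simp: T_def small_def)
    then show False using Lsmall[OF sm] by simp
  qed
  have att': "\<exists>m. centered sy m L' \<and> m + L' \<le> n"
  proof (cases T)
    case True
    then show ?thesis using i by (intro exI[of _ "Suc i - Suc L"]) (auto simp: L'_def T_def)
  next
    case False
    then show ?thesis using mL by (auto simp: L'_def)
  qed
  have L'B: "L' < L1 + B" using att' approx_bound[OF approx] by blast
  have bd': "e \<le> L'" if e: "centered sy m e" "m + e \<le> Suc i" for m e
  proof (rule ccontr)
    assume ne: "\<not> e \<le> L'"
    then have "\<not> e \<le> L" by (simp add: L'_def split: if_splits)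
    have "m + e = Suc i" using bd[OF e(1)] \<open>\<not> e \<le> L\<close> e(2) by (fastforce simp: L_def)
    have "centered sy m (e - 1)" using e by (auto intro: centered_mono)
    then have "e - 1 \<le> L" using bd[of m "e - 1"] \<open>m + e = Suc i\<close> \<open>\<not> e \<le> L\<close> by (simp add: L_def)
    then have eL: "e = Suc L" using \<open>\<not> e \<le> L\<close> by simp
    moreover have "e \<le> m" using e by (simp add: centered_def)
    moreover have "m = Suc i - Suc L" using eL \<open>m + e = Suc i\<close> by simp
    ultimately have T using e(1) \<open>m + e = Suc i\<close> by (auto simp: T_def)
    then show False using ne eL by (simp add: L'_def)
  qed
  have rep3: "report i c3"
  proof (cases T)
    case True
    \<comment> \<open>Up to \<open>i\<close> no palindrome has length \<open>Suc L\<close>, so the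
      emptied list is correct for the new length.\<close>
    have "centers (Suc L) i = {}" using bd by (force simp: centers_def L_def)
    then show ?thesis
      using True not_small s2 c0(5) by (simp add: report_def c3)
  next
    case False
    have "mem c2 10 = mem c 10" "mem c2 13 = mem c 13" using keep2 by simp_all
    then have "report i c2 = report i c" by (simp only: report_def s2(2) list2)
    then show ?thesis using False c0(5) by (simp add: c3)
  qed
  have core3: "core flagged (Suc i) c3"
    unfolding c3_def using core2 by (subst core_den) (simp_all add: wf_pass2, simp_all add: extend_def test_at_def)
  have k3: "known c3"
    unfolding c3_def using k2 by (subst known_den) (simp_all add: wf_pass2, simp_all add: extend_def test_at_def)
  have s3: "stream c3 = drop (Suc i) S" by (simp add: c3 s2)
  let ?p = "Branch (Var 12) (Output (Var 6 [-] Var 10))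
           (Put 8 (Var 13) (Var 6 [-] Var 10) ;; Assign 13 (Var 13 [+] Num 1))"
  define H where "H \<longleftrightarrow> 2 * L' \<le> Suc i \<and> centered sy (Suc i - L') L'"
  have fl': "flagged ((Suc i - 2 * L') div B)" if H
  proof (rule flagged_if_centered)
    have "Suc i - 2 * L' + L' = Suc i - L'" using that unfolding H_def by linarith
    then show "centered sy (Suc i - 2 * L' + L') L'" using that by (simp add: H_def)
  qed (use that c0(4) i in \<open>auto simp: H_def L'_def L_def\<close>)
  have c4: "c4 = (if H then den ?p c3 else c3)"
  proof -
    have "den hit c3 = (if 2 * L' \<le> Suc i \<and> flagged ((Suc i - 2 * L') div B) \<and> centered sy (Suc i - L') L'
       then den ?p c3 else c3)"
    proof (rule hit[OF core3 _ m3])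
      show "Suc i \<le> n" using i by simp
      assume "2 * L' \<le> Suc i"
      then show "nflags flagged (Suc (Suc i div B)) < nflags flagged (Suc ((Suc i - 2 * L') div B)) + 32"
        using L'B by (intro flagged_near) auto
    qed
    then show ?thesis using fl' unfolding c4_def H_def by auto
  qed
  have new: "centers L' (Suc i) = (if H then insert (Suc i - L') (centers L' i) else centers L' i)"
  proof -
    have "m + L' = Suc i \<and> centered sy m L' \<and> 1 \<le> m \<longleftrightarrow> H \<and> m = Suc i - L'" for m
    proof
      assume m: "m + L' = Suc i \<and> centered sy m L' \<and> 1 \<le> m"
      then have "m = Suc i - L'" by linarith
      moreover have "L' \<le> m" using m by (simp add: centered_def)
      ultimately show "H \<and> m = Suc i - L'" using m unfolding H_def by auto
    next
      assume m: "H \<and> m = Suc i - L'"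
      then have "1 \<le> m" "m + L' = Suc i" unfolding H_def by linarith+
      then show "m + L' = Suc i \<and> centered sy m L' \<and> 1 \<le> m" using m unfolding H_def by blast
    qed
    then have "m \<in> centers L' (Suc i) \<longleftrightarrow> m \<in> centers L' i \<or> H \<and> m = Suc i - L'" for m
      unfolding centers_def mem_Collect_eq le_Suc_eq by blast
    then show ?thesis by auto
  qed
  have fresh: "Suc i - L' \<notin> centers L' i" by (auto simp: centers_def)
  have regs3: "mem c3 6 = Suc i" "mem c3 2 = M" "mem c3 1 = 64 * B" using coreD(4)[OF core3] by blast+
  have rep4: "report (Suc i) c4 \<and> mem c4 10 = L' \<and> stream c4 = drop (Suc i) S"
  proof (cases H)
    case False
    then show ?thesis using rep3 m3 s3 new by (simp add: c4 report_def Lsmall L'_def not_small split: if_splits)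
  next
    case True
    show ?thesis
    proof (cases small)
      case sm: True
      then have L'1: "L' = L1" using Lsmall not_small by (auto simp: L'_def)
      have "mem c3 12 \<noteq> 0" using k3 sm by (simp add: known_def)
      then have eq: "c4 = c3\<lparr>emitted := emitted c3 @ [Suc i - L']\<rparr>" using True regs3 m3 by (simp add: c4)
      obtain ms where "emitted c3 = L1 # ms" "set ms = centers L1 i" using rep3 sm by (auto simp: report_def)
      then show ?thesis using sm True new m3 s3 L'1 unfolding eq report_def
        by (auto intro!: exI[of _ "ms @ [Suc i - L']"])
    next
      case big: False
      define N where "N = mem c3 13"
      have N: "N = card (centers L' i)" "(\<lambda>j. mem c3 (addr 8 j)) ` {..<N} = centers L' i" "emitted c3 = []"
        using rep3 unfolding report_def m3 N_def if_not_P[OF big] by blast+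
      have "8 * B \<le> L'" using big c0(4) by (simp add: small_def L'_def L_def)
      \<comment> \<open>The limit of \<open>64 * B\<close> cells leaves room for one more
        centre.\<close>
      then have "N \<le> 2 * B" unfolding N(1) using i bd' by (intro card_centers) auto
      then have NB: "N < 64 * B" "Suc N < M" using B M by simp_all
      have "mem c3 12 = 0" using k3 big by (simp add: known_def)
      moreover have "Suc i - L' < M" using i M by simp
      ultimately have eq: "c4 = c3\<lparr>mem := (mem c3)(addr 8 N := Suc i - L', 13 := Suc N)\<rparr>"
        using True regs3 m3 NB by (simp add: c4 N_def[symmetric] addr_neq)
      have "mem c4 10 = L'" "mem c4 13 = Suc N" "emitted c4 = []" using m3 N by (simp_all add: eq addr_neq)
      moreover have "Suc N = card (centers L' (Suc i))" using new True fresh finite_centers N(1) by simp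
      moreover have "(\<lambda>j. mem c4 (addr 8 j)) ` {..<Suc N} = centers L' (Suc i)"
      proof -
        have "(\<lambda>j. mem c4 (addr 8 j)) ` {..<N} = (\<lambda>j. mem c3 (addr 8 j)) ` {..<N}"
          by (intro image_cong) (auto simp: eq addr_eq_iff addr_neq)
        moreover have "mem c4 (addr 8 N) = Suc i - L'" by (simp add: eq addr_neq)
        ultimately show ?thesis using N(2) new True by (simp add: lessThan_Suc)
      qed
      ultimately show ?thesis using big s3 by (simp add: report_def eq)
    qed
  qed
  have core4: "core flagged (Suc i) c4"
    unfolding c4_def using core3 by (subst core_den) (simp_all add: wf_pass2, simp_all add: hit_def test_at_def)
  have k4: "known c4"
    unfolding c4_def using k3 by (subst known_den) (simp_all add: wf_pass2, simp_all add: hit_def test_at_def)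
  have "core flagged (Suc i) c5"
    unfolding c5_def using core4 by (subst core_den) (simp_all add: variable_def)
  moreover have "known c5"
    unfolding c5_def using k4 by (subst known_den) (simp_all add: variable_def)
  moreover have "mem c5 10 = L'" "stream c5 = drop (Suc i) S" using rep4 by (simp_all add: c5_def)
  moreover have "report (Suc i) c5"
  proof -
    have "emitted c5 = emitted c4" "mem c5 13 = mem c4 13" "mem c5 10 = mem c4 10"
      "\<And>j. mem c5 (addr 8 j) = mem c4 (addr 8 j)" by (simp_all add: c5_def addr_neq)
    then have "report (Suc i) c5 = report (Suc i) c4" by (simp only: report_def)
    then show ?thesis using rep4 by blast
  qed
  moreover have "L1 \<le> L'" using c0(4) by (simp add: L'_def L_def)
  moreover have "\<forall>m e. centered sy m e \<and> m + e \<le> Suc i \<longrightarrow> e \<le> L'" using bd' by blast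
  ultimately show ?thesis unfolding res inv2_def using att' by simp
qed

lemma inv2_start:
  assumes c: "inv1 n c" "mem c 10 = L1" "best_of c = best"
  shows "inv2 0 (den start2 c)"
proof -
  have core0: "core (\<lambda>_. True) n c" and str: "stream c = S" "emitted c = []"
    using c(1) length_S by (simp_all add: inv1_def)
  define c1 where "c1 = den (Assign 12 (Num 1 [-] (Num 1 [-] (Num 8 [*] Var 4 [-] Var 10)))) c"
  define c2 where "c2 = den (Assign 11 (Var 10)) c1"
  define c3 where "c3 = den (Assign 13 (Num 0)) c2"
  define c4 where "c4 = den (Branch (Var 12) (Output (Var 10)) Nop) c3"
  define c5 where "c5 = den init_pass c4"
  define c6 where "c6 = den (store flag_expr) c5"
  have res: "den start2 c = c6" by (simp only: start2_def den.simps(6) c6_def c5_def c4_def c3_def c2_def c1_def)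
  obtain m where m: "centered sy m L1" "m + L1 \<le> n" using approxD(1)[OF approx] by blast
  have regs: "mem c 4 = B" "mem c 2 = M" using coreD(4)[OF core0] by blast+
  have L1M: "L1 < M" "1 < M" using m M B by simp_all
  have c3: "c3 = c\<lparr>mem := (mem c)(12 := if small then 1 else 0, 11 := L1, 13 := 0)\<rparr>"
    unfolding c3_def c2_def c1_def small_def using regs c(2) L1M by (cases "L1 < 8 * B") simp_all
  have c4: "c4 = c3\<lparr>emitted := if small then [L1] else []\<rparr>"
    using str c(2) by (cases c; cases small) (simp_all add: c4_def c3)
  have env4: "env c4" unfolding c4 c3 using coreD(1)[OF core0] by (simp add: env_def)
  note 5 = init_pass(1)[OF env4, folded c5_def] init_pass(2)[OF env4, folded c5_def]
    init_pass(3)[OF env4, of flagged, folded c5_def]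
  have k4: "known c4" unfolding c4 c3 known_def using c(3) by (simp add: best_of_def addr_neq)
  have wf: "wf_com init_pass" by (simp add: init_pass_def variable_def)
  have k5: "known c5" unfolding c5_def using k4 wf by (subst known_den) (simp_all, simp_all add: init_pass_def)
  have k6: "known c6" unfolding c6_def using k5 by (subst known_den) (simp_all add: wf_pass2, simp_all add: store_def save_def)
  have core6: "core flagged 0 c6"
    unfolding c6_def using eval_flag_expr[OF k5] 5(1,2) by (intro start_core 5) (simp add: cursor_def env_def)
  have keep: "mem c6 10 = mem c4 10" "mem c6 13 = mem c4 13"
    unfolding c6_def c5_def
    by (simp_all add: den_unassigned init_pass_def[THEN arg_cong[where f = assigned]]
        store_def[THEN arg_cong[where f = assigned]] save_def)
  have "silent init_pass" by (simp add: init_pass_def)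
  then have st: "stream c6 = stream c4" "emitted c6 = emitted c4"
    unfolding c6_def c5_def by (simp_all add: silent_den silent_store)
  have m10: "mem c6 10 = L1" and m13: "mem c6 13 = 0" using keep c(2) by (simp_all add: c4 c3)
  have e: "emitted c6 = (if small then [L1] else [])" and s: "stream c6 = S" using st str by (simp_all add: c4 c3)
  have "centers L1 0 = {}" by (auto simp: centers_def)
  then have "report 0 c6" unfolding report_def using e m10 m13 by simp
  then show ?thesis unfolding res inv2_def using core6 k6 m10 s m by auto
qed

lemma inv2_end:
  assumes "inv1 n c" "mem c 10 = L1" "best_of c = best"
  shows "inv2 n ((den (countdown 17 pass2) ^^ n) (den start2 c))"
  by (rule funpow_invariant[where I = inv2]) (auto intro: inv2_start inv2_step assms)

text \<open>Register 17 counts down from the value of 13, so \<open>Var 13 [-] Var 17\<close> runs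
  through the indices from 0 upwards.\<close>

lemma list_loop:
  assumes c: "mem c 2 = M" "mem c 17 = N" "mem c 13 = N" "N < M"
  shows "emitted ((den (countdown 17 list_center) ^^ N) c) = emitted c @ map (\<lambda>j. mem c (addr 8 j)) [0..<N]"
proof -
  let ?c = "\<lambda>j. c\<lparr>mem := (mem c)(17 := N - j), emitted := emitted c @ map (\<lambda>j. mem c (addr 8 j)) [0..<j]\<rparr>"
  have "(den (countdown 17 list_center) ^^ N) c = ?c N"
  proof (rule funpow_invariant[where I = "\<lambda>j d. d = ?c j"])
    show "c = ?c 0" using c by (cases c) auto
  next
    fix j d assume j: "j < N" and d: "d = ?c j"
    have "N - (N - j) = j" "N - j - 1 < M" using j c by simp_all
    then show "den (countdown 17 list_center) d = ?c (Suc j)"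
      using j c unfolding d by (simp add: countdown_def list_center_def addr_neq)
  qed
  then show ?thesis by simp
qed

lemma final_report:
  assumes c: "inv1 n c" "mem c 10 = L1" "best_of c = best" and n: "1 \<le> n"
    and d: "d = den start3 ((den (countdown 17 pass2) ^^ n) (den start2 c))"
  shows "correct_report S (emitted ((den (countdown 17 list_center) ^^ mem d 17) d))"
proof -
  define e where "e = (den (countdown 17 pass2) ^^ n) (den start2 c)"
  have inv: "inv2 n e" unfolding e_def using c by (rule inv2_end)
  have e: "core flagged n e" "known e" "L1 \<le> mem e 10" "report n e"
    and att: "\<exists>m. centered sy m (mem e 10) \<and> m + mem e 10 \<le> n"
    and bd: "\<And>m l. centered sy m l \<Longrightarrow> m + l \<le> n \<Longrightarrow> l \<le> mem e 10"
    using inv unfolding inv2_def by blast+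
  define L where "L = mem e 10"
  obtain mL where mL: "centered sy mL L" "mL + L \<le> n" using att unfolding L_def by blast
  have longest: "max_pal_length S = L" "{m \<in> {1..length S}. pal_length S m = max_pal_length S} = centers L n"
    using longest_palindromes[of S mL L] mL bd n length_S by (auto simp: L_def centers_def)
  have regs: "mem e 2 = M" "mem e 1 = 64 * B" using coreD(4)[OF e(1)] by blast+
  have d': "d = den start3 e" by (simp add: d e_def)
  show ?thesis
  proof (cases small)
    case True
    have LL: "L = L1" using approxD(4)[OF approx _ mL] True e(3) by (simp add: small_def L_def)
    have "mem e 12 \<noteq> 0" using e(2) True by (simp add: known_def)
    then have dd: "d = e\<lparr>mem := (mem e)(17 := 0)\<rparr>" unfolding d' start3_def by simp
    obtain ms where ms: "emitted e = L # ms" "set ms = centers L n"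
      using e(4) True unfolding report_def LL by auto
    have out: "emitted ((den (countdown 17 list_center) ^^ mem d 17) d) = L # ms" by (simp add: dd ms(1))
    show ?thesis unfolding correct_report_def out longest(2) using ms(2) by (simp add: longest(1))
  next
    case False
    define N where "N = mem e 13"
    have N: "N = card (centers L n)" "(\<lambda>j. mem e (addr 8 j)) ` {..<N} = centers L n" "emitted e = []"
      using e(4) unfolding report_def N_def L_def if_not_P[OF False] by blast+
    have "8 * B \<le> L" using False e(3) by (simp add: small_def L_def)
    then have "N \<le> 2 * B" unfolding N(1) using bd by (intro card_centers) (auto simp: L_def)
    then have NB: "N < 64 * B" "N < M" using B M by simp_all
    have "mem e 12 = 0" using e(2) False by (simp add: known_def)
    then have dd: "d = e\<lparr>emitted := [L], mem := (mem e)(17 := N)\<rparr>"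
      unfolding d' start3_def using regs NB N(3) by (simp add: N_def[symmetric] L_def)
    have "emitted ((den (countdown 17 list_center) ^^ N) d) = emitted d @ map (\<lambda>j. mem d (addr 8 j)) [0..<N]"
      using regs NB by (intro list_loop) (simp_all add: dd N_def)
    also have "\<dots> = L # map (\<lambda>j. mem e (addr 8 j)) [0..<N]" by (simp add: dd addr_neq)
    finally have out: "emitted ((den (countdown 17 list_center) ^^ mem d 17) d) = L # map (\<lambda>j. mem e (addr 8 j)) [0..<N]"
      by (simp add: dd)
    have "set (map (\<lambda>j. mem e (addr 8 j)) [0..<N]) = centers L n" using N(2) by (simp add: atLeast0LessThan)
    then show ?thesis unfolding correct_report_def out longest(2) by (simp add: longest(1))
  qed
qed

end

lemma (in two_pass) correct_final:
  assumes c: "env c" "stream c = S @ S" "emitted c = []" "\<And>k. mem c (addr 3 k) = 0" and n: "1 \<le> n"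
  shows "correct_report S (emitted (final n c))"
proof -
  have inv: "inv1 n (after_pass1 n c)" using c by (rule after_pass1)
  interpret second_pass S n M B md "mem (after_pass1 n c) 10" "best_of (after_pass1 n c)"
    by unfold_locales (use inv in \<open>simp add: inv1_def\<close>)
  show ?thesis
    unfolding final_def Let_def after_pass2_def using inv n by (intro final_report) auto
qed

section \<open>Resource bounds\<close>

text \<open>Variable 2, like variable 1, cannot be assigned by commands, so
  \<open>(C * n) ^ E\<close> is computed by a bare \<open>move\<close>. This number is the hash
  base, a bound on the symbols and the modulus of all assignments at once.\<close>

definition palindrome_prog :: "nat \<Rightarrow> nat \<Rightarrow> prog" where
  "palindrome_prog C E = Seq (move 2 (power_expr (Num C [*] Var 0) E))
     (Seq scale_prog (Seq (modulus_prog C) search_palindromes))"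

definition coms :: "nat \<Rightarrow> com list" where
  "coms C = [Assign 3 (Num 0) ;; Assign 17 (Var 0), countdown 17 grow, Assign 4 (Var 3 [*] Var 3),
     init_draws C, init_trial, countdown 23 trial, end_trial, init_search, end_search,
     start1, countdown 17 pass1, start2, countdown 17 pass2, start3, countdown 17 list_center]"

text \<open>The sum is just a common upper bound of all costs. It depends on \<open>C\<close> and
  \<open>E\<close> only, as powers are unrolled, and so is constant in \<open>n\<close>.\<close>

definition step_bound :: "nat \<Rightarrow> nat \<Rightarrow> nat" where
  "step_bound C E = cost (move 2 (power_expr (Num C [*] Var 0) E)) + cost (move 1 (Num 64 [*] Var 4)) +
     sum_list (map (\<lambda>p. cost (compile p)) (coms C))"

lemma max_const_move:
  "max_const (compile_expr 32 e) \<le> X \<Longrightarrow> max_const (move v e) \<le> X"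
proof -
  assume "max_const (compile_expr 32 e) \<le> X"
  moreover have "max_const (foldr (\<lambda>r. Seq (Const r 0)) rs Skip) = 0" for rs by (induction rs) auto
  ultimately show ?thesis by (simp add: move_def clear_temps_def)
qed

lemma max_const_power_expr:
  assumes "\<And>d. max_const (compile_expr d e) \<le> X" "1 \<le> X"
  shows "max_const (compile_expr d (power_expr e k)) \<le> X"
  by (induction k arbitrary: d) (use assms in auto)

lemma max_const_init_draws: "24 \<le> X \<Longrightarrow> C \<le> X \<Longrightarrow> max_const (compile (init_draws C)) \<le> X"
proof -
  assume X: "24 \<le> X" "C \<le> X"
  have "max_const (compile_expr d (power_expr (Var 19) 6)) \<le> X" for d
    using X by (intro max_const_power_expr) auto
  then show ?thesis using X by (auto simp: init_draws_def intro!: max_const_move)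
qed

text \<open>\<open>C\<close> has to dominate the constants of a program in which \<open>C\<close>
  itself occurs. Taking the commands at \<open>C = 0\<close> breaks this circle;
  \<open>init_draws\<close> is treated separately.\<close>

definition const_bound :: nat where
  "const_bound = sum_list (map (\<lambda>p. max_const (compile p)) (coms 0))"

lemma modest_coms:
  assumes "p \<in> set (coms C)" "24 \<le> X" "C \<le> X" "const_bound \<le> X"
  shows "modest (step_bound C E) X p"
proof -
  have "wf_com p" using assms(1) by (auto simp: coms_def wf_coms variable_def)
  moreover have "cost (compile p) \<le> step_bound C E"
    using member_le_sum_list[of "cost (compile p)" "map (\<lambda>p. cost (compile p)) (coms C)"] assms(1)
    by (auto simp: step_bound_def)
  moreover have "max_const (compile p) \<le> X"
  proof (cases "p = init_draws C")
    case True
    then show ?thesis using assms by (simp add: max_const_init_draws)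
  next
    case False
    then have "p \<in> set (coms 0)" using assms(1) by (auto simp: coms_def)
    then have "max_const (compile p) \<le> const_bound"
      using member_le_sum_list[of "max_const (compile p)" "map (\<lambda>p. max_const (compile p)) (coms 0)"]
      by (auto simp: const_bound_def)
    then show ?thesis using assms(4) by simp
  qed
  ultimately show ?thesis by (simp add: modest_def)
qed

definition total_time :: "nat \<Rightarrow> nat \<Rightarrow> nat \<Rightarrow> nat" where
  "total_time C E n = (let k = step_bound C E; y = C * root4 n in
     k + (3 * k + n * Suc k + 4) + (24 * (y * (y ^ 3 * Suc k + 2 * k + 6) + 2 * k + 4) + k + 2) +
     (3 * k + (2 * n + 64 * root4 n ^ 2) * Suc k + 8) + 3)"

definition total_space :: "nat \<Rightarrow> nat" where
  "total_space n = 64 + 16 * (64 * root4 n ^ 2)"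

text \<open>The first factor is the length of the bound on stored numbers;
  \<open>2 ^ step_bound C E\<close> pays for the squarings inside one command.\<close>

definition total_bits :: "nat \<Rightarrow> nat \<Rightarrow> nat \<Rightarrow> nat" where
  "total_bits C E n = (E * nat \<lceil>log 2 (real (C * n))\<rceil> + 1) * 2 ^ step_bound C E"

lemma word_size:
  assumes "1 \<le> C * n"
  shows "Suc ((C * n) ^ E) ^ (2 ^ step_bound C E) \<le> 2 ^ total_bits C E n"
proof -
  define t where "t = nat \<lceil>log 2 (real (C * n))\<rceil>"
  have "real (C * n) = 2 powr log 2 (real (C * n))" using assms by simp
  also have "\<dots> \<le> 2 powr real t" unfolding t_def by (intro powr_mono real_nat_ceiling_ge) simp
  also have "\<dots> = real (2 ^ t)" by (simp add: powr_realpow)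
  finally have "C * n \<le> 2 ^ t" by (simp only: of_nat_le_iff)
  then have "(C * n) ^ E \<le> (2 ^ t) ^ E" by (rule power_mono) simp
  also have "\<dots> = 2 ^ (E * t)" by (simp add: mult.commute flip: power_mult)
  finally have "(C * n) ^ E \<le> 2 ^ (E * t)" .
  moreover have "1 \<le> (2::nat) ^ (E * t)" by simp
  ultimately have "Suc ((C * n) ^ E) \<le> 2 ^ (E * t + 1)"
    unfolding power_add power_one_right by linarith
  then have "Suc ((C * n) ^ E) ^ (2 ^ step_bound C E) \<le> (2 ^ (E * t + 1)) ^ (2 ^ step_bound C E)"
    by (rule power_mono) simp
  then show ?thesis by (simp only: total_bits_def t_def power_mult)
qed

lemma palindrome_prog_correct:
  fixes S :: "nat list"
  assumes S: "length S = n" "\<And>x. x \<in> set S \<Longrightarrow> x < (C * n) ^ E" and n: "1 \<le> n"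
    and C: "128 \<le> C" "const_bound \<le> C" and E: "146 \<le> E"
    and small: "\<And>y::nat. C \<le> y \<Longrightarrow> (1 - 1 / (12 * log 2 (real y))) powr real y +
      real y * (2 * real y ^ 4 + 1) * (real (4 * E) * log 2 (real y)) / real y ^ 6 \<le> real y powr (-1/2)"
  shows "halts_within (total_time C E n) (start 2 (palindrome_prog C E) S)"
    and "uses_space (total_space n) (total_bits C E n) (start 2 (palindrome_prog C E) S)"
    and "measure_pmf.prob (output_after (total_time C E n) (start 2 (palindrome_prog C E) S))
      {out. correct_report S out} \<ge> 1 - 1 / real n"
proof -
  define M where "M = (C * n) ^ E"
  define k where "k = step_bound C E"
  define s where "s = total_space n"
  define b where "b = total_bits C E n"
  define r where "r = root4 n"
  define y where "y = C * r"
  define l where "l = 64 * r ^ 2"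
  have Cn: "2 \<le> C * n" "C \<le> C * n" "1 \<le> C * n"
  proof -
    have "C * 1 \<le> C * n" using n by (rule mult_le_mono2)
    then show "2 \<le> C * n" "C \<le> C * n" "1 \<le> C * n" using C by linarith+
  qed
  interpret resources s b k n M
    by unfold_locales (use word_size[OF Cn(3), of E] in \<open>simp add: M_def k_def b_def\<close>)
  have r4: "n \<le> r ^ 4" "r \<le> n" using root4[of n] root4_le_self[of n] by (simp_all add: r_def)
  have r1: "1 \<le> r" using r4(1) n by (cases r) auto
  \<comment> \<open>The product of 24 factors up to \<open>y ^ 6\<close> is at most
    \<open>(C * n) ^ 144\<close>, which requires \<open>E\<close> to exceed 144.\<close>
  have M144: "(C * n) ^ (6 * 24) < M"
    unfolding M_def using Cn(1) E by (intro power_strict_increasing) auto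
  have M3: "(C * n) ^ 3 < M"
    unfolding M_def using Cn(1) E by (intro power_strict_increasing) auto
  have "(C * n) ^ 1 \<le> (C * n) ^ 3" using Cn by (intro power_increasing) auto
  then have M1: "C * n < M" using M3 unfolding power_one_right by (rule le_less_trans)
  have n2: "n \<le> n ^ 2" "r ^ 2 \<le> n ^ 2" using n r4(2) by (auto simp: self_le_power power_mono)
  have "(C * n) ^ 2 \<le> (C * n) ^ 3" using Cn by (intro power_increasing) auto
  \<comment> \<open>128 covers the \<open>1 + 64\<close> from \<open>n + 64 * r ^ 2\<close>, where
    both \<open>n\<close> and \<open>r ^ 2\<close> are at most \<open>n ^ 2\<close>.\<close>
  moreover have "128 * n ^ 2 \<le> (C * n) ^ 2"
  proof -
    have "128 * n ^ 2 \<le> C * n ^ 2" using C by (intro mult_le_mono1)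
    also have "\<dots> \<le> C ^ 2 * n ^ 2" using C by (intro mult_le_mono1) (simp add: self_le_power)
    finally show ?thesis by (simp add: power_mult_distrib)
  qed
  ultimately have big: "n + 64 * r ^ 2 < M" using M3 n2 by linarith
  have yn: "y \<le> C * n" unfolding y_def using r4(2) by (rule mult_le_mono2)
  have "C * 1 \<le> C * r" using r1 by (rule mult_le_mono2)
  then have yC: "C \<le> y" by (simp add: y_def)
  have y2: "2 \<le> y" using yC C by simp
  have yM: "(y ^ 6) ^ 24 < M"
  proof -
    have "(y ^ 6) ^ 24 \<le> ((C * n) ^ 6) ^ 24" by (intro power_mono yn) simp_all
    also have "\<dots> = (C * n) ^ (6 * 24)" by (rule power_mult[symmetric])
    also note M144
    finally show ?thesis .
  qed
  have modest: "modest k M p" if "p \<in> set (coms C)" for p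
    unfolding k_def using that C Cn M1 by (intro modest_coms) linarith+
  define c0 where "c0 = start 2 (palindrome_prog C E) S"
  have c0: "mem c0 = (\<lambda>_. 0)(0 := n)" "stream c0 = S @ S" "emitted c0 = []"
    by (simp_all add: c0_def start_def S numeral_2_eq_2)
  have c0_todo: "c0 = c0\<lparr>todo := [palindrome_prog C E]\<rparr>"
    by (simp add: c0_def start_def)
  have s64: "64 \<le> s" "64 + 16 * l \<le> s" by (simp_all add: s_def total_space_def l_def r_def)
  have syms: "x \<in> set S \<Longrightarrow> x < Suc M" for x using S(2)[of x] by (simp add: M_def)
  have b0: "bounded s (Suc M) c0"
  proof -
    have "n < Suc M" using big by simp
    then show ?thesis using syms s64 by (auto simp: bounded_def c0)
  qed
  let ?base = "move 2 (power_expr (Num C [*] Var 0) E)"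
  define c1 where "c1 = c0\<lparr>mem := (mem c0)(2 := M)\<rparr>"
  have nt: "no_temps (mem c0)" by (simp add: no_temps_def c0)
  have fit: "fits 32 (power_expr (Num C [*] Var 0) E)" by (intro fits_power_expr) simp
  have c1: "sem ?base c0 = c1" using sem_move[OF fit _ s64(1) nt, of 2] by (simp add: c1_def M_def c0)
  have R1: "runs s b k ?base c0 (return_pmf c1)"
    unfolding c1[symmetric]
  proof (rule runs_move[OF fit _ s64(1) nt b0])
    show "cost ?base \<le> k" by (simp add: k_def step_bound_def)
    have "C \<le> M" using Cn(2) M1 by linarith
    then show "max_const ?base \<le> M" using C(1) by (intro max_const_move max_const_power_expr) auto
  qed (use big in auto)
  have reg1: "regular s n 0 M c1"
    using b0 nt s64 big unfolding c1_def regular_def by (auto simp: c0 bounded_def no_temps_def)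
  define c2 where "c2 = c1\<lparr>mem := (mem c1)(3 := r, 17 := 0, 4 := r ^ 2, 1 := l)\<rparr>"
  have scale: "runs s b (3 * k + n * Suc k + 4) scale_prog c1 (return_pmf c2)" "regular s n l M c2"
    unfolding c2_def l_def r_def
    by (rule runs_scale; use reg1 big n s64 modest in \<open>simp add: coms_def k_def step_bound_def r_def l_def\<close>)+
  define D where "D = prime_product (y ^ 6) y 24 1"
  define c3 where "c3 = (\<lambda>m. c2\<lparr>mem := (mem c2)(19 := y, 20 := y ^ 6, 5 := m)\<rparr>)"
  have modulus: "runs s b (24 * (y * (y ^ 3 * Suc k + 2 * k + 6) + 2 * k + 4) + k + 2) (modulus_prog C) c2 (map_pmf c3 D)"
    unfolding c3_def D_def
  proof (rule runs_modulus)
    show "regular s n l M c2" by (rule scale)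
    show "mem c2 v = 0" if "20 \<le> v" for v using that by (simp add: c2_def c1_def c0)
    show "y = C * mem c2 3" by (simp add: c2_def y_def)
    show "24 < M" using M1 Cn C by linarith
  qed (use modest yM y2 in \<open>simp_all add: coms_def\<close>)
  have mM: "0 < m \<and> m < M" if "m \<in> set_pmf D" for m
    using prime_product_bounds[OF that[unfolded D_def]] y2 yM by auto
  have "(y ^ 6) ^ 1 \<le> (y ^ 6) ^ 24" "y ^ 1 \<le> y ^ 6" using y2 by (intro power_increasing; simp)+
  then have yM': "y \<le> M" "y ^ 6 \<le> M" using yM by auto
  have reg3: "regular s n l M (c3 m)" if "m \<in> set_pmf D" for m
  proof -
    have "regular s n l M (c2\<lparr>mem := (mem c2)(19 := y)\<rparr>)"
      using yM' by (intro regular_update[OF scale(2)]) (auto simp: variable_def)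
    from regular_update[OF this, of 20 "y ^ 6"]
    have "regular s n l M (c2\<lparr>mem := (mem c2)(19 := y, 20 := y ^ 6)\<rparr>)" using yM' by (simp add: variable_def)
    from regular_update[OF this, of 5 m] show ?thesis
      using mM[OF that] by (simp add: c3_def variable_def)
  qed
  have lM: "n < M" "l < M" using big by (simp_all add: l_def)
  have search: "runs s b (3 * k + (2 * n + l) * Suc k + 8) search_palindromes (c3 m) (return_pmf (final n (c3 m)))"
      "safe s b (final n (c3 m))" if "m \<in> set_pmf D" for m
  proof -
    have small: "modest k M start1" "modest k M (countdown 17 pass1)" "modest k M start2"
      "modest k M (countdown 17 pass2)" "modest k M start3" "modest k M (countdown 17 list_center)"
      by (rule modest; simp add: coms_def)+
    show "runs s b (3 * k + (2 * n + l) * Suc k + 8) search_palindromes (c3 m) (return_pmf (final n (c3 m)))"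
        "safe s b (final n (c3 m))"
      by (rule runs_search_palindromes[OF small reg3[OF that] lM])+
  qed
  have R: "runs s b (total_time C E n) (palindrome_prog C E) c0
      (bind_pmf (map_pmf c3 D) (\<lambda>c. return_pmf (final n c)))"
  proof -
    have "runs s b (Suc (k + Suc ((3 * k + n * Suc k + 4) + Suc ((24 * (y * (y ^ 3 * Suc k + 2 * k + 6) + 2 * k + 4) + k + 2) +
        (3 * k + (2 * n + l) * Suc k + 8))))) (palindrome_prog C E) c0
      (bind_pmf (map_pmf c3 D) (\<lambda>c. return_pmf (final n c)))"
      unfolding palindrome_prog_def
    proof (rule runs_Seq_return[OF bounded_safe[OF b0 Suc_M_le] R1],
        rule runs_Seq_return[OF regular_safe[OF reg1] scale(1)],
        rule runs_Seq[OF regular_safe[OF scale(2)] modulus])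
      fix c' assume "c' \<in> set_pmf (map_pmf c3 D)"
      then obtain m where "m \<in> set_pmf D" "c' = c3 m" unfolding set_map_pmf by blast
      then show "runs s b (3 * k + (2 * n + l) * Suc k + 8) search_palindromes c' (return_pmf (final n c'))"
        using search(1) by simp
    qed
    then show ?thesis by (rule runs_mono) (simp add: total_time_def Let_def k_def y_def r_def l_def)
  qed
  also have "bind_pmf (map_pmf c3 D) (\<lambda>c. return_pmf (final n c)) = map_pmf (\<lambda>m. final n (c3 m)) D"
    by (simp add: map_pmf_def bind_assoc_pmf bind_return_pmf)
  finally have R: "runs s b (total_time C E n) (palindrome_prog C E) c0 (map_pmf (\<lambda>m. final n (c3 m)) D)" .
  let ?out = "\<lambda>m. emitted (final n (c3 m))"
  have "finishes s b (total_time C E n + 0) (c0\<lparr>todo := palindrome_prog C E # []\<rparr>)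
      (bind_pmf (map_pmf (\<lambda>m. final n (c3 m)) D) (\<lambda>c. return_pmf (emitted c)))"
  proof (rule runsD[OF R])
    fix c assume "c \<in> set_pmf (map_pmf (\<lambda>m. final n (c3 m)) D)"
    then obtain m where "m \<in> set_pmf D" "c = final n (c3 m)" unfolding set_map_pmf by blast
    then have "safe s b (c\<lparr>todo := []\<rparr>)" using search(2) by simp
    then have "finishes s b 0 (c\<lparr>todo := []\<rparr>) (return_pmf (emitted (c\<lparr>todo := []\<rparr>)))" by (intro finishes_halted) simp_all
    then show "finishes s b 0 (c\<lparr>todo := []\<rparr>) (return_pmf (emitted c))" by simp
  qed
  also have "bind_pmf (map_pmf (\<lambda>m. final n (c3 m)) D) (\<lambda>c. return_pmf (emitted c)) = map_pmf ?out D"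
    by (simp add: map_pmf_def bind_assoc_pmf bind_return_pmf)
  finally have fin: "finishes s b (total_time C E n) c0 (map_pmf ?out D)"
    by (simp only: add_0_right c0_todo[symmetric])
  note all = fin[unfolded finishes_def c0_def]
  note stopped = mp[OF spec[OF conjunct2[OF all]], OF order_refl]
  show "halts_within (total_time C E n) (start 2 (palindrome_prog C E) S)"
    unfolding halts_within_def by (rule conjunct1[OF stopped])
  show "uses_space (total_space n) (total_bits C E n) (start 2 (palindrome_prog C E) S)"
    using conjunct1[OF all] by (simp add: uses_space_def safe_def s_def b_def)
  have out: "output_after (total_time C E n) (start 2 (palindrome_prog C E) S) = map_pmf ?out D"
    unfolding output_after_def by (rule conjunct2[OF stopped])
  have correct: "correct_report S (?out m)" if m: "m \<in> set_pmf D" "faithful M (\<lambda>i. S ! i) n m" for m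
  proof -
    interpret two_pass S n M "r ^ 2" m
    proof
      show "S ! i < M" if "i < n" for i using S that by (simp add: M_def)
      have "r ^ 2 * r ^ 2 = r ^ 4" by (simp flip: power_add)
      then show "n \<le> r ^ 2 * r ^ 2" using r4 by simp
    qed (use S r1 mM[OF m(1)] m(2) big in auto)
    show ?thesis
    proof (rule correct_final)
      show "env (c3 m)" using reg3[OF m(1)] by (simp add: env_def c3_def c2_def regular_def l_def)
      show "mem (c3 m) (addr 3 j) = 0" for j by (simp add: c3_def c2_def c1_def c0 addr_neq addr_def)
    qed (use n in \<open>simp_all add: c3_def c2_def c1_def c0\<close>)
  qed
  have "1 - 1 / real n \<le> measure_pmf.prob D {m. faithful M (\<lambda>i. S ! i) n m}"
    unfolding D_def
  proof (rule prob_faithful)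
    show "S ! t < M" if "t < n" for t using S that by (simp add: M_def)
    show "2 \<le> M" using Cn M1 by simp
    \<comment> \<open>The failure estimate needs \<open>M\<close> to be bounded by a power of
      \<open>y\<close>; this is the base of that comparison.\<close>
    have "C * n \<le> C ^ 4 * r ^ 4" using r4 C by (intro mult_le_mono) (auto simp: self_le_power)
    also have "\<dots> = y ^ 4" by (simp add: y_def power_mult_distrib)
    finally have Cy: "C * n \<le> y ^ 4" .
    then show "M \<le> y ^ (4 * E)" unfolding M_def power_mult by (intro power_mono) auto
    have "1 * n \<le> C * n" using C by (intro mult_le_mono1) simp
    then have "n \<le> C * n" by (simp only: mult_1)
    then show "n \<le> y ^ 4" using Cy by (rule le_trans)
    show "0 < n" using n by simp
    show "2 \<le> y" by (rule y2)
    show "(1 - 1 / (12 * log 2 (real y))) powr real y +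
      real y * (2 * real y ^ 4 + 1) * (real (4 * E) * log 2 (real y)) / real y ^ 6 \<le> real y powr (-1/2)"
      using yC by (rule small)
  qed
  \<comment> \<open>Correctness is known only for moduli that can be drawn, so the event is cut down
    to the support.\<close>
  also have "\<dots> = measure_pmf.prob D ({m. faithful M (\<lambda>i. S ! i) n m} \<inter> set_pmf D)"
    by (simp add: measure_Int_set_pmf)
  also have "\<dots> \<le> measure_pmf.prob D (?out -` {out. correct_report S out})"
    using correct by (intro measure_pmf.finite_measure_mono) auto
  also have "\<dots> = measure_pmf.prob (map_pmf ?out D) {out. correct_report S out}" by simp
  finally show "measure_pmf.prob (output_after (total_time C E n) (start 2 (palindrome_prog C E) S))
      {out. correct_report S out} \<ge> 1 - 1 / real n" unfolding out .
qed

section \<open>Asymptotics of time, space and word length\<close>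

lemma root4_less: "0 < n \<Longrightarrow> root4 n ^ 4 \<le> 16 * n"
proof -
  assume n: "0 < n"
  have "0 < root4 n" using root4[of n] n by (cases "root4 n") auto
  then obtain q where q: "root4 n = Suc q" by (cases "root4 n") auto
  have "q ^ 4 < n" using root4_le[of n q] q by linarith
  show ?thesis
  proof (cases "q = 0")
    case True
    then show ?thesis using n by (simp add: q)
  next
    case False
    then have "Suc q ^ 4 \<le> (2 * q) ^ 4" by (intro power_mono) auto
    then show ?thesis using \<open>q ^ 4 < n\<close> by (simp add: q power_mult_distrib)
  qed
qed

lemma root4_square: "real (root4 n ^ 2) \<le> 4 * sqrt (real n)"
proof (cases "n = 0")
  case True
  then show ?thesis using root4_le_self[of 0] by simp
next
  case False
  then have "(real (root4 n ^ 2)) ^ 2 \<le> 16 * real n"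
    using root4_less[of n] by (simp flip: power_mult of_nat_power of_nat_mult)
  then have "real (root4 n ^ 2) \<le> sqrt (16 * real n)" by (rule real_le_rsqrt)
  then show ?thesis by (simp add: real_sqrt_mult)
qed


text \<open>The critical term is the trial division, \<open>24 * y * y ^ 3\<close>, which is linear
  since \<open>y ^ 4 = C ^ 4 * root4 n ^ 4\<close>.\<close>

lemma time_bigo: "1 \<le> C \<Longrightarrow> (\<lambda>n. real (total_time C E n)) \<in> O(\<lambda>n. real n)"
proof -
  assume C: "1 \<le> C"
  define k where "k = step_bound C E"
  define K where "K = 56 * k + 91 * Suc k + 24 * (2 * k + 6) + 113"
  have "real (total_time C E n) \<le> real (K * (16 * C ^ 4)) * real n" if n: "1 \<le> n" for n
  proof -
    define r where "r = root4 n"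
    define y where "y = C * r"
    define z where "z = 16 * C ^ 4 * n"
    have r4: "r ^ 4 \<le> 16 * n" using root4_less[of n] n by (simp add: r_def)
    have C4: "1 \<le> C ^ 4" using C by simp
    have nz: "16 * n \<le> z" using mult_le_mono1[OF C4, of "16 * n"] by (simp add: z_def mult_ac)
    have yz: "y * y ^ 3 \<le> z"
    proof -
      have "y * y ^ 3 = y ^ 4" by (simp add: power3_eq_cube power4_eq_xxxx mult.assoc)
      also have "\<dots> = C ^ 4 * r ^ 4" unfolding y_def by (rule power_mult_distrib)
      also have "\<dots> \<le> C ^ 4 * (16 * n)" using r4 by (rule mult_le_mono2)
      finally show ?thesis by (simp add: z_def mult_ac)
    qed
    have "y \<le> y * y ^ 3" by (cases "y = 0") simp_all
    then have y1: "y \<le> z" using yz by (rule le_trans)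
    have "r ^ 2 \<le> r ^ 4" by (cases "r = 0") (auto intro: power_increasing)
    then have rz: "r ^ 2 \<le> z" using r4 nz by linarith
    have z1: "1 \<le> z" "n \<le> z" using nz n by linarith+
    have "total_time C E n = 56 * (1 * k) + 3 * (n * Suc k) + 24 * (y * y ^ 3 * Suc k) + 24 * (y * (2 * k + 6)) +
        64 * (r ^ 2 * Suc k) + 113 * 1"
      by (simp add: total_time_def Let_def k_def[symmetric] r_def[symmetric] y_def[symmetric] algebra_simps)
    also have "\<dots> \<le> 56 * (z * k) + 3 * (z * Suc k) + 24 * (z * Suc k) + 24 * (z * (2 * k + 6)) + 64 * (z * Suc k) + 113 * z"
      by (intro add_mono mult_le_mono2 mult_le_mono1 z1 yz y1 rz)
    also have "\<dots> = K * (16 * C ^ 4) * n" by (simp add: K_def z_def algebra_simps)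
    finally have "total_time C E n \<le> K * (16 * C ^ 4) * n" .
    then have "real (total_time C E n) \<le> real (K * (16 * C ^ 4) * n)" by (rule of_nat_mono)
    then show ?thesis by (simp only: of_nat_mult)
  qed
  then show ?thesis
    by (intro bigoI[of _ "real (K * (16 * C ^ 4))"]) (auto intro: eventually_mono[OF eventually_ge_at_top[of 1]])
qed

lemma space_bigo: "(\<lambda>n. real (total_space n)) \<in> O(\<lambda>n. sqrt (real n))"
proof (rule bigoI)
  show "\<forall>\<^sub>F n in at_top. norm (real (total_space n)) \<le> 4160 * norm (sqrt (real n))"
    using eventually_ge_at_top[of 1]
  proof eventually_elim
    case (elim n)
    then have "1 \<le> sqrt (real n)" by simp
    moreover have "real (total_space n) = 64 + 1024 * real (root4 n ^ 2)" by (simp add: total_space_def)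
    ultimately have "real (total_space n) \<le> 4160 * sqrt (real n)" using root4_square[of n] by linarith
    then show ?case by simp
  qed
qed

lemma bits_bigo: "1 \<le> C \<Longrightarrow> (\<lambda>n. real (total_bits C E n)) \<in> O(\<lambda>n. ln (real n))"
proof (rule bigoI)
  assume C: "1 \<le> C"
  define K where "K = (real E * (log 2 (real C) + 1 / ln 2 + 1) + 1) * 2 ^ step_bound C E"
  show "\<forall>\<^sub>F n in at_top. norm (real (total_bits C E n)) \<le> K * norm (ln (real n))"
    using eventually_ge_at_top[of 3]
  proof eventually_elim
    case (elim n)
    have "exp 1 \<le> real n" using exp_le elim by linarith
    then have "ln (exp 1) \<le> ln (real n)" using elim by (subst ln_le_cancel_iff) auto
    then have ln1: "1 \<le> ln (real n)" by simp
    have log0: "0 \<le> log 2 (real C)" using C by simp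
    have "log 2 (real (C * n)) = log 2 (real C) + log 2 (real n)" using C elim by (simp add: log_mult)
    moreover have "0 \<le> log 2 (real n)" using elim by simp
    ultimately have "real (nat \<lceil>log 2 (real (C * n))\<rceil>) \<le> log 2 (real C) + log 2 (real n) + 1" using log0 by linarith
    also have "\<dots> = log 2 (real C) + 1 / ln 2 * ln (real n) + 1" by (simp add: log_def)
    also have "\<dots> \<le> log 2 (real C) * ln (real n) + 1 / ln 2 * ln (real n) + 1 * ln (real n)"
      using ln1 log0 mult_left_mono[OF ln1 log0] by simp
    finally have t: "real (nat \<lceil>log 2 (real (C * n))\<rceil>) \<le> (log 2 (real C) + 1 / ln 2 + 1) * ln (real n)"
      by (simp only: distrib_right)
    have "real E * real (nat \<lceil>log 2 (real (C * n))\<rceil>) + 1 \<le> real E * ((log 2 (real C) + 1 / ln 2 + 1) * ln (real n)) + 1 * ln (real n)"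
      using t ln1 by (intro add_mono mult_left_mono) auto
    then have "(real E * real (nat \<lceil>log 2 (real (C * n))\<rceil>) + 1) * 2 ^ step_bound C E \<le>
        (real E * ((log 2 (real C) + 1 / ln 2 + 1) * ln (real n)) + 1 * ln (real n)) * 2 ^ step_bound C E"
      by (rule mult_right_mono) simp
    also have "\<dots> = K * ln (real n)" by (simp add: K_def algebra_simps)
    also have "(real E * real (nat \<lceil>log 2 (real (C * n))\<rceil>) + 1) * 2 ^ step_bound C E = real (total_bits C E n)"
      by (simp only: total_bits_def of_nat_mult of_nat_add of_nat_power of_nat_numeral of_nat_1)
    finally have "real (total_bits C E n) \<le> K * ln (real n)" .
    then show ?case using ln1 by simp
  qed
qed

text \<open>Logarithmic symbol length means a polynomial alphabet. \<open>A\<close> absorbs the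
  finitely many \<open>n\<close> below the asymptotic threshold, since the bound is wanted for every
  \<open>n \<ge> 1\<close>.\<close>

lemma alphabet_bound:
  fixes w :: "nat \<Rightarrow> nat"
  assumes "(\<lambda>n. real (w n)) \<in> O(\<lambda>n. ln (real n))"
  shows "\<exists>A e. \<forall>n\<ge>1. 2 ^ w n \<le> A * n ^ e"
proof -
  obtain c where c: "eventually (\<lambda>n. norm (real (w n)) \<le> c * norm (ln (real n))) at_top"
    using assms by (elim landau_o.bigE) auto
  then obtain N where N: "\<And>n. N \<le> n \<Longrightarrow> real (w n) \<le> c * \<bar>ln (real n)\<bar>"
    by (auto simp: eventually_at_top_linorder)
  define e where "e = nat \<lceil>c\<rceil>"
  define A where "A = (\<Sum>i<N. 2 ^ w i) + (1::nat)"
  have "2 ^ w n \<le> A * n ^ e" if n: "1 \<le> n" for n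
  proof (cases "n < N")
    case True
    have "2 ^ w n \<le> (\<Sum>i<N. 2 ^ w i :: nat)" using True by (intro member_le_sum) auto
    then have "2 ^ w n \<le> A" by (simp add: A_def)
    moreover have "A * 1 \<le> A * n ^ e" using n by (intro mult_le_mono2) simp
    ultimately show ?thesis by linarith
  next
    case False
    have ln0: "0 \<le> ln (real n)" using n by simp
    have "real (w n) \<le> c * ln (real n)" using N[of n] False ln0 by simp
    also have "\<dots> \<le> real e * ln (real n)" using ln0 unfolding e_def by (intro mult_right_mono real_nat_ceiling_ge)
    finally have "exp (real (w n)) \<le> exp (real e * ln (real n))" by simp
    also have "\<dots> = real n ^ e" using n by (simp add: exp_of_nat_mult)
    finally have "exp 1 ^ w n \<le> real n ^ e" by (simp flip: exp_of_nat_mult)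
    moreover have "2 ^ w n \<le> (exp 1 :: real) ^ w n"
      using exp_ge_add_one_self[of 1] by (intro power_mono) auto
    ultimately have "real (2 ^ w n) \<le> real (n ^ e)" by simp
    then have "2 ^ w n \<le> n ^ e" by (simp only: of_nat_le_iff)
    also have "\<dots> \<le> A * n ^ e" by (simp add: A_def)
    finally show ?thesis .
  qed
  then show ?thesis by blast
qed

theorem theorem2:
  fixes w :: "nat \<Rightarrow> nat"
  assumes symbols_fit_registers: "(\<lambda>n. real (w n)) \<in> O(\<lambda>n. ln (real n))"
  shows "\<exists>(P :: prog) (time :: nat \<Rightarrow> nat) (space :: nat \<Rightarrow> nat) (bits :: nat \<Rightarrow> nat).
    (\<lambda>n. real (time n)) \<in> O(\<lambda>n. real n) \<and>
    (\<lambda>n. real (space n)) \<in> O(\<lambda>n. sqrt (real n)) \<and>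
    (\<lambda>n. real (bits n)) \<in> O(\<lambda>n. ln (real n)) \<and>
    (\<forall>n\<ge>1. \<forall>S :: nat list. length S = n \<and> set S \<subseteq> {..<2 ^ w n} \<longrightarrow>
       halts_within (time n) (start 2 P S) \<and>
       uses_space (space n) (bits n) (start 2 P S) \<and>
       measure_pmf.prob (output_after (time n) (start 2 P S)) {out. correct_report S out}
         \<ge> 1 - 1 / real n)"
proof -
  obtain A e :: nat where w: "\<And>n. 1 \<le> n \<Longrightarrow> 2 ^ w n \<le> A * n ^ e"
    using alphabet_bound[OF symbols_fit_registers] by blast
  \<comment> \<open>\<open>e\<close> covers the alphabet, 146 the product of 24 primes.\<close>
  define E where "E = e + 146"
  obtain y0 :: real where y0: "\<And>y. y0 \<le> y \<Longrightarrow> (1 - 1 / (12 * log 2 y)) powr y +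
      y * (2 * y ^ 4 + 1) * (real (4 * E) * log 2 y) / y ^ 6 \<le> y powr (-1/2)"
    using eventually_failure_small[of "real (4 * E)"] unfolding eventually_at_top_linorder by blast
  \<comment> \<open>Because \<open>y\<close> is at least \<open>C\<close> for every
    \<open>n \<ge> 1\<close>, the summand \<open>nat \<lceil>y0\<rceil>\<close> makes the asymptotic
    failure estimate hold for all of them. The other summands cover the array limit, the constants
    of the program and the alphabet.\<close>
  define C where "C = 128 + const_bound + A + nat \<lceil>y0\<rceil>"
  have C: "128 \<le> C" "const_bound \<le> C" "A \<le> C" "1 \<le> C" by (simp_all add: C_def)
  have small: "(1 - 1 / (12 * log 2 (real y))) powr real y +
      real y * (2 * real y ^ 4 + 1) * (real (4 * E) * log 2 (real y)) / real y ^ 6 \<le> real y powr (-1/2)"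
    if "C \<le> y" for y :: nat
  proof (rule y0)
    have "nat \<lceil>y0\<rceil> \<le> y" using that unfolding C_def by (rule add_leD2)
    then show "y0 \<le> real y" by linarith
  qed
  have alphabet: "x < (C * n) ^ E" if n: "1 \<le> n" and x: "x < 2 ^ w n" for n x
  proof -
    have Cn: "1 \<le> C * n" using C(4) n by simp
    have "A * n ^ e \<le> C * n ^ e" using C by (intro mult_le_mono1)
    also have "\<dots> \<le> C * (C * n) ^ e" using C by (intro mult_le_mono2 power_mono) auto
    also have "\<dots> \<le> (C * n) * (C * n) ^ e" using n by (intro mult_le_mono1) simp
    also have "\<dots> = (C * n) ^ Suc e" by simp
    also have "\<dots> \<le> (C * n) ^ E" using Cn by (intro power_increasing) (simp_all add: E_def)
    finally show ?thesis using x w[OF n] by linarith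
  qed
  have E: "146 \<le> E" by (simp add: E_def)
  have "halts_within (total_time C E n) (start 2 (palindrome_prog C E) S) \<and>
      uses_space (total_space n) (total_bits C E n) (start 2 (palindrome_prog C E) S) \<and>
      measure_pmf.prob (output_after (total_time C E n) (start 2 (palindrome_prog C E) S)) {out. correct_report S out}
        \<ge> 1 - 1 / real n"
    if n: "1 \<le> n" and S: "length S = n \<and> set S \<subseteq> {..<2 ^ w n}" for n S
  proof -
    have "x < (C * n) ^ E" if "x \<in> set S" for x using alphabet[OF n, of x] S that by auto
    from palindrome_prog_correct[OF _ this n C(1,2) E small] S show ?thesis by blast
  qed
  then show ?thesis
    using time_bigo[OF C(4), of E] space_bigo bits_bigo[OF C(4), of E] by blast
qed

end
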